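(* Let $W$ be a finite group acting on the right of a poset $\Sigma$, let $W_\bullet^e$ be a decreasing normal component structure, and let $R$ be a $W$-equivariant $\Sigma$-diagram of commutative rings. Then taking fixed points, $(\Psi M)(E)=M(E)^{W_E^e}$, gives a functor $$\Psi=\Psi^{W_\bullet^e}:\ W\text{-equivariant-}R\text{-modules}\longrightarrow R_{inv}\text{-modules}.$$ This has left adjoint $\theta_*$ given by termwise extension of scalars, $(\theta_*N)(E)=R(E)\otimes_{R_{inv}(E)}N(E)$. Provided $|W|$ is invertible in $R$, the unit map $$N(E)\longrightarrow \big(R(E)\otimes_{R_{inv}(E)}N(E)\big)^{W_E^e}=(\Psi\theta_*N)(E)$$ of the $\theta_*$, $\Psi$ adjunction is an isomorphism.
   Context: The poset $\Sigma$ is regarded as a category with a morphism $F\to E$ when $F\subseteq E$ (writing $\subseteq$ for the order), and $W$ acts on it by order-preserving maps $E\mapsto E^w$. The transport category $\Sigma\rtimes W$ has the same objects as $\Sigma$; for $i:\sigma\to\tau$ in $\Sigma$ and $v\in W$ it has a morphism $(i,v):\sigma\to\tau^v$, the composite of $i$ followed by the isomorphism $v:\tau\to\tau^v$, and the composite of $(i,v)$ followed by $(j,w)$ is $(ij^{v^{-1}},vw)$ (functions written on the right). The endomorphism group of $E$ in $\Sigma\rtimes W$ is the stabilizer $W_E$ of $E$. A $W$-equivariant $\Sigma$-diagram of commutative rings is a functor from $\Sigma\rtimes W$ to commutative rings, i.e. a functor $R$ on $\Sigma$ with compatible ring maps $w_m:R(E)\to R(E^w)$, with $e_m=1$ and $(vw)_m$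 being $v_m$ followed by $w_m$. A $W$-equivariant $R$-module is an $R$-module diagram $M$ on $\Sigma$ with additive maps $w_m:M(E)\to M(E^w)$, compatible with the structure maps, satisfying $w_m(\lambda x)=w_m(\lambda)w_m(x)$, $e_m=1$, and the same composition rule. A component structure $W_\bullet^e$ is a subcategory of $\Sigma\rtimes W$ with the same objects, containing $\Sigma$, whose morphisms are generated by those of $\Sigma$ together with automorphisms of objects; the endomorphism group of $E$ in it is written $W_E^e\le W_E$. It is normal if $W_E^e$ is normal in $W_E$ for every $E$. It is decreasing if $E\supseteq F$ implies $W_E^e\subseteq W_F^e$. For a normal component structure, the discrete residual $W_\bullet^d$ is the category with the same objects as $\Sigma$ whose morphisms are pairs $(i,[v])$ with $i:\sigma\to\tau$ in $\Sigma$ and $[v]$ the equivalence class of $v\in W$ under precomposition by $W_\tau^e$ and postcomposition by $W_{\tau^v}^e$, with composition induced from $\Sigma\rtimes W$; the endomorphism group of $E$ in it is $W_E^d=W_E/W_E^e$. Put $R_{inv}(E)=R(E)^{W_E^e}$; since the component structure is decreasing and normal, this is regarded as a $W_\bullet^d$-diagram of rings, with structure maps induced by those of $R$. An $R_{inv}$-module is a module over this $W_\bullet^d$-diagram of rings: $R_{inv}(E)$-modules $N(E)$, functorial on $W_\bullet^d$, with structure maps compatible with those of $R_{inv}$ (so that $W_E^e$ acts trivially on $N(E)$). The structure map of $\theta_*N$ for $E\supseteq F$ is the composite $R(F)\otimes_{R_{inv}(F)}N(F)\to R(E)\otimes_{R_{inv}(F)}N(F)\to R(E)\otimes_{R_{inv}(E)}N(E)$,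 and $W$ acts through both tensor factors.
   Formalization: The formal version also assumes that conjugation by w carries W_E^e onto the group of E^w, for all E and w in W. Normality of each W_E^e in W_E does not imply this, and without it composition in the discrete residual is not well defined and Ψ can fail. *)

theory Defs
  imports "HOL-Algebra.Module" "HOL-Algebra.Free_Abelian_Groups"
begin

section \<open>Categories and functors\<close>

record ('o, 'h) cat =
  Ob :: "'o set"
  Hom :: "'o \<Rightarrow> 'o \<Rightarrow> 'h set"
  Idn :: "'o \<Rightarrow> 'h"
  Cmp :: "'o \<Rightarrow> 'o \<Rightarrow> 'o \<Rightarrow> 'h \<Rightarrow> 'h \<Rightarrow> 'h"
    \<comment> \<open>\<open>Cmp \<C> V Y Z g f\<close> is \<open>f\<close> followed by \<open>g\<close>, for \<open>f : V \<rightarrow> Y\<close> and \<open>g : Y \<rightarrow> Z\<close>\<close>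

locale category =
  fixes \<C> :: "('o, 'h) cat"
  assumes Idn_in: "V \<in> Ob \<C> \<Longrightarrow> Idn \<C> V \<in> Hom \<C> V V"
    and Cmp_in: "\<lbrakk>V \<in> Ob \<C>; Y \<in> Ob \<C>; Z \<in> Ob \<C>; f \<in> Hom \<C> V Y; g \<in> Hom \<C> Y Z\<rbrakk>
      \<Longrightarrow> Cmp \<C> V Y Z g f \<in> Hom \<C> V Z"
    and Cmp_Idn: "\<lbrakk>V \<in> Ob \<C>; Y \<in> Ob \<C>; f \<in> Hom \<C> V Y\<rbrakk> \<Longrightarrow> Cmp \<C> V V Y f (Idn \<C> V) = f"
    and Idn_Cmp: "\<lbrakk>V \<in> Ob \<C>; Y \<in> Ob \<C>; f \<in> Hom \<C> V Y\<rbrakk> \<Longrightarrow> Cmp \<C> V Y Y (Idn \<C> Y) f = f"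
    and Cmp_assoc: "\<lbrakk>V \<in> Ob \<C>; Y \<in> Ob \<C>; Z \<in> Ob \<C>; U \<in> Ob \<C>;
        f \<in> Hom \<C> V Y; g \<in> Hom \<C> Y Z; h \<in> Hom \<C> Z U\<rbrakk>
      \<Longrightarrow> Cmp \<C> V Z U h (Cmp \<C> V Y Z g f) = Cmp \<C> V Y U (Cmp \<C> Y Z U h g) f"

locale cat_functor = C: category \<C> + D: category \<D>
  for \<C> :: "('o, 'h) cat" and \<D> :: "('p, 'k) cat"
    and F :: "'o \<Rightarrow> 'p" and Fm :: "'o \<Rightarrow> 'o \<Rightarrow> 'h \<Rightarrow> 'k" +
  assumes F_Ob: "V \<in> Ob \<C> \<Longrightarrow> F V \<in> Ob \<D>"
    and Fm_Hom: "\<lbrakk>V \<in> Ob \<C>; Y \<in> Ob \<C>; f \<in> Hom \<C> V Y\<rbrakk> \<Longrightarrow> Fm V Y f \<in> Hom \<D> (F V) (F Y)"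
    and Fm_Idn: "V \<in> Ob \<C> \<Longrightarrow> Fm V V (Idn \<C> V) = Idn \<D> (F V)"
    and Fm_Cmp: "\<lbrakk>V \<in> Ob \<C>; Y \<in> Ob \<C>; Z \<in> Ob \<C>; f \<in> Hom \<C> V Y; g \<in> Hom \<C> Y Z\<rbrakk>
      \<Longrightarrow> Fm V Z (Cmp \<C> V Y Z g f) = Cmp \<D> (F V) (F Y) (F Z) (Fm Y Z g) (Fm V Y f)"


section \<open>The transport category and component structures\<close>

record ('s, 'w) poset_action =
  grp :: "'w monoid"
  pts :: "'s set"
  leq :: "('s \<times> 's) set"  \<comment> \<open>\<open>(F, E) \<in> leq\<close> means \<open>F \<subseteq> E\<close>\<close>
  act :: "'s \<Rightarrow> 'w \<Rightarrow> 's"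

locale poset_action = W: group "grp T" for T :: "('s, 'w) poset_action" +
  assumes poset: "partial_order_on (pts T) (leq T)"
    and act_closed: "\<lbrakk>E \<in> pts T; w \<in> carrier (grp T)\<rbrakk> \<Longrightarrow> act T E w \<in> pts T"
    and act_one: "E \<in> pts T \<Longrightarrow> act T E \<one>\<^bsub>grp T\<^esub> = E"
    and act_mult: "\<lbrakk>E \<in> pts T; v \<in> carrier (grp T); w \<in> carrier (grp T)\<rbrakk>
      \<Longrightarrow> act T E (v \<otimes>\<^bsub>grp T\<^esub> w) = act T (act T E v) w"
    and act_mono: "\<lbrakk>(F, E) \<in> leq T; w \<in> carrier (grp T)\<rbrakk> \<Longrightarrow> (act T F w, act T E w) \<in> leq T"

text \<open>A triple \<open>(\<sigma>, \<tau>, v)\<close> is the morphism \<open>(i, v) : \<sigma> \<rightarrow> \<tau>\<^sup>v\<close> with \<open>i : \<sigma> \<rightarrow> \<tau>\<close> in the poset.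
  Its target is \<open>\<tau>\<^sup>v\<close>, not \<open>\<tau>\<close>.\<close>

definition transport :: "('s, 'w) poset_action \<Rightarrow> ('s \<times> 's \<times> 'w) set" where
  "transport T = {(\<sigma>, \<tau>, v). (\<sigma>, \<tau>) \<in> leq T \<and> v \<in> carrier (grp T)}"

definition transport_id :: "('s, 'w) poset_action \<Rightarrow> 's \<Rightarrow> 's \<times> 's \<times> 'w" where
  "transport_id T E = (E, E, \<one>\<^bsub>grp T\<^esub>)"

fun transport_src :: "('s, 'w) poset_action \<Rightarrow> 's \<times> 's \<times> 'w \<Rightarrow> 's" where
  "transport_src T (\<sigma>, \<tau>, v) = \<sigma>"

fun transport_tgt :: "('s, 'w) poset_action \<Rightarrow> 's \<times> 's \<times> 'w \<Rightarrow> 's" where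
  "transport_tgt T (\<sigma>, \<tau>, v) = act T \<tau> v"

text \<open>\<open>transport_comp T m n\<close> is \<open>m\<close> followed by \<open>n\<close>: for \<open>j : \<tau>\<^sup>v \<rightarrow> \<rho>\<close> the translate \<open>j\<close> by
  \<open>v\<^sup>-\<^sup>1\<close> is \<open>\<tau> \<rightarrow> act \<rho> (inv v)\<close>.\<close>

fun transport_comp ::
  "('s, 'w) poset_action \<Rightarrow> 's \<times> 's \<times> 'w \<Rightarrow> 's \<times> 's \<times> 'w \<Rightarrow> 's \<times> 's \<times> 'w" where
  "transport_comp T (\<sigma>, \<tau>, v) (\<tau>', \<rho>, w) =
     (\<sigma>, act T \<rho> (inv\<^bsub>grp T\<^esub> v), v \<otimes>\<^bsub>grp T\<^esub> w)"

definition stab :: "('s, 'w) poset_action \<Rightarrow> 's \<Rightarrow> 'w set" where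
  "stab T E = {w \<in> carrier (grp T). act T E w = E}"

definition poset_morphisms :: "('s, 'w) poset_action \<Rightarrow> ('s \<times> 's \<times> 'w) set" where
  "poset_morphisms T = {(\<sigma>, \<tau>, \<one>\<^bsub>grp T\<^esub>) | \<sigma> \<tau>. (\<sigma>, \<tau>) \<in> leq T}"

definition automorphisms :: "('s, 'w) poset_action \<Rightarrow> ('s \<times> 's \<times> 'w) set" where
  "automorphisms T = {(E, E, w) | E w. E \<in> pts T \<and> w \<in> stab T E}"

definition wide_subcategory :: "('s, 'w) poset_action \<Rightarrow> ('s \<times> 's \<times> 'w) set \<Rightarrow> bool" where
  "wide_subcategory T C \<longleftrightarrow> C \<subseteq> transport T \<and> (\<forall>E\<in>pts T. transport_id T E \<in> C) \<and>
     (\<forall>m\<in>C. \<forall>n\<in>C. transport_tgt T m = transport_src T n \<longrightarrow> transport_comp T m n \<in> C)"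

definition generated_subcategory ::
  "('s, 'w) poset_action \<Rightarrow> ('s \<times> 's \<times> 'w) set \<Rightarrow> ('s \<times> 's \<times> 'w) set" where
  "generated_subcategory T G = \<Inter> {D. wide_subcategory T D \<and> G \<subseteq> D}"

definition component_structure :: "('s, 'w) poset_action \<Rightarrow> ('s \<times> 's \<times> 'w) set \<Rightarrow> bool" where
  "component_structure T C \<longleftrightarrow> wide_subcategory T C \<and> poset_morphisms T \<subseteq> C \<and>
     (\<exists>A \<subseteq> automorphisms T. C = generated_subcategory T (poset_morphisms T \<union> A))"

text \<open>The group written \<open>W\<^sub>E\<^sup>e\<close>.\<close>

definition cgroup :: "('s, 'w) poset_action \<Rightarrow> ('s \<times> 's \<times> 'w) set \<Rightarrow> 's \<Rightarrow> 'w set" where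
  "cgroup T C E = {w \<in> stab T E. (E, E, w) \<in> C}"

definition normal_structure :: "('s, 'w) poset_action \<Rightarrow> ('s \<times> 's \<times> 'w) set \<Rightarrow> bool" where
  "normal_structure T C \<longleftrightarrow> (\<forall>E\<in>pts T. cgroup T C E \<lhd> (grp T)\<lparr>carrier := stab T E\<rparr>)"

definition decreasing_structure :: "('s, 'w) poset_action \<Rightarrow> ('s \<times> 's \<times> 'w) set \<Rightarrow> bool" where
  "decreasing_structure T C \<longleftrightarrow> (\<forall>(F, E)\<in>leq T. cgroup T C E \<subseteq> cgroup T C F)"

text \<open>The class \<open>[v]\<close> of \<open>v\<close> in the morphisms \<open>(i, [v])\<close>, \<open>i : \<sigma> \<rightarrow> \<tau>\<close>, of the discrete residual.\<close>

definition dclass ::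
  "('s, 'w) poset_action \<Rightarrow> ('s \<times> 's \<times> 'w) set \<Rightarrow> 's \<Rightarrow> 'w \<Rightarrow> 'w set" where
  "dclass T C \<tau> v = {a \<otimes>\<^bsub>grp T\<^esub> v \<otimes>\<^bsub>grp T\<^esub> b | a b.
     a \<in> cgroup T C \<tau> \<and> b \<in> cgroup T C (act T \<tau> v)}"

text \<open>The discrete residual inherits a composition of isomorphisms only if the composite of
  \<open>(1, [v]) : \<tau> \<rightarrow> \<tau>\<^sup>v\<close> and \<open>(1, [w])\<close> is independent of representatives.  Normality, a condition on
  each \<open>W\<^sub>E\<close> separately, does not imply this.  Given normality, it is equivalent to conjugation by \<open>w\<close>
  carrying \<open>W\<^sub>E\<^sup>e\<close> onto the group of \<open>E\<^sup>w\<close> (lemma below).  Without it the fixed points of an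
  equivariant module need not be preserved by \<open>W\<close>.\<close>

definition conjugation_invariant ::
  "('s, 'w) poset_action \<Rightarrow> ('s \<times> 's \<times> 'w) set \<Rightarrow> bool" where
  "conjugation_invariant T C \<longleftrightarrow> (\<forall>E\<in>pts T. \<forall>w\<in>carrier (grp T).
     cgroup T C (act T E w) = (\<lambda>u. inv\<^bsub>grp T\<^esub> w \<otimes>\<^bsub>grp T\<^esub> u \<otimes>\<^bsub>grp T\<^esub> w) ` cgroup T C E)"

lemma conjugation_invariant_iff_residual_composition:
  assumes T: "poset_action T" and N: "normal_structure T C"
  shows "conjugation_invariant T C \<longleftrightarrow>
    (\<forall>\<tau>\<in>pts T. \<forall>v\<in>carrier (grp T). \<forall>v'\<in>carrier (grp T). \<forall>w\<in>carrier (grp T). \<forall>w'\<in>carrier (grp T).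
       dclass T C \<tau> v = dclass T C \<tau> v' \<longrightarrow>
       dclass T C (act T \<tau> v) w = dclass T C (act T \<tau> v) w' \<longrightarrow>
       dclass T C \<tau> (v \<otimes>\<^bsub>grp T\<^esub> w) = dclass T C \<tau> (v' \<otimes>\<^bsub>grp T\<^esub> w'))"
    (is "_ \<longleftrightarrow> ?well_defined")
proof
  interpret poset_action T by (rule T)
  let ?H = "cgroup T C"
  have sub: "?H E \<subseteq> carrier (grp T)" for E
    by (auto simp: cgroup_def stab_def)
  have stabH: "act T E u = E" if "u \<in> ?H E" for E u
    using that by (auto simp: cgroup_def stab_def)
  have grpH: "subgroup (?H E) (grp T\<lparr>carrier := stab T E\<rparr>)" if "E \<in> pts T" for E
    using N that unfolding normal_structure_def by (meson normal_imp_subgroup)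
  have oneH: "\<one>\<^bsub>grp T\<^esub> \<in> ?H E" if "E \<in> pts T" for E
    using subgroup.one_closed[OF grpH[OF that]] by simp
  have multH: "a \<otimes>\<^bsub>grp T\<^esub> b \<in> ?H E" if "E \<in> pts T" "a \<in> ?H E" "b \<in> ?H E" for E a b
    using subgroup.m_closed[OF grpH[OF that(1)] that(2,3)] by simp
  have invact: "act T (act T E w) (inv\<^bsub>grp T\<^esub> w) = E" if "E \<in> pts T" "w \<in> carrier (grp T)" for E w
    using that act_mult[of E w "inv\<^bsub>grp T\<^esub> w"] act_one by simp
  have invH: "inv\<^bsub>grp T\<^esub> a \<in> ?H E" if E: "E \<in> pts T" and a: "a \<in> ?H E" for E a
  proof -
    obtain b where b: "b \<in> ?H E" "b \<otimes>\<^bsub>grp T\<^esub> a = \<one>\<^bsub>grp T\<^esub>"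
      using group.subgroup_imp_group[OF _ grpH[OF E]] group.l_inv_ex[of "grp T\<lparr>carrier := stab T E, carrier := ?H E\<rparr>" a] a N E
      unfolding normal_structure_def normal_def by (auto dest!: bspec)
    then show ?thesis
      using W.inv_equality[of b a] a sub by auto
  qed
  {
    assume ci: "conjugation_invariant T C"
    have conj: "?H (act T E w) = (\<lambda>u. inv\<^bsub>grp T\<^esub> w \<otimes>\<^bsub>grp T\<^esub> u \<otimes>\<^bsub>grp T\<^esub> w) ` ?H E"
      if "E \<in> pts T" "w \<in> carrier (grp T)" for E w
      using ci that unfolding conjugation_invariant_def by blast
    have up: "\<exists>a\<in>?H E. w \<otimes>\<^bsub>grp T\<^esub> b = a \<otimes>\<^bsub>grp T\<^esub> w"
      if E: "E \<in> pts T" and w: "w \<in> carrier (grp T)" and b: "b \<in> ?H (act T E w)" for E w b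
    proof -
      obtain a where a: "a \<in> ?H E" "b = inv\<^bsub>grp T\<^esub> w \<otimes>\<^bsub>grp T\<^esub> a \<otimes>\<^bsub>grp T\<^esub> w"
        using b conj[OF E w] by blast
      then have "w \<otimes>\<^bsub>grp T\<^esub> b = a \<otimes>\<^bsub>grp T\<^esub> w"
        using w sub[of E] by (auto simp: W.m_assoc[symmetric])
      with a show ?thesis by blast
    qed
    have cls: "dclass T C E w = (\<lambda>a. a \<otimes>\<^bsub>grp T\<^esub> w) ` ?H E"
      if E: "E \<in> pts T" and w: "w \<in> carrier (grp T)" for E w
    proof
      show "dclass T C E w \<subseteq> (\<lambda>a. a \<otimes>\<^bsub>grp T\<^esub> w) ` ?H E"
      proof
        fix x assume "x \<in> dclass T C E w"
        then obtain a b where ab: "a \<in> ?H E" "b \<in> ?H (act T E w)" "x = a \<otimes>\<^bsub>grp T\<^esub> w \<otimes>\<^bsub>grp T\<^esub> b"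
          unfolding dclass_def by blast
        obtain c where c: "c \<in> ?H E" "w \<otimes>\<^bsub>grp T\<^esub> b = c \<otimes>\<^bsub>grp T\<^esub> w"
          using up[OF E w ab(2)] by blast
        have car: "a \<in> carrier (grp T)" "b \<in> carrier (grp T)" "c \<in> carrier (grp T)"
          using ab c sub by blast+
        have "x = (a \<otimes>\<^bsub>grp T\<^esub> c) \<otimes>\<^bsub>grp T\<^esub> w"
          using ab(3) c(2) car w by (simp add: W.m_assoc)
        then show "x \<in> (\<lambda>a. a \<otimes>\<^bsub>grp T\<^esub> w) ` ?H E"
          using multH[OF E ab(1) c(1)] by blast
      qed
      show "(\<lambda>a. a \<otimes>\<^bsub>grp T\<^esub> w) ` ?H E \<subseteq> dclass T C E w"
      proof
        fix x assume "x \<in> (\<lambda>a. a \<otimes>\<^bsub>grp T\<^esub> w) ` ?H E"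
        then obtain a where a: "a \<in> ?H E" "x = a \<otimes>\<^bsub>grp T\<^esub> w" by blast
        then have "x = a \<otimes>\<^bsub>grp T\<^esub> w \<otimes>\<^bsub>grp T\<^esub> \<one>\<^bsub>grp T\<^esub>"
          using sub w by (auto simp: subset_iff)
        then show "x \<in> dclass T C E w"
          unfolding dclass_def using a(1) oneH[OF act_closed[OF E w]] by blast
      qed
    qed
    have rep: "\<exists>a\<in>?H E. w' = a \<otimes>\<^bsub>grp T\<^esub> w"
      if E: "E \<in> pts T" and w: "w \<in> carrier (grp T)" "w' \<in> carrier (grp T)"
        and eq: "dclass T C E w = dclass T C E w'" for E w w'
    proof -
      have "\<one>\<^bsub>grp T\<^esub> \<otimes>\<^bsub>grp T\<^esub> w' \<in> dclass T C E w'"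
        unfolding cls[OF E w(2)] using oneH[OF E] by blast
      then show ?thesis
        using eq cls[OF E w(1)] w by auto
    qed
    have eqI: "dclass T C E (a \<otimes>\<^bsub>grp T\<^esub> w) = dclass T C E w"
      if E: "E \<in> pts T" and w: "w \<in> carrier (grp T)" and a: "a \<in> ?H E" for E w a
    proof -
      have car: "a \<in> carrier (grp T)" using a sub by blast
      have "c \<otimes>\<^bsub>grp T\<^esub> w = (c \<otimes>\<^bsub>grp T\<^esub> inv\<^bsub>grp T\<^esub> a) \<otimes>\<^bsub>grp T\<^esub> (a \<otimes>\<^bsub>grp T\<^esub> w)" if "c \<in> ?H E" for c
      proof -
        have "c \<in> carrier (grp T)" using that sub by blast
        then show ?thesis
          using car w W.m_assoc[of "inv\<^bsub>grp T\<^esub> a" a w, symmetric] by (simp add: W.m_assoc)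
      qed
      moreover have "c \<otimes>\<^bsub>grp T\<^esub> (a \<otimes>\<^bsub>grp T\<^esub> w) = (c \<otimes>\<^bsub>grp T\<^esub> a) \<otimes>\<^bsub>grp T\<^esub> w" if "c \<in> ?H E" for c
        using that sub car w by (auto simp: W.m_assoc subset_iff)
      ultimately show ?thesis
        unfolding cls[OF E w] cls[OF E W.m_closed[OF car w]]
        using multH[OF E] invH[OF E a] a by (intro equalityI image_subsetI; metis image_eqI)
    qed
    show ?well_defined
    proof (intro ballI impI)
      fix \<tau> v v' w w'
      assume t: "\<tau> \<in> pts T" and car: "v \<in> carrier (grp T)" "v' \<in> carrier (grp T)"
        "w \<in> carrier (grp T)" "w' \<in> carrier (grp T)"
        and eq: "dclass T C \<tau> v = dclass T C \<tau> v'" "dclass T C (act T \<tau> v) w = dclass T C (act T \<tau> v) w'"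
      obtain a where a: "a \<in> ?H \<tau>" "v' = a \<otimes>\<^bsub>grp T\<^esub> v"
        using rep[OF t car(1,2) eq(1)] by blast
      obtain b where b: "b \<in> ?H (act T \<tau> v)" "w' = b \<otimes>\<^bsub>grp T\<^esub> w"
        using rep[OF act_closed[OF t car(1)] car(3,4) eq(2)] by blast
      obtain c where c: "c \<in> ?H \<tau>" "v \<otimes>\<^bsub>grp T\<^esub> b = c \<otimes>\<^bsub>grp T\<^esub> v"
        using up[OF t car(1) b(1)] by blast
      have car': "a \<in> carrier (grp T)" "b \<in> carrier (grp T)" "c \<in> carrier (grp T)"
        using a b c sub by blast+
      have "v' \<otimes>\<^bsub>grp T\<^esub> w' = a \<otimes>\<^bsub>grp T\<^esub> ((v \<otimes>\<^bsub>grp T\<^esub> b) \<otimes>\<^bsub>grp T\<^esub> w)"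
        using a b car car' by (simp add: W.m_assoc)
      also have "\<dots> = (a \<otimes>\<^bsub>grp T\<^esub> c) \<otimes>\<^bsub>grp T\<^esub> (v \<otimes>\<^bsub>grp T\<^esub> w)"
        unfolding c(2) using car car' by (simp add: W.m_assoc)
      finally show "dclass T C \<tau> (v \<otimes>\<^bsub>grp T\<^esub> w) = dclass T C \<tau> (v' \<otimes>\<^bsub>grp T\<^esub> w')"
        using eqI[OF t W.m_closed[OF car(1,3)] multH[OF t a(1) c(1)]] by simp
    qed
  }
  {
    assume wd: ?well_defined
    have down: "v \<otimes>\<^bsub>grp T\<^esub> u \<otimes>\<^bsub>grp T\<^esub> inv\<^bsub>grp T\<^esub> v \<in> ?H E"
      if E: "E \<in> pts T" and v: "v \<in> carrier (grp T)" and u: "u \<in> ?H (act T E v)" for E v u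
    proof -
      let ?H' = "?H (act T E v)"
      have E': "act T E v \<in> pts T" by (rule act_closed[OF E v])
      have uc: "u \<in> carrier (grp T)" using u sub by blast
      have act_vu: "act T E (v \<otimes>\<^bsub>grp T\<^esub> u) = act T E v"
        using act_mult[OF E v uc] stabH[OF u] by simp
      have 1: "a \<otimes>\<^bsub>grp T\<^esub> (v \<otimes>\<^bsub>grp T\<^esub> u) \<otimes>\<^bsub>grp T\<^esub> b = a \<otimes>\<^bsub>grp T\<^esub> v \<otimes>\<^bsub>grp T\<^esub> (u \<otimes>\<^bsub>grp T\<^esub> b)"
        if "a \<in> ?H E" "b \<in> ?H'" for a b
        using that sub v uc by (auto simp: W.m_assoc subset_iff)
      have 2: "a \<otimes>\<^bsub>grp T\<^esub> v \<otimes>\<^bsub>grp T\<^esub> b =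
          a \<otimes>\<^bsub>grp T\<^esub> (v \<otimes>\<^bsub>grp T\<^esub> u) \<otimes>\<^bsub>grp T\<^esub> (inv\<^bsub>grp T\<^esub> u \<otimes>\<^bsub>grp T\<^esub> b)"
        if "a \<in> ?H E" "b \<in> ?H'" for a b
      proof -
        have "a \<in> carrier (grp T)" "b \<in> carrier (grp T)" using that sub by blast+
        moreover have "u \<otimes>\<^bsub>grp T\<^esub> (inv\<^bsub>grp T\<^esub> u \<otimes>\<^bsub>grp T\<^esub> b) = b"
          using uc calculation by (simp add: W.m_assoc[symmetric])
        ultimately show ?thesis
          using v uc by (simp add: W.m_assoc)
      qed
      have eq: "dclass T C E v = dclass T C E (v \<otimes>\<^bsub>grp T\<^esub> u)"
      proof
        show "dclass T C E v \<subseteq> dclass T C E (v \<otimes>\<^bsub>grp T\<^esub> u)"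
          unfolding dclass_def act_vu using 2 multH[OF E' invH[OF E' u]] by blast
        show "dclass T C E (v \<otimes>\<^bsub>grp T\<^esub> u) \<subseteq> dclass T C E v"
          unfolding dclass_def act_vu using 1 multH[OF E' u] by blast
      qed
      have vu: "v \<otimes>\<^bsub>grp T\<^esub> u \<in> carrier (grp T)" and iv: "inv\<^bsub>grp T\<^esub> v \<in> carrier (grp T)"
        using v uc by auto
      have "dclass T C E (v \<otimes>\<^bsub>grp T\<^esub> inv\<^bsub>grp T\<^esub> v) = dclass T C E (v \<otimes>\<^bsub>grp T\<^esub> u \<otimes>\<^bsub>grp T\<^esub> inv\<^bsub>grp T\<^esub> v)"
        using wd E v vu iv eq by blast
      moreover have "v \<otimes>\<^bsub>grp T\<^esub> u \<otimes>\<^bsub>grp T\<^esub> inv\<^bsub>grp T\<^esub> v \<in> dclass T C E (v \<otimes>\<^bsub>grp T\<^esub> u \<otimes>\<^bsub>grp T\<^esub> inv\<^bsub>grp T\<^esub> v)"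
        (is "?x \<in> _")
      proof -
        have x: "?x \<in> carrier (grp T)" using vu iv by simp
        then have "?x = \<one>\<^bsub>grp T\<^esub> \<otimes>\<^bsub>grp T\<^esub> ?x \<otimes>\<^bsub>grp T\<^esub> \<one>\<^bsub>grp T\<^esub>" by simp
        then show ?thesis
          unfolding dclass_def using oneH[OF E] oneH[OF act_closed[OF E x]] by blast
      qed
      moreover have "dclass T C E (v \<otimes>\<^bsub>grp T\<^esub> inv\<^bsub>grp T\<^esub> v) \<subseteq> ?H E"
      proof -
        have "a \<otimes>\<^bsub>grp T\<^esub> \<one>\<^bsub>grp T\<^esub> \<otimes>\<^bsub>grp T\<^esub> b \<in> ?H E" if "a \<in> ?H E" "b \<in> ?H E" for a b
          using multH[OF E that] that sub by (auto simp: subset_iff)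
        then show ?thesis
          unfolding dclass_def W.r_inv[OF v] act_one[OF E] by blast
      qed
      ultimately show ?thesis by blast
    qed
    show "conjugation_invariant T C"
      unfolding conjugation_invariant_def
    proof (intro ballI equalityI subsetI)
      fix E w u assume E: "E \<in> pts T" and w: "w \<in> carrier (grp T)" and u: "u \<in> ?H (act T E w)"
      have uc: "u \<in> carrier (grp T)" using u sub by blast
      have "inv\<^bsub>grp T\<^esub> w \<otimes>\<^bsub>grp T\<^esub> (w \<otimes>\<^bsub>grp T\<^esub> u \<otimes>\<^bsub>grp T\<^esub> inv\<^bsub>grp T\<^esub> w) \<otimes>\<^bsub>grp T\<^esub> w =
          (inv\<^bsub>grp T\<^esub> w \<otimes>\<^bsub>grp T\<^esub> w) \<otimes>\<^bsub>grp T\<^esub> u \<otimes>\<^bsub>grp T\<^esub> (inv\<^bsub>grp T\<^esub> w \<otimes>\<^bsub>grp T\<^esub> w)"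
        using w uc by (simp only: W.m_assoc W.m_closed W.inv_closed)
      also have "\<dots> = u" using w uc by simp
      finally show "u \<in> (\<lambda>u. inv\<^bsub>grp T\<^esub> w \<otimes>\<^bsub>grp T\<^esub> u \<otimes>\<^bsub>grp T\<^esub> w) ` ?H E"
        using down[OF E w u] by (metis image_eqI)
    next
      fix E w u assume E: "E \<in> pts T" and w: "w \<in> carrier (grp T)"
        and "u \<in> (\<lambda>u. inv\<^bsub>grp T\<^esub> w \<otimes>\<^bsub>grp T\<^esub> u \<otimes>\<^bsub>grp T\<^esub> w) ` ?H E"
      then obtain y where y: "y \<in> ?H E" "u = inv\<^bsub>grp T\<^esub> w \<otimes>\<^bsub>grp T\<^esub> y \<otimes>\<^bsub>grp T\<^esub> w" by blast
      have "y \<in> ?H (act T (act T E w) (inv\<^bsub>grp T\<^esub> w))" using y(1) invact[OF E w] by simp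
      from down[OF act_closed[OF E w] W.inv_closed[OF w] this]
      show "u \<in> ?H (act T E w)" using y(2) w by simp
    qed
  }
qed


section \<open>Diagrams of rings and modules\<close>

text \<open>\<open>smap D F E\<close> is the structure map \<open>D F \<rightarrow> D E\<close> for \<open>F \<subseteq> E\<close>, and \<open>wmap D w E\<close> is
  \<open>w\<^sub>m : D E \<rightarrow> D (E\<^sup>w)\<close>.\<close>

record ('s, 'w, 'o, 'x) diagram =
  ob :: "'s \<Rightarrow> 'o"
  smap :: "'s \<Rightarrow> 's \<Rightarrow> 'x \<Rightarrow> 'x"
  wmap :: "'w \<Rightarrow> 's \<Rightarrow> 'x \<Rightarrow> 'x"

text \<open>\<open>dmap D \<sigma> \<tau> [v]\<close> is the value \<open>D \<sigma> \<rightarrow> D (\<tau>\<^sup>v)\<close> on the morphism \<open>(i, [v])\<close>.\<close>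

record ('s, 'w, 'o, 'x) residual_diagram =
  dob :: "'s \<Rightarrow> 'o"
  dmap :: "'s \<Rightarrow> 's \<Rightarrow> 'w set \<Rightarrow> 'x \<Rightarrow> 'x"

type_synonym ('s, 'w, 'r) ring_diagram = "('s, 'w, 'r ring, 'r) diagram"
type_synonym ('s, 'w, 'r, 'm) module_diagram = "('s, 'w, ('r, 'm) module, 'm) diagram"
type_synonym ('s, 'w, 'r) residual_ring_diagram = "('s, 'w, 'r ring, 'r) residual_diagram"
type_synonym ('s, 'w, 'r, 'm) residual_module_diagram =
  "('s, 'w, ('r, 'm) module, 'm) residual_diagram"

locale equivariant_diagram =
  fixes T :: "('s, 'w) poset_action"
    and D :: "('s, 'w, ('x, 'z) partial_object_scheme, 'x) diagram"
  assumes smap_id: "\<lbrakk>E \<in> pts T; x \<in> carrier (ob D E)\<rbrakk> \<Longrightarrow> smap D E E x = x"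
    and smap_comp: "\<lbrakk>(F, E) \<in> leq T; (E, G) \<in> leq T; x \<in> carrier (ob D F)\<rbrakk>
      \<Longrightarrow> smap D F G x = smap D E G (smap D F E x)"
    and wmap_one: "\<lbrakk>E \<in> pts T; x \<in> carrier (ob D E)\<rbrakk> \<Longrightarrow> wmap D \<one>\<^bsub>grp T\<^esub> E x = x"
    and wmap_mult: "\<lbrakk>E \<in> pts T; v \<in> carrier (grp T); w \<in> carrier (grp T); x \<in> carrier (ob D E)\<rbrakk>
      \<Longrightarrow> wmap D (v \<otimes>\<^bsub>grp T\<^esub> w) E x = wmap D w (act T E v) (wmap D v E x)"
    and wmap_smap: "\<lbrakk>(F, E) \<in> leq T; w \<in> carrier (grp T); x \<in> carrier (ob D F)\<rbrakk>
      \<Longrightarrow> wmap D w E (smap D F E x) = smap D (act T F w) (act T E w) (wmap D w F x)"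

locale equivariant_ring = equivariant_diagram T R
  for T :: "('s, 'w) poset_action" and R :: "('s, 'w, 'r) ring_diagram" +
  assumes cring_ob: "E \<in> pts T \<Longrightarrow> cring (ob R E)"
    and smap_ring_hom: "(F, E) \<in> leq T \<Longrightarrow> smap R F E \<in> ring_hom (ob R F) (ob R E)"
    and wmap_ring_hom: "\<lbrakk>E \<in> pts T; w \<in> carrier (grp T)\<rbrakk>
      \<Longrightarrow> wmap R w E \<in> ring_hom (ob R E) (ob R (act T E w))"

definition semilinear ::
  "('a \<Rightarrow> 'b) \<Rightarrow> 'a ring \<Rightarrow> ('a, 'p) module \<Rightarrow> ('b, 'q) module \<Rightarrow> ('p \<Rightarrow> 'q) set" where
  "semilinear \<phi> A P Q = {f \<in> carrier P \<rightarrow> carrier Q.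
     (\<forall>x\<in>carrier P. \<forall>y\<in>carrier P. f (x \<oplus>\<^bsub>P\<^esub> y) = f x \<oplus>\<^bsub>Q\<^esub> f y) \<and>
     (\<forall>a\<in>carrier A. \<forall>x\<in>carrier P. f (a \<odot>\<^bsub>P\<^esub> x) = \<phi> a \<odot>\<^bsub>Q\<^esub> f x)}"

locale equivariant_module = equivariant_diagram T M
  for T :: "('s, 'w) poset_action" and R :: "('s, 'w, 'r) ring_diagram"
    and M :: "('s, 'w, 'r, 'm) module_diagram" +
  assumes module_ob: "E \<in> pts T \<Longrightarrow> module (ob R E) (ob M E)"
    and smap_semilinear: "(F, E) \<in> leq T
      \<Longrightarrow> smap M F E \<in> semilinear (smap R F E) (ob R F) (ob M F) (ob M E)"
    and wmap_semilinear: "\<lbrakk>E \<in> pts T; w \<in> carrier (grp T)\<rbrakk>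
      \<Longrightarrow> wmap M w E \<in> semilinear (wmap R w E) (ob R E) (ob M E) (ob M (act T E w))"

text \<open>Diagrams on the discrete residual, whose composition is induced from the transport category:
  functoriality is required for all representatives \<open>v\<close>, \<open>w\<close> of the two classes.  Different
  representatives can give composites with different middle objects \<open>\<rho>\<^sup>v\<^sup>-\<^sup>1\<close>, which the composition of
  the residual identifies; a functor takes the same value on them, as demanded here.\<close>

locale residual_functor =
  fixes T :: "('s, 'w) poset_action" and C :: "('s \<times> 's \<times> 'w) set"
    and D :: "('s, 'w, ('x, 'z) partial_object_scheme, 'x) residual_diagram"
  assumes dmap_id: "\<lbrakk>E \<in> pts T; x \<in> carrier (dob D E)\<rbrakk>
      \<Longrightarrow> dmap D E E (dclass T C E \<one>\<^bsub>grp T\<^esub>) x = x"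
    and dmap_comp: "\<lbrakk>(\<sigma>, \<tau>) \<in> leq T; v \<in> carrier (grp T); (act T \<tau> v, \<rho>) \<in> leq T;
        w \<in> carrier (grp T); transport_comp T (\<sigma>, \<tau>, v) (act T \<tau> v, \<rho>, w) = (\<sigma>, \<rho>', u);
        x \<in> carrier (dob D \<sigma>)\<rbrakk>
      \<Longrightarrow> dmap D \<sigma> \<rho>' (dclass T C \<rho>' u) x =
          dmap D (act T \<tau> v) \<rho> (dclass T C \<rho> w) (dmap D \<sigma> \<tau> (dclass T C \<tau> v) x)"

locale residual_ring = residual_functor T C A
  for T :: "('s, 'w) poset_action" and C :: "('s \<times> 's \<times> 'w) set"
    and A :: "('s, 'w, 'r) residual_ring_diagram" +
  assumes cring_dob: "E \<in> pts T \<Longrightarrow> cring (dob A E)"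
    and dmap_ring_hom: "\<lbrakk>(\<sigma>, \<tau>) \<in> leq T; v \<in> carrier (grp T)\<rbrakk>
      \<Longrightarrow> dmap A \<sigma> \<tau> (dclass T C \<tau> v) \<in> ring_hom (dob A \<sigma>) (dob A (act T \<tau> v))"

locale residual_module = residual_functor T C N
  for T :: "('s, 'w) poset_action" and C :: "('s \<times> 's \<times> 'w) set"
    and A :: "('s, 'w, 'r) residual_ring_diagram"
    and N :: "('s, 'w, 'r, 'n) residual_module_diagram" +
  assumes module_dob: "E \<in> pts T \<Longrightarrow> module (dob A E) (dob N E)"
    and dmap_semilinear: "\<lbrakk>(\<sigma>, \<tau>) \<in> leq T; v \<in> carrier (grp T)\<rbrakk>
      \<Longrightarrow> dmap N \<sigma> \<tau> (dclass T C \<tau> v) \<in>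
          semilinear (dmap A \<sigma> \<tau> (dclass T C \<tau> v)) (dob A \<sigma>) (dob N \<sigma>) (dob N (act T \<tau> v))"


section \<open>The two categories of modules\<close>

text \<open>Morphisms are families of maps, made extensional so that equality of morphisms is
  equality in HOL.\<close>

definition family_id :: "('s, 'w) poset_action \<Rightarrow> ('s \<Rightarrow> 'x set) \<Rightarrow> 's \<Rightarrow> 'x \<Rightarrow> 'x" where
  "family_id T S = (\<lambda>E\<in>pts T. \<lambda>x\<in>S E. x)"

definition family_comp ::
  "('s, 'w) poset_action \<Rightarrow> ('s \<Rightarrow> 'x set) \<Rightarrow> ('s \<Rightarrow> 'y \<Rightarrow> 'z) \<Rightarrow> ('s \<Rightarrow> 'x \<Rightarrow> 'y) \<Rightarrow> 's \<Rightarrow> 'x \<Rightarrow> 'z" where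
  "family_comp T S g f = (\<lambda>E\<in>pts T. compose (S E) (g E) (f E))"

definition equivariant_hom ::
  "('s, 'w) poset_action \<Rightarrow> ('s, 'w, 'r) ring_diagram \<Rightarrow>
   ('s, 'w, 'r, 'm) module_diagram \<Rightarrow> ('s, 'w, 'r, 'k) module_diagram \<Rightarrow> ('s \<Rightarrow> 'm \<Rightarrow> 'k) set" where
  "equivariant_hom T R M M' = {f \<in> (\<Pi>\<^sub>E E\<in>pts T. carrier (ob M E) \<rightarrow>\<^sub>E carrier (ob M' E)).
     (\<forall>E\<in>pts T. f E \<in> semilinear (\<lambda>a. a) (ob R E) (ob M E) (ob M' E)) \<and>
     (\<forall>(F, E)\<in>leq T. \<forall>x\<in>carrier (ob M F). f E (smap M F E x) = smap M' F E (f F x)) \<and>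
     (\<forall>E\<in>pts T. \<forall>w\<in>carrier (grp T). \<forall>x\<in>carrier (ob M E).
        f (act T E w) (wmap M w E x) = wmap M' w E (f E x))}"

definition equivariant_modules ::
  "('s, 'w) poset_action \<Rightarrow> ('s, 'w, 'r) ring_diagram \<Rightarrow>
   (('s, 'w, 'r, 'm) module_diagram, 's \<Rightarrow> 'm \<Rightarrow> 'm) cat" where
  "equivariant_modules T R = \<lparr>Ob = {M. equivariant_module T R M}, Hom = equivariant_hom T R,
     Idn = (\<lambda>M. family_id T (\<lambda>E. carrier (ob M E))),
     Cmp = (\<lambda>M _ _. family_comp T (\<lambda>E. carrier (ob M E)))\<rparr>"

definition residual_hom ::
  "('s, 'w) poset_action \<Rightarrow> ('s \<times> 's \<times> 'w) set \<Rightarrow> ('s, 'w, 'r) residual_ring_diagram \<Rightarrow>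
   ('s, 'w, 'r, 'n) residual_module_diagram \<Rightarrow> ('s, 'w, 'r, 'k) residual_module_diagram \<Rightarrow>
   ('s \<Rightarrow> 'n \<Rightarrow> 'k) set" where
  "residual_hom T C A N N' = {f \<in> (\<Pi>\<^sub>E E\<in>pts T. carrier (dob N E) \<rightarrow>\<^sub>E carrier (dob N' E)).
     (\<forall>E\<in>pts T. f E \<in> semilinear (\<lambda>a. a) (dob A E) (dob N E) (dob N' E)) \<and>
     (\<forall>(\<sigma>, \<tau>)\<in>leq T. \<forall>v\<in>carrier (grp T). \<forall>x\<in>carrier (dob N \<sigma>).
        f (act T \<tau> v) (dmap N \<sigma> \<tau> (dclass T C \<tau> v) x) = dmap N' \<sigma> \<tau> (dclass T C \<tau> v) (f \<sigma> x))}"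

definition residual_modules ::
  "('s, 'w) poset_action \<Rightarrow> ('s \<times> 's \<times> 'w) set \<Rightarrow> ('s, 'w, 'r) residual_ring_diagram \<Rightarrow>
   (('s, 'w, 'r, 'n) residual_module_diagram, 's \<Rightarrow> 'n \<Rightarrow> 'n) cat" where
  "residual_modules T C A = \<lparr>Ob = {N. residual_module T C A N}, Hom = residual_hom T C A,
     Idn = (\<lambda>N. family_id T (\<lambda>E. carrier (dob N E))),
     Cmp = (\<lambda>N _ _. family_comp T (\<lambda>E. carrier (dob N E)))\<rparr>"


section \<open>Fixed points\<close>

definition fixed_points ::
  "('s, 'w) poset_action \<Rightarrow> ('s \<times> 's \<times> 'w) set \<Rightarrow>
   ('s, 'w, ('x, 'z) partial_object_scheme, 'x) diagram \<Rightarrow> 's \<Rightarrow> 'x set" where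
  "fixed_points T C D E = {x \<in> carrier (ob D E). \<forall>w\<in>cgroup T C E. wmap D w E x = x}"

text \<open>For a ring diagram this is \<open>R\<^sub>i\<^sub>n\<^sub>v\<close>, for a module diagram \<open>M\<close> it is \<open>\<Psi> M\<close>.  On fixed points the
  map does not depend on the representative of the class.\<close>

definition fixed_diagram ::
  "('s, 'w) poset_action \<Rightarrow> ('s \<times> 's \<times> 'w) set \<Rightarrow>
   ('s, 'w, ('x, 'z) partial_object_scheme, 'x) diagram \<Rightarrow>
   ('s, 'w, ('x, 'z) partial_object_scheme, 'x) residual_diagram" where
  "fixed_diagram T C D =
     \<lparr>dob = (\<lambda>E. (ob D E)\<lparr>carrier := fixed_points T C D E\<rparr>),
      dmap = (\<lambda>\<sigma> \<tau> c x. wmap D (SOME v. v \<in> c) \<tau> (smap D \<sigma> \<tau> x))\<rparr>"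

definition R_inv ::
  "('s, 'w) poset_action \<Rightarrow> ('s \<times> 's \<times> 'w) set \<Rightarrow> ('s, 'w, 'r) ring_diagram \<Rightarrow>
   ('s, 'w, 'r) residual_ring_diagram" where
  "R_inv T C R = fixed_diagram T C R"

definition Psi ::
  "('s, 'w) poset_action \<Rightarrow> ('s \<times> 's \<times> 'w) set \<Rightarrow> ('s, 'w, 'r, 'm) module_diagram \<Rightarrow>
   ('s, 'w, 'r, 'm) residual_module_diagram" where
  "Psi T C M = fixed_diagram T C M"

definition Psi_map ::
  "('s, 'w) poset_action \<Rightarrow> ('s \<times> 's \<times> 'w) set \<Rightarrow> ('s, 'w, 'r, 'm) module_diagram \<Rightarrow>
   ('s, 'w, 'r, 'k) module_diagram \<Rightarrow> ('s \<Rightarrow> 'm \<Rightarrow> 'k) \<Rightarrow> 's \<Rightarrow> 'm \<Rightarrow> 'k" where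
  "Psi_map T C M M' f = (\<lambda>E\<in>pts T. restrict (f E) (fixed_points T C M E))"


section \<open>Tensor products and extension of scalars\<close>

text \<open>The tensor product over \<open>A\<close> of modules \<open>P\<close>, \<open>Q\<close>: the free abelian group on pairs modulo the
  bilinearity and balancing relations.  Its elements are cosets.\<close>

definition tensor_free ::
  "('a, 'p) module \<Rightarrow> ('a, 'q) module \<Rightarrow> ('p \<times> 'q \<Rightarrow>\<^sub>0 int) monoid" where
  "tensor_free P Q = free_Abelian_group (carrier P \<times> carrier Q)"

definition tensor_relations ::
  "'a ring \<Rightarrow> ('a, 'p) module \<Rightarrow> ('a, 'q) module \<Rightarrow> ('p \<times> 'q \<Rightarrow>\<^sub>0 int) set" where
  "tensor_relations A P Q =
     {frag_of (p \<oplus>\<^bsub>P\<^esub> p', q) - frag_of (p, q) - frag_of (p', q) | p p' q.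
        p \<in> carrier P \<and> p' \<in> carrier P \<and> q \<in> carrier Q} \<union>
     {frag_of (p, q \<oplus>\<^bsub>Q\<^esub> q') - frag_of (p, q) - frag_of (p, q') | p q q'.
        p \<in> carrier P \<and> q \<in> carrier Q \<and> q' \<in> carrier Q} \<union>
     {frag_of (a \<odot>\<^bsub>P\<^esub> p, q) - frag_of (p, a \<odot>\<^bsub>Q\<^esub> q) | a p q.
        a \<in> carrier A \<and> p \<in> carrier P \<and> q \<in> carrier Q}"

definition tensor_null ::
  "'a ring \<Rightarrow> ('a, 'p) module \<Rightarrow> ('a, 'q) module \<Rightarrow> ('p \<times> 'q \<Rightarrow>\<^sub>0 int) set" where
  "tensor_null A P Q = generate (tensor_free P Q) (tensor_relations A P Q)"

definition tensor_group ::
  "'a ring \<Rightarrow> ('a, 'p) module \<Rightarrow> ('a, 'q) module \<Rightarrow> ('p \<times> 'q \<Rightarrow>\<^sub>0 int) set monoid" where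
  "tensor_group A P Q = tensor_free P Q Mod tensor_null A P Q"

definition pure_tensor ::
  "'a ring \<Rightarrow> ('a, 'p) module \<Rightarrow> ('a, 'q) module \<Rightarrow> 'p \<Rightarrow> 'q \<Rightarrow> ('p \<times> 'q \<Rightarrow>\<^sub>0 int) set" where
  "pure_tensor A P Q p q = tensor_null A P Q #>\<^bsub>tensor_free P Q\<^esub> frag_of (p, q)"

text \<open>\<open>tensor_map A P Q f g\<close> is the map \<open>p \<otimes> q \<mapsto> f p \<otimes> g q\<close> into the tensor product of \<open>P\<close> and \<open>Q\<close>
  over \<open>A\<close>: push a coset forward and saturate it to a coset of the target relations.\<close>

definition tensor_map ::
  "'a ring \<Rightarrow> ('a, 'p) module \<Rightarrow> ('a, 'q) module \<Rightarrow> ('p0 \<Rightarrow> 'p) \<Rightarrow> ('q0 \<Rightarrow> 'q) \<Rightarrow>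
   ('p0 \<times> 'q0 \<Rightarrow>\<^sub>0 int) set \<Rightarrow> ('p \<times> 'q \<Rightarrow>\<^sub>0 int) set" where
  "tensor_map A P Q f g K =
     tensor_null A P Q <#>\<^bsub>tensor_free P Q\<^esub> (frag_extend (\<lambda>(p, q). frag_of (f p, g q)) ` K)"

text \<open>The ring \<open>B\<close> as a module over the source of \<open>\<phi>\<close>.\<close>

definition ring_via :: "('a \<Rightarrow> 'b) \<Rightarrow> 'b ring \<Rightarrow> ('a, 'b) module" where
  "ring_via \<phi> B = \<lparr>carrier = carrier B, mult = (\<otimes>\<^bsub>B\<^esub>), one = \<one>\<^bsub>B\<^esub>,
     ring.zero = \<zero>\<^bsub>B\<^esub>, add = (\<oplus>\<^bsub>B\<^esub>),
     smult = (\<lambda>a b. \<phi> a \<otimes>\<^bsub>B\<^esub> b)\<rparr>"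

text \<open>\<open>B \<otimes>\<^sub>A N\<close> as a \<open>B\<close>-module, for a subring \<open>A\<close> of \<open>B\<close>.  The \<open>mult\<close> and \<open>one\<close> fields of a
  module record carry no meaning.\<close>

definition extend_scalars ::
  "'r ring \<Rightarrow> 'r ring \<Rightarrow> ('r, 'n) module \<Rightarrow> ('r, ('r \<times> 'n \<Rightarrow>\<^sub>0 int) set) module" where
  "extend_scalars A B N = (let P = ring_via (\<lambda>a. a) B; G = tensor_group A P N in
     \<lparr>carrier = carrier G, mult = undefined, one = undefined,
      ring.zero = \<one>\<^bsub>G\<^esub>, add = (\<otimes>\<^bsub>G\<^esub>),
      smult = (\<lambda>b. tensor_map A P N (\<lambda>s. b \<otimes>\<^bsub>B\<^esub> s) (\<lambda>n. n))\<rparr>)"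


section \<open>The left adjoint\<close>

text \<open>The structure map for \<open>F \<subseteq> E\<close> goes through \<open>R(E) \<otimes> N(F)\<close> over \<open>R\<^sub>i\<^sub>n\<^sub>v(F)\<close>.  The class of \<open>\<one>\<close> at
  \<open>E\<close> is the one indexing the poset morphism \<open>F \<rightarrow> E\<close>, and the class of \<open>w\<close> at \<open>E\<close> the one indexing
  \<open>w : E \<rightarrow> E\<^sup>w\<close>.\<close>

definition theta ::
  "('s, 'w) poset_action \<Rightarrow> ('s \<times> 's \<times> 'w) set \<Rightarrow> ('s, 'w, 'r) ring_diagram \<Rightarrow>
   ('s, 'w, 'r, 'n) residual_module_diagram \<Rightarrow>
   ('s, 'w, 'r, ('r \<times> 'n \<Rightarrow>\<^sub>0 int) set) module_diagram" where
  "theta T C R N = (let A = R_inv T C R in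
     \<lparr>ob = (\<lambda>E. extend_scalars (dob A E) (ob R E) (dob N E)),
      smap = (\<lambda>F E.
        tensor_map (dob A E) (ring_via (\<lambda>a. a) (ob R E)) (dob N E)
          (\<lambda>r. r) (dmap N F E (dclass T C E \<one>\<^bsub>grp T\<^esub>)) \<circ>
        tensor_map (dob A F) (ring_via (smap R F E) (ob R E)) (dob N F)
          (smap R F E) (\<lambda>n. n)),
      wmap = (\<lambda>w E.
        tensor_map (dob A (act T E w)) (ring_via (\<lambda>a. a) (ob R (act T E w))) (dob N (act T E w))
          (wmap R w E) (dmap N E E (dclass T C E w)))\<rparr>)"

definition theta_map ::
  "('s, 'w) poset_action \<Rightarrow> ('s \<times> 's \<times> 'w) set \<Rightarrow> ('s, 'w, 'r) ring_diagram \<Rightarrow>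
   ('s, 'w, 'r, 'n) residual_module_diagram \<Rightarrow> ('s, 'w, 'r, 'k) residual_module_diagram \<Rightarrow>
   ('s \<Rightarrow> 'n \<Rightarrow> 'k) \<Rightarrow> 's \<Rightarrow> ('r \<times> 'n \<Rightarrow>\<^sub>0 int) set \<Rightarrow> ('r \<times> 'k \<Rightarrow>\<^sub>0 int) set" where
  "theta_map T C R N N' f = (\<lambda>E\<in>pts T. \<lambda>K\<in>carrier (ob (theta T C R N) E).
     tensor_map (dob (R_inv T C R) E) (ring_via (\<lambda>a. a) (ob R E)) (dob N' E) (\<lambda>r. r) (f E) K)"

definition unit_map ::
  "('s, 'w) poset_action \<Rightarrow> ('s \<times> 's \<times> 'w) set \<Rightarrow> ('s, 'w, 'r) ring_diagram \<Rightarrow>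
   ('s, 'w, 'r, 'n) residual_module_diagram \<Rightarrow> 's \<Rightarrow> 'n \<Rightarrow> ('r \<times> 'n \<Rightarrow>\<^sub>0 int) set" where
  "unit_map T C R N = (\<lambda>E\<in>pts T. \<lambda>n\<in>carrier (dob N E).
     pure_tensor (dob (R_inv T C R) E) (ring_via (\<lambda>a. a) (ob R E)) (dob N E) \<one>\<^bsub>ob R E\<^esub> n)"

text \<open>The adjunct \<open>\<Psi> f \<circ> \<eta>\<^sub>N : N \<rightarrow> \<Psi> M\<close> of \<open>f : \<theta>\<^sub>* N \<rightarrow> M\<close>.\<close>

definition adjunct ::
  "('s, 'w) poset_action \<Rightarrow> ('s \<times> 's \<times> 'w) set \<Rightarrow> ('s, 'w, 'r) ring_diagram \<Rightarrow>
   ('s, 'w, 'r, 'n) residual_module_diagram \<Rightarrow> ('s, 'w, 'r, 'm) module_diagram \<Rightarrow>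
   ('s \<Rightarrow> ('r \<times> 'n \<Rightarrow>\<^sub>0 int) set \<Rightarrow> 'm) \<Rightarrow> 's \<Rightarrow> 'n \<Rightarrow> 'm" where
  "adjunct T C R N M f = family_comp T (\<lambda>E. carrier (dob N E))
     (Psi_map T C (theta T C R N) M f) (unit_map T C R N)"

text \<open>Isomorphisms of modules on the discrete residual, between modules whose elements may lie in
  different types.\<close>

definition residual_iso ::
  "('s, 'w) poset_action \<Rightarrow> ('s \<times> 's \<times> 'w) set \<Rightarrow> ('s, 'w, 'r) residual_ring_diagram \<Rightarrow>
   ('s, 'w, 'r, 'n) residual_module_diagram \<Rightarrow> ('s, 'w, 'r, 'k) residual_module_diagram \<Rightarrow>
   ('s \<Rightarrow> 'n \<Rightarrow> 'k) set" where
  "residual_iso T C A N N' = {f \<in> residual_hom T C A N N'. \<exists>g\<in>residual_hom T C A N' N.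
     family_comp T (\<lambda>E. carrier (dob N E)) g f = family_id T (\<lambda>E. carrier (dob N E)) \<and>
     family_comp T (\<lambda>E. carrier (dob N' E)) f g = family_id T (\<lambda>E. carrier (dob N' E))}"

end

theory Submission
  imports Defs "HOL-Algebra.Subrings"
begin

text \<open>Since the component structure is decreasing, a structure map carries \<open>W\<^sub>F\<^sup>e\<close>-invariants to
  \<open>W\<^sub>E\<^sup>e\<close>-invariants.  Since conjugation by \<open>v\<close> carries \<open>W\<^sub>E\<^sup>e\<close> onto the group of \<open>E\<^sup>v\<close>, the map \<open>v\<^sub>m\<close>
  carries invariants to invariants, and on them it depends only on \<open>[v]\<close>.  The adjunction is, object
  by object, the one between extension and restriction of scalars: a map out of \<open>R(E) \<otimes> N(E)\<close> is
  determined by its values on \<open>1 \<otimes> n\<close>, and these are invariant because \<open>W\<^sub>E\<^sup>e\<close> acts trivially on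
  \<open>N(E)\<close>.  When \<open>|W|\<close> is invertible, averaging over \<open>W\<^sub>E\<^sup>e\<close> gives an \<open>R\<^sub>i\<^sub>n\<^sub>v(E)\<close>-linear retraction of
  \<open>R(E)\<close> onto \<open>R\<^sub>i\<^sub>n\<^sub>v(E)\<close>, and tensoring it with \<open>N(E)\<close> gives the inverse of the unit.\<close>

section \<open>Tensor products\<close>

text \<open>Equations between maps out of \<open>\<theta>_* N\<close> are additive, so they are
  checked on pure tensors, where they split into an equation in \<open>R\<close> and one in
  \<open>N\<close>. The labour lies in well-definedness, since tensor products over different rings
  are compared. What makes it work is that both factors of such a map are semilinear along one and
  the same map of base rings, so that balancing relations go to balancing relations.

  On the residual side a class \<open>[v]\<close> is a double coset, and the maps on invariants use
  an arbitrary representative of it. Conjugation invariance moves the right-hand factor across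
  \<open>v\<close>, which leaves \<open>W_\<tau>^e v\<close>; the remaining left factor acts first,
  on an element that it fixes. That \<open>W_E^e\<close> acts trivially on \<open>N(E)\<close> is no
  axiom: each of its elements has the class of the identity.

  The adjunction is obtained as a bijection of morphism sets, \<open>f\<close> going to
  \<open>n \<mapsto> f (1 \<otimes> n)\<close>, natural on both sides. The averaging constant exists
  because \<open>|W_E^e|\<close> divides \<open>|W|\<close>, and it is itself invariant, being the
  inverse of an integer.\<close>

lemma tensor_relationsE:
  assumes "k \<in> tensor_relations A P Q"
  obtains (left) p p' q where "p \<in> carrier P" "p' \<in> carrier P" "q \<in> carrier Q"
      "k = frag_of (p \<oplus>\<^bsub>P\<^esub> p', q) - frag_of (p, q) - frag_of (p', q)"
    | (right) p q q' where "p \<in> carrier P" "q \<in> carrier Q" "q' \<in> carrier Q"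
      "k = frag_of (p, q \<oplus>\<^bsub>Q\<^esub> q') - frag_of (p, q) - frag_of (p, q')"
    | (balanced) a p q where "a \<in> carrier A" "p \<in> carrier P" "q \<in> carrier Q"
      "k = frag_of (a \<odot>\<^bsub>P\<^esub> p, q) - frag_of (p, a \<odot>\<^bsub>Q\<^esub> q)"
  using assms unfolding tensor_relations_def by (elim UnE CollectE exE conjE)

lemma tensor_relationsI:
  "\<lbrakk>p \<in> carrier P; p' \<in> carrier P; q \<in> carrier Q\<rbrakk>
    \<Longrightarrow> frag_of (p \<oplus>\<^bsub>P\<^esub> p', q) - frag_of (p, q) - frag_of (p', q) \<in> tensor_relations A P Q"
  "\<lbrakk>p \<in> carrier P; q \<in> carrier Q; q' \<in> carrier Q\<rbrakk>
    \<Longrightarrow> frag_of (p, q \<oplus>\<^bsub>Q\<^esub> q') - frag_of (p, q) - frag_of (p, q') \<in> tensor_relations A P Q"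
  "\<lbrakk>a \<in> carrier A; p \<in> carrier P; q \<in> carrier Q\<rbrakk>
    \<Longrightarrow> frag_of (a \<odot>\<^bsub>P\<^esub> p, q) - frag_of (p, a \<odot>\<^bsub>Q\<^esub> q) \<in> tensor_relations A P Q"
  unfolding tensor_relations_def by auto

section \<open>The tensor product as a quotient group, and its pure tensors\<close>

locale tensor_product = P: Module.module A P + Q: Module.module A Q
  for A :: "'a ring" and P :: "('a, 'p) module" and Q :: "('a, 'q) module"
begin

abbreviation "cls k \<equiv> tensor_null A P Q #>\<^bsub>tensor_free P Q\<^esub> k"

sublocale free: comm_group "tensor_free P Q"
  by (simp add: tensor_free_def abelian_free_Abelian_group)

lemma carrier_free [simp]:
  "k \<in> carrier (tensor_free P Q) \<longleftrightarrow> Poly_Mapping.keys k \<subseteq> carrier P \<times> carrier Q"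
  by (simp add: tensor_free_def)

lemma mult_free [simp]: "k \<otimes>\<^bsub>tensor_free P Q\<^esub> l = k + l"
  by (simp add: tensor_free_def)

lemma relations_subset: "tensor_relations A P Q \<subseteq> carrier (tensor_free P Q)"
proof -
  have "k - l \<in> carrier (tensor_free P Q)"
    if "k \<in> carrier (tensor_free P Q)" "l \<in> carrier (tensor_free P Q)" for k l
    using that keys_diff[of k l] by auto
  then show ?thesis
    unfolding tensor_relations_def by (auto simp del: carrier_free simp: tensor_free_def)
qed

sublocale null: normal "tensor_null A P Q" "tensor_free P Q"
  unfolding tensor_null_def
  by (intro free.subgroup_imp_normal free.generate_is_subgroup relations_subset)

sublocale tensor: comm_group "tensor_group A P Q"
  unfolding tensor_group_def by (intro free.abelian_FactGroup null.subgroup_axioms)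

lemma carrier_tensor:
  "carrier (tensor_group A P Q) = cls ` {k. Poly_Mapping.keys k \<subseteq> carrier P \<times> carrier Q}"
  by (force simp: tensor_group_def carrier_FactGroup)

lemma one_tensor: "\<one>\<^bsub>tensor_group A P Q\<^esub> = tensor_null A P Q"
  by (simp add: tensor_group_def)

lemma mult_cls:
  assumes "Poly_Mapping.keys k \<subseteq> carrier P \<times> carrier Q"
    and "Poly_Mapping.keys l \<subseteq> carrier P \<times> carrier Q"
  shows "cls k \<otimes>\<^bsub>tensor_group A P Q\<^esub> cls l = cls (k + l)"
  using null.rcos_sum[of k l] assms by (simp add: tensor_group_def)

lemma cls_eqI:
  assumes "Poly_Mapping.keys k \<subseteq> carrier P \<times> carrier Q"
    and "Poly_Mapping.keys l \<subseteq> carrier P \<times> carrier Q"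
    and "k - l \<in> tensor_null A P Q"
  shows "cls k = cls l"
proof -
  have "k = (k - l) \<otimes>\<^bsub>tensor_free P Q\<^esub> l" by simp
  then have "k \<in> cls l"
    using assms(3) unfolding r_coset_def by blast
  then show ?thesis
    using free.repr_independence[of k "tensor_null A P Q" l] assms null.subgroup_axioms by simp
qed

lemma relation_null: "k \<in> tensor_relations A P Q \<Longrightarrow> k \<in> tensor_null A P Q"
  unfolding tensor_null_def by (rule generate.incl)

lemma pure_closed [simp]:
  "\<lbrakk>p \<in> carrier P; q \<in> carrier Q\<rbrakk> \<Longrightarrow> pure_tensor A P Q p q \<in> carrier (tensor_group A P Q)"
  unfolding pure_tensor_def carrier_tensor by force

lemma pure_add_left:
  assumes "p \<in> carrier P" "p' \<in> carrier P" "q \<in> carrier Q"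
  shows "pure_tensor A P Q (p \<oplus>\<^bsub>P\<^esub> p') q =
    pure_tensor A P Q p q \<otimes>\<^bsub>tensor_group A P Q\<^esub> pure_tensor A P Q p' q"
proof -
  have "frag_of (p \<oplus>\<^bsub>P\<^esub> p', q) - frag_of (p, q) - frag_of (p', q) \<in> tensor_null A P Q"
    using assms by (intro relation_null tensor_relationsI)
  moreover have "Poly_Mapping.keys (frag_of (p, q) + frag_of (p', q)) \<subseteq> carrier P \<times> carrier Q"
    using assms keys_add[of "frag_of (p, q)" "frag_of (p', q)"] by auto
  ultimately show ?thesis
    using assms by (simp add: pure_tensor_def mult_cls cls_eqI diff_diff_eq)
qed

lemma pure_add_right:
  assumes "p \<in> carrier P" "q \<in> carrier Q" "q' \<in> carrier Q"
  shows "pure_tensor A P Q p (q \<oplus>\<^bsub>Q\<^esub> q') =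
    pure_tensor A P Q p q \<otimes>\<^bsub>tensor_group A P Q\<^esub> pure_tensor A P Q p q'"
proof -
  have "frag_of (p, q \<oplus>\<^bsub>Q\<^esub> q') - frag_of (p, q) - frag_of (p, q') \<in> tensor_null A P Q"
    using assms by (intro relation_null tensor_relationsI)
  moreover have "Poly_Mapping.keys (frag_of (p, q) + frag_of (p, q')) \<subseteq> carrier P \<times> carrier Q"
    using assms keys_add[of "frag_of (p, q)" "frag_of (p, q')"] by auto
  ultimately show ?thesis
    using assms by (simp add: pure_tensor_def mult_cls cls_eqI diff_diff_eq)
qed

lemma pure_balanced:
  assumes "a \<in> carrier A" "p \<in> carrier P" "q \<in> carrier Q"
  shows "pure_tensor A P Q (a \<odot>\<^bsub>P\<^esub> p) q = pure_tensor A P Q p (a \<odot>\<^bsub>Q\<^esub> q)"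
proof -
  have "frag_of (a \<odot>\<^bsub>P\<^esub> p, q) - frag_of (p, a \<odot>\<^bsub>Q\<^esub> q) \<in> tensor_null A P Q"
    using assms by (intro relation_null tensor_relationsI)
  then show ?thesis
    using assms by (simp add: pure_tensor_def cls_eqI)
qed

lemma tensor_induct [consumes 1, case_names pure add]:
  assumes x: "x \<in> carrier (tensor_group A P Q)"
    and pure: "\<And>p q. \<lbrakk>p \<in> carrier P; q \<in> carrier Q\<rbrakk> \<Longrightarrow> S (pure_tensor A P Q p q)"
    and add: "\<And>x y. \<lbrakk>x \<in> carrier (tensor_group A P Q); y \<in> carrier (tensor_group A P Q); S x; S y\<rbrakk>
      \<Longrightarrow> S (x \<otimes>\<^bsub>tensor_group A P Q\<^esub> y)"
  shows "S x"
proof -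
  have cl: "cls k \<in> carrier (tensor_group A P Q)"
    if "Poly_Mapping.keys k \<subseteq> carrier P \<times> carrier Q" for k
    using that unfolding carrier_tensor by blast
  have cls_0: "cls 0 = \<one>\<^bsub>tensor_group A P Q\<^esub>"
    using free.coset_mult_one[OF null.subset] by (simp add: one_tensor tensor_free_def)
  \<comment> \<open>By additivity this element equals its own square in the group, hence is
    neutral.\<close>
  have zero: "pure_tensor A P Q \<zero>\<^bsub>P\<^esub> q = \<one>\<^bsub>tensor_group A P Q\<^esub>" if "q \<in> carrier Q" for q
    using pure_add_left[of "\<zero>\<^bsub>P\<^esub>" "\<zero>\<^bsub>P\<^esub>" q] that tensor.r_cancel_one' by simp
  have neg: "cls (- frag_of (p, q)) = pure_tensor A P Q (\<ominus>\<^bsub>P\<^esub> p) q"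
    if pq: "p \<in> carrier P" "q \<in> carrier Q" for p q
  proof -
    have k: "Poly_Mapping.keys (frag_of (p, q)) \<subseteq> carrier P \<times> carrier Q"
      using pq by simp
    have "pure_tensor A P Q (\<ominus>\<^bsub>P\<^esub> p) q \<otimes>\<^bsub>tensor_group A P Q\<^esub> pure_tensor A P Q p q =
        \<one>\<^bsub>tensor_group A P Q\<^esub>"
      using pure_add_left[of "\<ominus>\<^bsub>P\<^esub> p" p q] pq zero by (simp add: P.M.l_neg)
    moreover have "cls (- frag_of (p, q)) \<otimes>\<^bsub>tensor_group A P Q\<^esub> pure_tensor A P Q p q =
        \<one>\<^bsub>tensor_group A P Q\<^esub>"
      using k mult_cls[of "- frag_of (p, q)" "frag_of (p, q)"] cls_0
      by (simp add: pure_tensor_def del: keys_single)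
    ultimately show ?thesis
      using pq cl[of "- frag_of (p, q)"] k
        tensor.right_cancel[of "pure_tensor A P Q p q" "cls (- frag_of (p, q))" "pure_tensor A P Q
            (\<ominus>\<^bsub>P\<^esub> p) q"]
      by simp
  qed
  obtain k where k: "Poly_Mapping.keys k \<subseteq> carrier P \<times> carrier Q" "x = cls k"
    using x unfolding carrier_tensor by blast
  \<comment> \<open>The induction rule for free abelian groups closes under differences, so the
    claim is carried for \<open>k\<close> and \<open>- k\<close> together.\<close>
  have "S (cls k) \<and> S (cls (- k))"
    using k(1)
  proof (rule free_Abelian_group_induct)
    show "S (cls 0) \<and> S (cls (- 0))"
      using cls_0 pure[of "\<zero>\<^bsub>P\<^esub>" "\<zero>\<^bsub>Q\<^esub>"] zero[of "\<zero>\<^bsub>Q\<^esub>"] by simp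
  next
    fix x y :: "'p \<times> 'q \<Rightarrow>\<^sub>0 int"
    assume "Poly_Mapping.keys x \<subseteq> carrier P \<times> carrier Q" "Poly_Mapping.keys y \<subseteq> carrier P \<times> carrier Q"
      "S (cls x) \<and> S (cls (- x))" "S (cls y) \<and> S (cls (- y))"
    then show "S (cls (x - y)) \<and> S (cls (- (x - y)))"
      using add[of "cls x" "cls (- y)"] add[of "cls (- x)" "cls y"] mult_cls[of x "- y"]
          mult_cls[of "- x" y]
        cl[of x] cl[of y] cl[of "- x"] cl[of "- y"]
      by simp
  next
    fix a assume "a \<in> carrier P \<times> carrier Q"
    then obtain p q where "a = (p, q)" "p \<in> carrier P" "q \<in> carrier Q" by blast
    then show "S (cls (frag_of a)) \<and> S (cls (- frag_of a))"
      using pure[of p q] pure[of "\<ominus>\<^bsub>P\<^esub> p" q] neg[of p q] by (simp add: pure_tensor_def)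
  qed
  then show ?thesis using k(2) by simp
qed

text \<open>Freeness extends \<open>f\<close> to formal combinations, and the last three hypotheses
  say that this extension kills the three families of relations. It serves for targets that are not
  tensor products themselves: the maps \<open>b \<otimes> n \<mapsto> b g(n)\<close> of the
  adjunction and the inverse of the unit.\<close>

lemma tensor_universal:
  fixes G :: "('x, 'y) ring_scheme"
  assumes G: "abelian_group G"
    and closed: "\<And>p q. \<lbrakk>p \<in> carrier P; q \<in> carrier Q\<rbrakk> \<Longrightarrow> f p q \<in> carrier G"
    and left: "\<And>p p' q. \<lbrakk>p \<in> carrier P; p' \<in> carrier P; q \<in> carrier Q\<rbrakk>
      \<Longrightarrow> f (p \<oplus>\<^bsub>P\<^esub> p') q = f p q \<oplus>\<^bsub>G\<^esub> f p' q"
    and right: "\<And>p q q'. \<lbrakk>p \<in> carrier P; q \<in> carrier Q; q' \<in> carrier Q\<rbrakk>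
      \<Longrightarrow> f p (q \<oplus>\<^bsub>Q\<^esub> q') = f p q \<oplus>\<^bsub>G\<^esub> f p q'"
    and balanced: "\<And>a p q. \<lbrakk>a \<in> carrier A; p \<in> carrier P; q \<in> carrier Q\<rbrakk>
      \<Longrightarrow> f (a \<odot>\<^bsub>P\<^esub> p) q = f p (a \<odot>\<^bsub>Q\<^esub> q)"
  obtains h where "h \<in> hom (tensor_group A P Q) (add_monoid G)"
    and "\<And>p q. \<lbrakk>p \<in> carrier P; q \<in> carrier Q\<rbrakk> \<Longrightarrow> h (pure_tensor A P Q p q) = f p q"
proof -
  interpret G: abelian_group G by (rule G)
  have "(\<lambda>(p, q). f p q) ` (carrier P \<times> carrier Q) \<subseteq> carrier (add_monoid G)"
    using closed by auto
  then obtain h where h: "h \<in> hom (tensor_free P Q) (add_monoid G)"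
    and hf': "\<And>x. x \<in> carrier P \<times> carrier Q \<Longrightarrow> h (frag_of x) = (case x of (p, q) \<Rightarrow> f p q)"
    unfolding tensor_free_def
    by (rule comm_group.free_Abelian_group_universal[OF G.a_comm_group]) blast
  have hf: "h (frag_of (p, q)) = f p q" if "p \<in> carrier P" "q \<in> carrier Q" for p q
    using hf'[of "(p, q)"] that by simp
  interpret h: group_hom "tensor_free P Q" "add_monoid G" h
    using h by unfold_locales
  have diff: "h (k - l) = h k \<ominus>\<^bsub>G\<^esub> h l"
    if "Poly_Mapping.keys k \<subseteq> carrier P \<times> carrier Q" "Poly_Mapping.keys l \<subseteq> carrier P \<times> carrier Q"
        for k l
    using h.hom_mult[of k "- l"] h.hom_inv[of l] that
    by (simp add: keys_minus G.minus_eq tensor_free_def a_inv_def)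
  have diff_closed: "Poly_Mapping.keys (k - l) \<subseteq> carrier P \<times> carrier Q"
    if "Poly_Mapping.keys k \<subseteq> carrier P \<times> carrier Q" "Poly_Mapping.keys l \<subseteq> carrier P \<times> carrier Q"
    for k l :: "'p \<times> 'q \<Rightarrow>\<^sub>0 int"
    using that keys_diff[of k l] by auto
  have cancel: "x \<oplus>\<^bsub>G\<^esub> y \<ominus>\<^bsub>G\<^esub> x \<ominus>\<^bsub>G\<^esub> y = \<zero>\<^bsub>G\<^esub>" if "x \<in> carrier G" "y \<in> carrier G" for x y
    using that by (simp add: G.minus_eq G.a_assoc G.a_comm[of y] G.r_neg1 G.r_neg)
  have "h k = \<zero>\<^bsub>G\<^esub>" if "k \<in> tensor_relations A P Q" for k
    using that
  proof (cases rule: tensor_relationsE)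
    case (left p p' q)
    then show ?thesis
      using diff_closed[of "frag_of (p \<oplus>\<^bsub>P\<^esub> p', q)" "frag_of (p, q)"] cancel[of "f p q" "f p' q"]
      by (simp add: diff hf assms)
  next
    case (right p q q')
    then show ?thesis
      using diff_closed[of "frag_of (p, q \<oplus>\<^bsub>Q\<^esub> q')" "frag_of (p, q)"] cancel[of "f p q" "f p q'"]
      by (simp add: diff hf assms)
  next
    case (balanced a p q)
    then show ?thesis
      by (simp add: diff hf assms G.minus_eq G.r_neg)
  qed
  then have "tensor_relations A P Q \<subseteq> kernel (tensor_free P Q) (add_monoid G) h"
    using relations_subset by (auto simp: kernel_def simp del: carrier_free)
  then have null0: "tensor_null A P Q \<subseteq> kernel (tensor_free P Q) (add_monoid G) h"
    unfolding tensor_null_def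
    by (rule free.generate_subgroup_incl[OF _ h.subgroup_kernel])
  \<comment> \<open>Descent to the quotient asks that \<open>h\<close> be constant on cosets: two
    representatives differ by an element of \<open>tensor_null\<close>, which \<open>h\<close>
    kills.\<close>
  have "h x = h y" if xy: "x \<in> carrier (tensor_free P Q)" "y
      \<in> carrier (tensor_free P Q)" "cls x = cls y" for x y
  proof -
    have "x \<in> cls y"
      using free.rcos_self[OF xy(1) null.subgroup_axioms] xy(3) by simp
    then obtain z where z: "z \<in> tensor_null A P Q" "x = z + y"
      unfolding r_coset_def by auto
    then have "h z = \<zero>\<^bsub>G\<^esub>" "z \<in> carrier (tensor_free P Q)"
      using null0 null.subset by (auto simp: kernel_def)
    then show ?thesis
      using h.hom_mult[of z y] z(2) xy h.hom_closed[OF xy(2)] by simp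
  qed
  then obtain g where "g \<in> hom (tensor_group A P Q) (add_monoid G)"
    and "\<And>x. x \<in> carrier (tensor_free P Q) \<Longrightarrow> g (cls x) = h x"
    unfolding tensor_group_def by (rule FactGroup_universal[OF h null.normal_axioms]) blast+
  with that[of g] hf show thesis
    by (simp add: pure_tensor_def)
qed

end

text \<open>The base ring may change: semilinearity of both factors along a common
  \<open>\<phi>\<close> sends the balancing relation for \<open>a\<close> to the one for
  \<open>\<phi> a\<close>. This single form covers scalar multiplication, structure maps, the maps
  of \<open>W\<close> and maps induced by morphisms.\<close>

lemma tensor_map_hom:
  assumes src: "tensor_product A0 P0 Q0" and tgt: "tensor_product A P Q"
    and f: "f \<in> semilinear \<phi> A0 P0 P" and g: "g \<in> semilinear \<phi> A0 Q0 Q"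
    and \<phi>: "\<phi> \<in> carrier A0 \<rightarrow> carrier A"
  shows "tensor_map A P Q f g \<in> hom (tensor_group A0 P0 Q0) (tensor_group A P Q)"
    and "\<lbrakk>p \<in> carrier P0; q \<in> carrier Q0\<rbrakk>
      \<Longrightarrow> tensor_map A P Q f g (pure_tensor A0 P0 Q0 p q) = pure_tensor A P Q (f p) (g q)"
proof -
  interpret s: tensor_product A0 P0 Q0 by (rule src)
  interpret t: tensor_product A P Q by (rule tgt)
  let ?e = "frag_extend (\<lambda>(p, q). frag_of (f p, g q))"
  have e_closed: "Poly_Mapping.keys (?e k) \<subseteq> carrier P \<times> carrier Q"
    if "Poly_Mapping.keys k \<subseteq> carrier P0 \<times> carrier Q0" for k
  proof -
    have "f p \<in> carrier P" "g q \<in> carrier Q" if "(p, q) \<in> Poly_Mapping.keys k" for p q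
      using that \<open>Poly_Mapping.keys k \<subseteq> _\<close> f g by (auto simp: semilinear_def)
    then show ?thesis
      using keys_frag_extend[of "\<lambda>(p, q). frag_of (f p, g q)" k] by (auto split: prod.splits)
  qed
  have e_hom: "?e \<in> hom (tensor_free P0 Q0) (tensor_free P Q)"
    using e_closed by (intro homI) (simp_all add: frag_extend_add)
  interpret e: group_hom "tensor_free P0 Q0" "tensor_free P Q" ?e
    using e_hom by unfold_locales
  have e_relation: "?e k \<in> tensor_relations A P Q" if "k \<in> tensor_relations A0 P0 Q0" for k
    using that
  proof (cases rule: tensor_relationsE)
    case (left p p' q)
    then have "f p \<in> carrier P" "f p' \<in> carrier P" "g q \<in> carrier Q"
      using f g by (auto simp: semilinear_def)
    then show ?thesis
      using left f tensor_relationsI(1)[of "f p" P "f p'" "g q" Q]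
          by (simp add: semilinear_def frag_extend_diff)
  next
    case (right p q q')
    then have "f p \<in> carrier P" "g q \<in> carrier Q" "g q' \<in> carrier Q"
      using f g by (auto simp: semilinear_def)
    then show ?thesis
      using right g tensor_relationsI(2)[of "f p" P "g q" Q "g q'"]
          by (simp add: semilinear_def frag_extend_diff)
  next
    case (balanced a p q)
    then have "f p \<in> carrier P" "g q \<in> carrier Q" "\<phi> a \<in> carrier A"
      using f g \<phi> by (auto simp: semilinear_def)
    then show ?thesis
      using balanced f g tensor_relationsI(3)[of "\<phi> a" A "f p" P "g q" Q]
      by (simp add: semilinear_def frag_extend_diff)
  qed
  then have "?e ` tensor_relations A0 P0 Q0 \<subseteq> tensor_relations A P Q"
    by blast
  then have null: "?e ` tensor_null A0 P0 Q0 \<subseteq> tensor_null A P Q"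
    unfolding tensor_null_def
    using e.generate_img[OF s.relations_subset]
      t.free.mono_generate[of "?e ` tensor_relations A0 P0 Q0" "tensor_relations A P Q"] by simp
  \<comment> \<open>The image of a coset is in general only part of a coset, and adding
    \<open>tensor_null\<close> fills it up. That no second coset is met is the inclusion
    \<open>null\<close>.\<close>
  have map_cls: "tensor_map A P Q f g (s.cls k) = t.cls (?e k)"
    if k: "Poly_Mapping.keys k \<subseteq> carrier P0 \<times> carrier Q0" for k
  proof
    show "tensor_map A P Q f g (s.cls k) \<subseteq> t.cls (?e k)"
    proof
      fix x assume "x \<in> tensor_map A P Q f g (s.cls k)"
      then obtain m n where mn: "m \<in> tensor_null A P Q" "n \<in> tensor_null A0 P0 Q0" "x = m + ?e (n + k)"
        unfolding tensor_map_def set_mult_def r_coset_def by auto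
      then have "m + ?e n \<in> tensor_null A P Q" "x = (m + ?e n) + ?e k"
        using null t.null.m_closed[of m "?e n"] by (auto simp: frag_extend_add)
      then show "x \<in> t.cls (?e k)" unfolding r_coset_def by auto
    qed
    show "t.cls (?e k) \<subseteq> tensor_map A P Q f g (s.cls k)"
    proof
      fix x assume "x \<in> t.cls (?e k)"
      then obtain m where m: "m \<in> tensor_null A P Q" "x = m + ?e k"
        unfolding r_coset_def by auto
      moreover have "k \<in> s.cls k"
        using s.free.rcos_self[of k "tensor_null A0 P0 Q0"] k s.null.subgroup_axioms by simp
      ultimately show "x \<in> tensor_map A P Q f g (s.cls k)"
        unfolding tensor_map_def set_mult_def by auto
    qed
  qed
  show "tensor_map A P Q f g \<in> hom (tensor_group A0 P0 Q0) (tensor_group A P Q)"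
  proof (rule homI)
    fix x y assume "x \<in> carrier (tensor_group A0 P0 Q0)" "y \<in> carrier (tensor_group A0 P0 Q0)"
    then obtain k l where kl: "Poly_Mapping.keys k \<subseteq> carrier P0 \<times> carrier Q0" "x = s.cls k"
      "Poly_Mapping.keys l \<subseteq> carrier P0 \<times> carrier Q0" "y = s.cls l"
      unfolding s.carrier_tensor by blast
    then have "Poly_Mapping.keys (k + l) \<subseteq> carrier P0 \<times> carrier Q0"
      using keys_add[of k l] by auto
    with kl show "tensor_map A P Q f g (x \<otimes>\<^bsub>tensor_group A0 P0 Q0\<^esub> y) =
        tensor_map A P Q f g x \<otimes>\<^bsub>tensor_group A P Q\<^esub> tensor_map A P Q f g y"
      by (simp add: s.mult_cls t.mult_cls map_cls e_closed frag_extend_add)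
  qed (auto simp: s.carrier_tensor t.carrier_tensor map_cls e_closed)
  show "tensor_map A P Q f g (pure_tensor A0 P0 Q0 p q) = pure_tensor A P Q (f p) (g q)"
    if "p \<in> carrier P0" "q \<in> carrier Q0"
    using that map_cls[of "frag_of (p, q)"] by (simp add: pure_tensor_def)
qed

section \<open>Extension of scalars\<close>

lemma semilinearI:
  assumes "\<And>x. x \<in> carrier P \<Longrightarrow> f x \<in> carrier Q"
    and "\<And>x y. \<lbrakk>x \<in> carrier P; y \<in> carrier P\<rbrakk> \<Longrightarrow> f (x \<oplus>\<^bsub>P\<^esub> y) = f x \<oplus>\<^bsub>Q\<^esub> f y"
    and "\<And>a x. \<lbrakk>a \<in> carrier A; x \<in> carrier P\<rbrakk> \<Longrightarrow> f (a \<odot>\<^bsub>P\<^esub> x) = \<phi> a \<odot>\<^bsub>Q\<^esub> f x"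
  shows "f \<in> semilinear \<phi> A P Q"
  using assms by (auto simp: semilinear_def)

lemma semilinear_closed: "\<lbrakk>f \<in> semilinear \<phi> A P Q; x \<in> carrier P\<rbrakk> \<Longrightarrow> f x \<in> carrier Q"
  by (auto simp: semilinear_def)

lemma semilinear_add:
  "\<lbrakk>f \<in> semilinear \<phi> A P Q; x \<in> carrier P; y \<in> carrier P\<rbrakk> \<Longrightarrow> f (x \<oplus>\<^bsub>P\<^esub> y) = f x \<oplus>\<^bsub>Q\<^esub> f y"
  by (auto simp: semilinear_def)

lemma semilinear_smult:
  "\<lbrakk>f \<in> semilinear \<phi> A P Q; a \<in> carrier A; x \<in> carrier P\<rbrakk> \<Longrightarrow> f (a \<odot>\<^bsub>P\<^esub> x) = \<phi> a \<odot>\<^bsub>Q\<^esub> f x"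
  by (auto simp: semilinear_def)

text \<open>\<open>h\<close> and \<open>\<chi>\<close> agree with the composites on carriers only,
  because composites of morphisms are stored as restricted functions.\<close>

lemma semilinear_compose:
  assumes f: "f \<in> semilinear \<phi> A P Q" and g: "g \<in> semilinear \<psi> B Q U"
    and \<phi>: "\<And>a. a \<in> carrier A \<Longrightarrow> \<phi> a \<in> carrier B"
    and h: "\<And>x. x \<in> carrier P \<Longrightarrow> h x = g (f x)"
    and \<chi>: "\<And>a. a \<in> carrier A \<Longrightarrow> \<chi> a = \<psi> (\<phi> a)"
    and P: "Module.module A P"
  shows "h \<in> semilinear \<chi> A P U"
proof -
  interpret P: Module.module A P by (rule P)
  show ?thesis
    using \<phi> by (intro semilinearI)
      (simp_all add: h \<chi> semilinear_closed[OF f] semilinear_closed[OF g] semilinear_add[OF f]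
        semilinear_add[OF g] semilinear_smult[OF f] semilinear_smult[OF g])
qed

lemma ring_via_sel [simp]:
  "carrier (ring_via \<phi> B) = carrier B"
  "x \<oplus>\<^bsub>ring_via \<phi> B\<^esub> y = x \<oplus>\<^bsub>B\<^esub> y"
  "\<zero>\<^bsub>ring_via \<phi> B\<^esub> = \<zero>\<^bsub>B\<^esub>"
  "a \<odot>\<^bsub>ring_via \<phi> B\<^esub> x = \<phi> a \<otimes>\<^bsub>B\<^esub> x"
  by (simp_all add: ring_via_def)

lemma ring_via_module:
  assumes A: "cring A" and B: "cring B" and \<phi>: "\<phi> \<in> ring_hom A B"
  shows "Module.module A (ring_via \<phi> B)"
proof -
  interpret A: cring A by (rule A)
  interpret B: cring B by (rule B)
  have closed: "\<phi> a \<in> carrier B" if "a \<in> carrier A" for a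
    using \<phi> that by (rule ring_hom_closed)
  have "\<exists>y\<in>carrier B. y \<oplus>\<^bsub>B\<^esub> x = \<zero>\<^bsub>B\<^esub>" if "x \<in> carrier B" for x
    using that B.l_neg by blast
  then have "abelian_group (ring_via \<phi> B)"
    by (intro abelian_groupI) (simp_all add: B.a_ac)
  then show ?thesis
    using A by (intro moduleI)
      (simp_all add: closed B.l_distr B.r_distr B.m_assoc ring_hom_add[OF \<phi>] ring_hom_mult[OF \<phi>]
          ring_hom_one[OF \<phi>])
qed

text \<open>That the identity function is a ring homomorphism encodes that \<open>A\<close> is a
  subring: on its carrier the operations agree with those of \<open>B\<close>. The rings share one
  type, as \<open>R_inv\<close> and \<open>R\<close> do.\<close>

locale scalar_extension = B: cring B + N: Module.module A N
  for A B :: "'r ring" and N :: "('r, 'n) module" +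
  assumes inclusion: "(\<lambda>a. a) \<in> ring_hom A B"
begin

sublocale tensor_product A "ring_via (\<lambda>a. a) B" N
  by (intro tensor_product.intro ring_via_module N.R.is_cring B.is_cring inclusion N.module_axioms)

abbreviation "ext \<equiv> extend_scalars A B N"
abbreviation "pure \<equiv> pure_tensor A (ring_via (\<lambda>a. a) B) N"

lemma A_subset: "a \<in> carrier A \<Longrightarrow> a \<in> carrier B"
  using inclusion by (rule ring_hom_closed)

lemma carrier_ext: "carrier ext = carrier (tensor_group A (ring_via (\<lambda>a. a) B) N)"
  by (simp add: extend_scalars_def Let_def)

lemma add_ext: "x \<oplus>\<^bsub>ext\<^esub> y = x \<otimes>\<^bsub>tensor_group A (ring_via (\<lambda>a. a) B) N\<^esub> y"
  by (simp add: extend_scalars_def Let_def)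

lemma zero_ext: "\<zero>\<^bsub>ext\<^esub> = \<one>\<^bsub>tensor_group A (ring_via (\<lambda>a. a) B) N\<^esub>"
  by (simp add: extend_scalars_def Let_def)

lemma pure_ext [simp]: "\<lbrakk>b \<in> carrier B; n \<in> carrier N\<rbrakk> \<Longrightarrow> pure b n \<in> carrier ext"
  by (simp add: carrier_ext)

lemma pure_ext_add_left:
  "\<lbrakk>b \<in> carrier B; b' \<in> carrier B; n \<in> carrier N\<rbrakk> \<Longrightarrow> pure (b \<oplus>\<^bsub>B\<^esub> b') n = pure b n \<oplus>\<^bsub>ext\<^esub> pure b' n"
  using pure_add_left[of b b' n] by (simp add: add_ext)

lemma pure_ext_add_right:
  "\<lbrakk>b \<in> carrier B; n \<in> carrier N; n' \<in> carrier N\<rbrakk> \<Longrightarrow> pure b (n \<oplus>\<^bsub>N\<^esub> n') = pure b n \<oplus>\<^bsub>ext\<^esub> pure b n'"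
  using pure_add_right[of b n n'] by (simp add: add_ext)

lemma pure_ext_balanced:
  "\<lbrakk>a \<in> carrier A; b \<in> carrier B; n \<in> carrier N\<rbrakk> \<Longrightarrow> pure (a \<otimes>\<^bsub>B\<^esub> b) n = pure b (a \<odot>\<^bsub>N\<^esub> n)"
  using pure_balanced[of a b n] by simp

lemma ext_induct [consumes 1, case_names pure add]:
  assumes "x \<in> carrier ext"
    and "\<And>b n. \<lbrakk>b \<in> carrier B; n \<in> carrier N\<rbrakk> \<Longrightarrow> S (pure b n)"
    and "\<And>x y. \<lbrakk>x \<in> carrier ext; y \<in> carrier ext; S x; S y\<rbrakk> \<Longrightarrow> S (x \<oplus>\<^bsub>ext\<^esub> y)"
  shows "S x"
  using tensor_induct[of x S] assms by (simp add: carrier_ext add_ext)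

text \<open>Multiplication by \<open>b\<close> is linear over \<open>A\<close> because
  \<open>B\<close> is commutative, so it can be tensored with the identity of
  \<open>N\<close>.\<close>

lemma smult_hom:
  assumes b: "b \<in> carrier B"
  shows "(\<odot>\<^bsub>ext\<^esub>) b \<in> hom (tensor_group A (ring_via (\<lambda>a. a) B) N) (tensor_group A (ring_via (\<lambda>a. a)
      B) N)"
    and "\<lbrakk>c \<in> carrier B; n \<in> carrier N\<rbrakk> \<Longrightarrow> b \<odot>\<^bsub>ext\<^esub> pure c n = pure (b \<otimes>\<^bsub>B\<^esub> c) n"
proof -
  have smult: "(\<odot>\<^bsub>ext\<^esub>) b = tensor_map A (ring_via (\<lambda>a. a) B) N (\<lambda>s. b \<otimes>\<^bsub>B\<^esub> s) (\<lambda>n. n)"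
    by (simp add: extend_scalars_def Let_def)
  have "(\<lambda>s. b \<otimes>\<^bsub>B\<^esub> s) \<in> semilinear (\<lambda>a. a) A (ring_via (\<lambda>a. a) B) (ring_via (\<lambda>a. a) B)"
    using b by (intro semilinearI) (simp_all add: B.r_distr B.m_lcomm A_subset)
  moreover have "(\<lambda>n. n) \<in> semilinear (\<lambda>a. a) A N N"
    by (intro semilinearI) simp_all
  moreover have "(\<lambda>a. a) \<in> carrier A \<rightarrow> carrier A" by simp
  ultimately show "(\<odot>\<^bsub>ext\<^esub>) b \<in> hom (tensor_group A (ring_via (\<lambda>a. a) B) N) (tensor_group A
      (ring_via (\<lambda>a. a) B) N)"
    and "\<lbrakk>c \<in> carrier B; n \<in> carrier N\<rbrakk> \<Longrightarrow> b \<odot>\<^bsub>ext\<^esub> pure c n = pure (b \<otimes>\<^bsub>B\<^esub> c) n"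
    unfolding smult
    using tensor_map_hom[OF tensor_product_axioms tensor_product_axioms] by simp_all
qed

lemma smult_ext_closed [simp]: "\<lbrakk>b \<in> carrier B; x \<in> carrier ext\<rbrakk> \<Longrightarrow> b \<odot>\<^bsub>ext\<^esub> x \<in> carrier ext"
  using smult_hom(1)[of b] by (auto simp: carrier_ext hom_def)

lemma smult_ext_add:
  "\<lbrakk>b \<in> carrier B; x \<in> carrier ext; y \<in> carrier ext\<rbrakk>
      \<Longrightarrow> b \<odot>\<^bsub>ext\<^esub> (x \<oplus>\<^bsub>ext\<^esub> y) = b \<odot>\<^bsub>ext\<^esub> x \<oplus>\<^bsub>ext\<^esub> b \<odot>\<^bsub>ext\<^esub> y"
  using smult_hom(1)[of b] by (auto simp: carrier_ext add_ext hom_def)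

lemma abelian_group_ext: "abelian_group ext"
  by (intro abelian_groupI) (simp_all add: carrier_ext add_ext zero_ext tensor.m_ac tensor.l_inv_ex)

sublocale ext: Module.module B ext
proof (intro moduleI)
  interpret E: abelian_group ext by (rule abelian_group_ext)
  show "cring B" by (rule B.is_cring)
  show "abelian_group ext" by (rule abelian_group_ext)
  show "(a \<oplus>\<^bsub>B\<^esub> b) \<odot>\<^bsub>ext\<^esub> x = a \<odot>\<^bsub>ext\<^esub> x \<oplus>\<^bsub>ext\<^esub> b \<odot>\<^bsub>ext\<^esub> x"
    if ab: "a \<in> carrier B" "b \<in> carrier B" and x: "x \<in> carrier ext" for a b x
    using x
  proof (induction rule: ext_induct)
    case (pure c n)
    then show ?case using ab by (simp add: smult_hom(2) B.l_distr pure_ext_add_left)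
  next
    case (add x y)
    then show ?case
      using ab E.a_ac by (simp add: smult_ext_add)
  qed
  show "(a \<otimes>\<^bsub>B\<^esub> b) \<odot>\<^bsub>ext\<^esub> x = a \<odot>\<^bsub>ext\<^esub> (b \<odot>\<^bsub>ext\<^esub> x)"
    if ab: "a \<in> carrier B" "b \<in> carrier B" and x: "x \<in> carrier ext" for a b x
    using x ab by (induction rule: ext_induct) (simp_all add: smult_hom(2) B.m_assoc smult_ext_add)
  show "\<one>\<^bsub>B\<^esub> \<odot>\<^bsub>ext\<^esub> x = x" if "x \<in> carrier ext" for x
    using that by (induction rule: ext_induct) (simp_all add: smult_hom(2) smult_ext_add)
qed (simp_all add: smult_ext_add)

lemma unit_semilinear: "pure \<one>\<^bsub>B\<^esub> \<in> semilinear (\<lambda>a. a) A N ext"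
proof (rule semilinearI)
  fix a n assume "a \<in> carrier A" "n \<in> carrier N"
  then show "pure \<one>\<^bsub>B\<^esub> (a \<odot>\<^bsub>N\<^esub> n) = a \<odot>\<^bsub>ext\<^esub> pure \<one>\<^bsub>B\<^esub> n"
    using pure_ext_balanced[of a "\<one>\<^bsub>B\<^esub>" n] by (simp add: A_subset smult_hom(2))
qed (simp_all add: pure_ext_add_right)

text \<open>Compatibility with scalars comes from \<open>b (c \<otimes> n) = bc \<otimes> n\<close>
  and the multiplicativity of \<open>\<psi>\<close>; additivity of \<open>h\<close> carries it from
  pure tensors to all elements.\<close>

lemma semilinear_extI:
  assumes add: "\<And>x y. \<lbrakk>x \<in> carrier ext; y \<in> carrier ext\<rbrakk> \<Longrightarrow> h (x \<oplus>\<^bsub>ext\<^esub> y) = h x \<oplus>\<^bsub>M\<^esub> h y"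
    and pure: "\<And>b n. \<lbrakk>b \<in> carrier B; n \<in> carrier N\<rbrakk> \<Longrightarrow> h (pure b n) = \<psi> b \<odot>\<^bsub>M\<^esub> g n"
    and g: "\<And>n. n \<in> carrier N \<Longrightarrow> g n \<in> carrier M"
    and \<psi>: "\<psi> \<in> ring_hom B B'" and M: "Module.module B' M"
  shows "h \<in> semilinear \<psi> B ext M"
proof -
  interpret M: Module.module B' M by (rule M)
  have \<psi>_closed: "\<psi> b \<in> carrier B'" if "b \<in> carrier B" for b
    using \<psi> that by (rule ring_hom_closed)
  have closed: "h x \<in> carrier M" if "x \<in> carrier ext" for x
    using that by (induction rule: ext_induct) (simp_all add: add pure g \<psi>_closed)
  show ?thesis
  proof (rule semilinearI)
    fix b x assume b: "b \<in> carrier B" and x: "x \<in> carrier ext"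
    from x show "h (b \<odot>\<^bsub>ext\<^esub> x) = \<psi> b \<odot>\<^bsub>M\<^esub> h x"
      by (induction rule: ext_induct)
         (simp_all add: b pure g \<psi>_closed smult_hom(2) ring_hom_mult[OF \<psi>] M.smult_assoc1
           smult_ext_add add closed M.smult_r_distr)
  qed (simp_all add: closed add)
qed

text \<open>Since \<open>b \<otimes> n = b (1 \<otimes> n)\<close>, the elements
  \<open>1 \<otimes> n\<close> generate the extension over \<open>B\<close>. This is the uniqueness
  half of the adjunction.\<close>

lemma semilinear_ext_eqI:
  assumes h: "h \<in> semilinear \<psi> B ext M" and h': "h' \<in> semilinear \<psi> B ext M"
    and eq: "\<And>n. n \<in> carrier N \<Longrightarrow> h (pure \<one>\<^bsub>B\<^esub> n) = h' (pure \<one>\<^bsub>B\<^esub> n)"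
    and x: "x \<in> carrier ext"
  shows "h x = h' x"
  using x
proof (induction rule: ext_induct)
  case (pure b n)
  then show ?case
    using semilinear_smult[OF h, of b "pure \<one>\<^bsub>B\<^esub> n"] semilinear_smult[OF h', of b "pure \<one>\<^bsub>B\<^esub> n"]
    by (simp add: eq smult_hom(2))
next
  case (add x y)
  then show ?case
    by (simp add: semilinear_add[OF h] semilinear_add[OF h'])
qed

text \<open>The existence half of the adjunction at one object. It is applied with the whole module
  of an equivariant diagram as target: the invariants, where \<open>g\<close> then takes its values,
  need not be stable under \<open>B\<close>.\<close>

lemma ext_universal:
  assumes M: "Module.module B M" and g: "g \<in> semilinear (\<lambda>a. a) A N M"
  obtains h where "h \<in> semilinear (\<lambda>a. a) B ext M"
    and "\<And>b n. \<lbrakk>b \<in> carrier B; n \<in> carrier N\<rbrakk> \<Longrightarrow> h (pure b n) = b \<odot>\<^bsub>M\<^esub> g n"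
proof -
  interpret M: Module.module B M by (rule M)
  have "\<exists>h. h \<in> hom (tensor_group A (ring_via (\<lambda>a. a) B) N) (add_monoid M) \<and>
      (\<forall>b\<in>carrier B. \<forall>n\<in>carrier N. h (pure b n) = b \<odot>\<^bsub>M\<^esub> g n)"
  proof (rule tensor_universal[OF M.abelian_group_axioms, of "\<lambda>b n. b \<odot>\<^bsub>M\<^esub> g n"])
    fix a b n assume "a \<in> carrier A" "b \<in> carrier (ring_via (\<lambda>a. a) B)" "n \<in> carrier N"
    then show "(a \<odot>\<^bsub>ring_via (\<lambda>a. a) B\<^esub> b) \<odot>\<^bsub>M\<^esub> g n = b \<odot>\<^bsub>M\<^esub> g (a \<odot>\<^bsub>N\<^esub> n)"
      using M.smult_assoc1[of b a "g n"]
      by (simp add: A_subset semilinear_smult[OF g] semilinear_closed[OF g] B.m_comm)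
  qed (auto simp: semilinear_closed[OF g] semilinear_add[OF g] M.smult_l_distr M.smult_r_distr)
  then obtain h where h: "h \<in> hom (tensor_group A (ring_via (\<lambda>a. a) B) N) (add_monoid M)"
    and pure: "\<And>b n. \<lbrakk>b \<in> carrier B; n \<in> carrier N\<rbrakk> \<Longrightarrow> h (pure b n) = b \<odot>\<^bsub>M\<^esub> g n"
    by blast
  have "h \<in> semilinear (\<lambda>a. a) B ext M"
  proof (rule semilinear_extI[where g = g, OF _ _ _ _ M])
    show "h (x \<oplus>\<^bsub>ext\<^esub> y) = h x \<oplus>\<^bsub>M\<^esub> h y" if "x \<in> carrier ext" "y \<in> carrier ext" for x y
      using hom_mult[OF h, of x y] that by (simp add: carrier_ext add_ext)
    show "(\<lambda>a. a) \<in> ring_hom B B" by (intro ring_hom_memI) simp_all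
  qed (simp_all add: pure semilinear_closed[OF g])
  with pure show thesis by (rule that[rotated]) 
qed

lemma pure_finsum:
  assumes "finite H" "\<And>h. h \<in> H \<Longrightarrow> b h \<in> carrier B" "n \<in> carrier N"
  shows "pure (finsum B b H) n = finsum ext (\<lambda>h. pure (b h) n) H"
  using assms
proof (induction H rule: finite_induct)
  case empty
  have "pure \<zero>\<^bsub>B\<^esub> n \<oplus>\<^bsub>ext\<^esub> pure \<zero>\<^bsub>B\<^esub> n = pure \<zero>\<^bsub>B\<^esub> n"
    using empty pure_ext_add_left[of "\<zero>\<^bsub>B\<^esub>" "\<zero>\<^bsub>B\<^esub>" n] by simp
  then show ?case
    using empty by simp
next
  case (insert h H)
  then have "finsum B b H \<in> carrier B" by (intro B.finsum_closed) auto
  with insert show ?case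
    by (simp add: B.finsum_insert ext.finsum_insert Pi_def pure_ext_add_left)
qed

lemma natural_smult: "x \<in> carrier ext \<Longrightarrow> ([k] \<cdot>\<^bsub>B\<^esub> \<one>\<^bsub>B\<^esub>) \<odot>\<^bsub>ext\<^esub> x = [k] \<cdot>\<^bsub>ext\<^esub> x" for k :: nat
  by (induction k) (simp_all add: ext.smult_l_distr)

text \<open>The inverse is \<open>b \<otimes> n \<mapsto> c tr(b) n\<close> with \<open>tr\<close> the trace over \<open>H\<close> and \<open>c = 1/|H|\<close>: followed by
  the unit it is the average over \<open>H\<close>, which is the identity on invariants.\<close>

lemma unit_bij_invariants:
  fixes H :: "'h set"
  assumes H: "finite H"
    and s: "\<And>h. h \<in> H \<Longrightarrow> s h \<in> ring_hom B B"
    and A: "carrier A = {b \<in> carrier B. \<forall>h\<in>H. s h b = b}"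
    and mult: "\<And>h k b. \<lbrakk>h \<in> H; k \<in> H; b \<in> carrier B\<rbrakk> \<Longrightarrow> s k (s h b) = s (m h k) b"
    and trans: "\<And>k. k \<in> H \<Longrightarrow> bij_betw (\<lambda>h. m h k) H H"
    and c: "c \<in> carrier B" "c \<otimes>\<^bsub>B\<^esub> [card H] \<cdot>\<^bsub>B\<^esub> \<one>\<^bsub>B\<^esub> = \<one>\<^bsub>B\<^esub>"
    and S_add: "\<And>h x y. \<lbrakk>h \<in> H; x \<in> carrier ext; y \<in> carrier ext\<rbrakk>
        \<Longrightarrow> S h (x \<oplus>\<^bsub>ext\<^esub> y) = S h x \<oplus>\<^bsub>ext\<^esub> S h y"
    and S_pure: "\<And>h b n. \<lbrakk>h \<in> H; b \<in> carrier B; n \<in> carrier N\<rbrakk> \<Longrightarrow> S h (pure b n) = pure (s h b) n"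
  shows "bij_betw (pure \<one>\<^bsub>B\<^esub>) (carrier N) {x \<in> carrier ext. \<forall>h\<in>H. S h x = x}"
proof -
  have s_closed: "s h b \<in> carrier B" if "h \<in> H" "b \<in> carrier B" for h b
    using ring_hom_closed[OF s[OF that(1)] that(2)] .
  have S_closed: "S h x \<in> carrier ext" if "h \<in> H" "x \<in> carrier ext" for h x
    using that(2) by (induction rule: ext_induct) (simp_all add: that(1) S_pure S_add s_closed)
  define tr where "tr b = finsum B (\<lambda>h. s h b) H" for b
  have tr_closed: "tr b \<in> carrier B" if "b \<in> carrier B" for b
    unfolding tr_def using that by (intro B.finsum_closed) (simp add: s_closed)
  \<comment> \<open>Applying \<open>s k\<close> turns the summand at \<open>h\<close> into the one
    at \<open>m h k\<close>, and right translation by \<open>k\<close> permutes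
    \<open>H\<close>.\<close>
  have tr_fixed: "s k (tr b) = tr b" if k: "k \<in> H" and b: "b \<in> carrier B" for k b
  proof -
    interpret h: ring_hom_cring B B "s k"
      using s[OF k] by unfold_locales
    have "s k (tr b) = finsum B (\<lambda>h. s k (s h b)) H"
      unfolding tr_def using h.hom_finsum[of "\<lambda>h. s h b" H] b by (simp add: s_closed o_def)
    also have "\<dots> = finsum B (\<lambda>h. s (m h k) b) H"
      using b k by (intro B.finsum_cong') (auto simp: mult[symmetric] s_closed)
    also have "\<dots> = finsum B (\<lambda>h. s h b) ((\<lambda>h. m h k) ` H)"
      using trans[OF k] b by (intro B.finsum_reindex[symmetric]) (auto simp: bij_betw_def s_closed)
    finally show ?thesis
      using trans[OF k] by (simp add: tr_def bij_betw_def)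
  qed
  \<comment> \<open>\<open>c\<close> inverts an integer multiple of \<open>\<one>\<close>, which
    every ring homomorphism \<open>s k\<close> fixes; so \<open>s k c\<close> is an inverse of the
    same element, and inverses are unique.\<close>
  have c_fixed: "s k c = c" if k: "k \<in> H" for k
  proof -
    interpret h: ring_hom_cring B B "s k"
      using s[OF k] by unfold_locales
    have "s k ([i] \<cdot>\<^bsub>B\<^esub> \<one>\<^bsub>B\<^esub>) = [i] \<cdot>\<^bsub>B\<^esub> \<one>\<^bsub>B\<^esub>" for i :: nat
      by (induction i) simp_all
    then have "s k c \<otimes>\<^bsub>B\<^esub> [card H] \<cdot>\<^bsub>B\<^esub> \<one>\<^bsub>B\<^esub> = \<one>\<^bsub>B\<^esub>"
      using h.hom_mult[of c "[card H] \<cdot>\<^bsub>B\<^esub> \<one>\<^bsub>B\<^esub>"] c by simp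
    then show ?thesis
      using c B.inv_unique[of "s k c" "[card H] \<cdot>\<^bsub>B\<^esub> \<one>\<^bsub>B\<^esub>" c] B.m_comm by (simp add: s_closed k)
  qed
  define P where "P b = c \<otimes>\<^bsub>B\<^esub> tr b" for b
  have P_A: "P b \<in> carrier A" if "b \<in> carrier B" for b
    using that c unfolding P_def A by (simp add: tr_closed ring_hom_mult[OF s] c_fixed tr_fixed)
  have P_add: "P (b \<oplus>\<^bsub>B\<^esub> b') = P b \<oplus>\<^bsub>A\<^esub> P b'" if b: "b \<in> carrier B" "b' \<in> carrier B" for b b'
  proof -
    have "tr (b \<oplus>\<^bsub>B\<^esub> b') = finsum B (\<lambda>h. s h b \<oplus>\<^bsub>B\<^esub> s h b') H"
      unfolding tr_def using b by (intro B.finsum_cong') (auto simp: s_closed ring_hom_add[OF s])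
    then have "tr (b \<oplus>\<^bsub>B\<^esub> b') = tr b \<oplus>\<^bsub>B\<^esub> tr b'"
      using b by (simp add: tr_def B.finsum_addf s_closed)
    then show ?thesis
      using ring_hom_add[OF inclusion P_A[OF b(1)] P_A[OF b(2)]] b c
          by (simp add: P_def B.r_distr tr_closed)
  qed
  \<comment> \<open>The scalar is put on the right so that \<open>N.smult_assoc1\<close> turns the
    action of this product on \<open>n\<close> into \<open>P b\<close> acting on \<open>a n\<close>,
    which is the balancing condition for \<open>g\<close> below.\<close>
  have P_smult: "P (a \<otimes>\<^bsub>B\<^esub> b) = P b \<otimes>\<^bsub>A\<^esub> a" if a: "a \<in> carrier A" and b: "b \<in> carrier B" for a b
  proof -
    have aB: "a \<in> carrier B" "\<And>h. h \<in> H \<Longrightarrow> s h a = a" using a by (simp_all add: A)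
    have "tr (a \<otimes>\<^bsub>B\<^esub> b) = finsum B (\<lambda>h. a \<otimes>\<^bsub>B\<^esub> s h b) H"
      unfolding tr_def using aB b by (intro B.finsum_cong') (auto simp: s_closed ring_hom_mult[OF s])
    then have "tr (a \<otimes>\<^bsub>B\<^esub> b) = a \<otimes>\<^bsub>B\<^esub> tr b"
      using aB(1) b H B.finsum_rdistr[of H a "\<lambda>h. s h b"] by (simp add: tr_def s_closed)
    then show ?thesis
      using ring_hom_mult[OF inclusion P_A[OF b] a] aB(1) b c by (simp add: P_def B.m_ac tr_closed)
  qed
  have "tr \<one>\<^bsub>B\<^esub> = finsum B (\<lambda>h. \<one>\<^bsub>B\<^esub>) H"
    unfolding tr_def by (intro B.finsum_cong') (auto simp: ring_hom_one[OF s])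
  then have P_one: "P \<one>\<^bsub>B\<^esub> = \<one>\<^bsub>A\<^esub>"
    using c ring_hom_one[OF inclusion] by (simp add: P_def B.add.finprod_const)
  obtain g where g: "g \<in> hom (tensor_group A (ring_via (\<lambda>a. a) B) N) (add_monoid N)"
    and g_pure: "\<And>b n. \<lbrakk>b \<in> carrier B; n \<in> carrier N\<rbrakk> \<Longrightarrow> g (pure b n) = P b \<odot>\<^bsub>N\<^esub> n"
  proof (rule tensor_universal[OF N.abelian_group_axioms, of "\<lambda>b n. P b \<odot>\<^bsub>N\<^esub> n"])
    fix a b n assume "a \<in> carrier A" "b \<in> carrier (ring_via (\<lambda>a. a) B)" "n \<in> carrier N"
    then show "P (a \<odot>\<^bsub>ring_via (\<lambda>a. a) B\<^esub> b) \<odot>\<^bsub>N\<^esub> n = P b \<odot>\<^bsub>N\<^esub> (a \<odot>\<^bsub>N\<^esub> n)"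
      by (simp add: P_smult P_A N.smult_assoc1)
  qed (auto simp: P_A P_add N.smult_l_distr N.smult_r_distr)
  have g_closed: "g x \<in> carrier N" if "x \<in> carrier ext" for x
    using g that by (auto simp: hom_def carrier_ext)
  have g_add: "g (x \<oplus>\<^bsub>ext\<^esub> y) = g x \<oplus>\<^bsub>N\<^esub> g y" if "x \<in> carrier ext" "y \<in> carrier ext" for x y
    using hom_mult[OF g] that by (simp add: carrier_ext add_ext)
  \<comment> \<open>Stated for all elements of the extension, the formula is additive in
    \<open>x\<close> and can be proved on pure tensors. Restricted to invariants it could not: an
    invariant is not visibly a sum of invariant pure tensors.\<close>
  have average: "pure \<one>\<^bsub>B\<^esub> (g x) = c \<odot>\<^bsub>ext\<^esub> finsum ext (\<lambda>h. S h x) H" if "x \<in> carrier ext" for x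
    using that
  proof (induction rule: ext_induct)
    case (pure b n)
    have "finsum ext (\<lambda>h. S h (pure b n)) H = finsum ext (\<lambda>h. pure (s h b) n) H"
      using pure by (intro ext.finsum_cong') (auto simp: S_pure s_closed)
    also have "\<dots> = pure (tr b) n"
      using pure H by (simp add: tr_def pure_finsum s_closed)
    finally have "c \<odot>\<^bsub>ext\<^esub> finsum ext (\<lambda>h. S h (pure b n)) H = pure (P b) n"
      using pure c by (simp add: smult_hom(2) P_def tr_closed)
    \<comment> \<open>\<open>P b\<close> lies in \<open>A\<close> and therefore crosses the tensor
      sign.\<close>
    also have "\<dots> = pure \<one>\<^bsub>B\<^esub> (P b \<odot>\<^bsub>N\<^esub> n)"
      using pure_ext_balanced[OF P_A[OF pure(1)] B.one_closed pure(2)] A_subset[OF P_A[OF pure(1)]]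
          by simp
    finally show ?case
      using pure by (simp add: g_pure)
  next
    case (add x y)
    have "finsum ext (\<lambda>h. S h (x \<oplus>\<^bsub>ext\<^esub> y)) H = finsum ext (\<lambda>h. S h x \<oplus>\<^bsub>ext\<^esub> S h y) H"
      using add by (intro ext.finsum_cong') (auto simp: S_add S_closed)
    also have "\<dots> = finsum ext (\<lambda>h. S h x) H \<oplus>\<^bsub>ext\<^esub> finsum ext (\<lambda>h. S h y) H"
      using add by (intro ext.finsum_addf) (auto simp: S_closed)
    finally show ?case
      using add c by (simp add: g_add g_closed pure_ext_add_right smult_ext_add S_closed)
  qed
  show ?thesis
  proof (rule bij_betwI[where g = g])
    show "pure \<one>\<^bsub>B\<^esub> \<in> carrier N \<rightarrow> {x \<in> carrier ext. \<forall>h\<in>H. S h x = x}"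
      by (auto simp: S_pure ring_hom_one[OF s])
    show "g \<in> {x \<in> carrier ext. \<forall>h\<in>H. S h x = x} \<rightarrow> carrier N"
      by (auto simp: g_closed)
    show "g (pure \<one>\<^bsub>B\<^esub> n) = n" if "n \<in> carrier N" for n
      using that by (simp add: g_pure P_one)
    fix x assume "x \<in> {x \<in> carrier ext. \<forall>h\<in>H. S h x = x}"
    then have x: "x \<in> carrier ext" "\<And>h. h \<in> H \<Longrightarrow> S h x = x" by auto
    have "finsum ext (\<lambda>h. S h x) H = finsum ext (\<lambda>h. x) H"
      using x by (intro ext.finsum_cong') auto
    also have "\<dots> = ([card H] \<cdot>\<^bsub>B\<^esub> \<one>\<^bsub>B\<^esub>) \<odot>\<^bsub>ext\<^esub> x"
      using x by (simp add: ext.add.finprod_const natural_smult)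
    finally show "pure \<one>\<^bsub>B\<^esub> (g x) = x"
      using average[OF x(1)] x(1) c by (simp add: ext.smult_assoc1[symmetric])
  qed
qed

end

text \<open>If \<open>d\<close> inverts the integer \<open>k l\<close>, then \<open>d k\<close>
  inverts \<open>l\<close>. This passes from the order of \<open>W\<close> to the orders of its
  subgroups.\<close>

lemma (in cring) nat_divisor_unit:
  assumes "[(k * l :: nat)] \<cdot> \<one> \<in> Units R"
  obtains c where "c \<in> carrier R" and "c \<otimes> [l] \<cdot> \<one> = \<one>"
proof -
  obtain d where d: "d \<in> carrier R" "d \<otimes> [(k * l)] \<cdot> \<one> = \<one>"
    using Units_l_inv_ex[OF assms] by blast
  have "[(k * l)] \<cdot> \<one> = [k] \<cdot> \<one> \<otimes> [l] \<cdot> \<one>"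
    using add_pow_ldistr[of "\<one>" "[l] \<cdot> \<one>" k] add.nat_pow_pow[of "\<one>" k l] by (simp add: mult.commute)
  then have "(d \<otimes> [k] \<cdot> \<one>) \<otimes> [l] \<cdot> \<one> = \<one>"
    using d by (simp add: m_assoc)
  with d(1) show thesis
    by (intro that[of "d \<otimes> [k] \<cdot> \<one>"]) simp_all
qed

section \<open>Fixed points\<close>

lemma family_eqI:
  assumes "f \<in> (\<Pi>\<^sub>E E\<in>pts T. extensional (S E))" "g \<in> (\<Pi>\<^sub>E E\<in>pts T. extensional (S E))"
    and "\<And>E x. \<lbrakk>E \<in> pts T; x \<in> S E\<rbrakk> \<Longrightarrow> f E x = g E x"
  shows "f = g"
  using assms by (intro PiE_ext[where k = "pts T"] extensionalityI[of _ "S _"]) auto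

lemma family_comp_apply:
  "\<lbrakk>E \<in> pts T; x \<in> S E\<rbrakk> \<Longrightarrow> family_comp T S g f E x = g E (f E x)"
  by (simp add: family_comp_def compose_def)

lemma family_comp_extensional: "family_comp T S g f \<in> (\<Pi>\<^sub>E E\<in>pts T. extensional (S E))"
  by (auto simp: family_comp_def compose_def)

lemma family_id_apply: "\<lbrakk>E \<in> pts T; x \<in> S E\<rbrakk> \<Longrightarrow> family_id T S E x = x"
  by (simp add: family_id_def)

lemma family_id_extensional: "family_id T S \<in> (\<Pi>\<^sub>E E\<in>pts T. extensional (S E))"
  by (auto simp: family_id_def)

lemma equivariant_homI:
  assumes "f \<in> (\<Pi>\<^sub>E E\<in>pts T. extensional (carrier (ob M E)))"
    and "\<And>E. E \<in> pts T \<Longrightarrow> f E \<in> semilinear (\<lambda>a. a) (ob R E) (ob M E) (ob M' E)"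
    and "\<And>F E x. \<lbrakk>(F, E) \<in> leq T; x \<in> carrier (ob M F)\<rbrakk> \<Longrightarrow> f E (smap M F E x) = smap M' F E (f F x)"
    and "\<And>E w x. \<lbrakk>E \<in> pts T; w \<in> carrier (grp T); x \<in> carrier (ob M E)\<rbrakk>
      \<Longrightarrow> f (act T E w) (wmap M w E x) = wmap M' w E (f E x)"
  shows "f \<in> equivariant_hom T R M M'"
  using assms by (auto simp: equivariant_hom_def PiE_iff dest: semilinear_closed)

lemma equivariant_homD:
  assumes "f \<in> equivariant_hom T R M M'"
  shows "f \<in> (\<Pi>\<^sub>E E\<in>pts T. extensional (carrier (ob M E)))"
    and "E \<in> pts T \<Longrightarrow> f E \<in> semilinear (\<lambda>a. a) (ob R E) (ob M E) (ob M' E)"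
    and "\<lbrakk>E \<in> pts T; x \<in> carrier (ob M E)\<rbrakk> \<Longrightarrow> f E x \<in> carrier (ob M' E)"
    and "\<lbrakk>(F, E) \<in> leq T; x \<in> carrier (ob M F)\<rbrakk> \<Longrightarrow> f E (smap M F E x) = smap M' F E (f F x)"
    and "\<lbrakk>E \<in> pts T; w \<in> carrier (grp T); x \<in> carrier (ob M E)\<rbrakk>
      \<Longrightarrow> f (act T E w) (wmap M w E x) = wmap M' w E (f E x)"
  using assms by (auto simp: equivariant_hom_def PiE_iff)

lemma residual_homI:
  assumes "f \<in> (\<Pi>\<^sub>E E\<in>pts T. extensional (carrier (dob N E)))"
    and "\<And>E. E \<in> pts T \<Longrightarrow> f E \<in> semilinear (\<lambda>a. a) (dob A E) (dob N E) (dob N' E)"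
    and "\<And>\<sigma> \<tau> v x. \<lbrakk>(\<sigma>, \<tau>) \<in> leq T; v \<in> carrier (grp T); x \<in> carrier (dob N \<sigma>)\<rbrakk>
      \<Longrightarrow> f (act T \<tau> v) (dmap N \<sigma> \<tau> (dclass T C \<tau> v) x) = dmap N' \<sigma> \<tau> (dclass T C \<tau> v) (f \<sigma> x)"
  shows "f \<in> residual_hom T C A N N'"
  using assms by (auto simp: residual_hom_def PiE_iff dest: semilinear_closed)

lemma residual_homD:
  assumes "f \<in> residual_hom T C A N N'"
  shows "f \<in> (\<Pi>\<^sub>E E\<in>pts T. extensional (carrier (dob N E)))"
    and "E \<in> pts T \<Longrightarrow> f E \<in> semilinear (\<lambda>a. a) (dob A E) (dob N E) (dob N' E)"
    and "\<lbrakk>E \<in> pts T; x \<in> carrier (dob N E)\<rbrakk> \<Longrightarrow> f E x \<in> carrier (dob N' E)"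
    and "\<lbrakk>(\<sigma>, \<tau>) \<in> leq T; v \<in> carrier (grp T); x \<in> carrier (dob N \<sigma>)\<rbrakk>
      \<Longrightarrow> f (act T \<tau> v) (dmap N \<sigma> \<tau> (dclass T C \<tau> v) x) = dmap N' \<sigma> \<tau> (dclass T C \<tau> v) (f \<sigma> x)"
  using assms by (auto simp: residual_hom_def PiE_iff)

section \<open>The groups \<open>W_E^e\<close> and the classes of the discrete residual\<close>

locale component_action = poset_action T for T :: "('s, 'w) poset_action" +
  fixes C :: "('s \<times> 's \<times> 'w) set"
  assumes decreasing: "decreasing_structure T C"
    and normal: "normal_structure T C"
    and conjugation: "conjugation_invariant T C"
begin

lemma leq_pts: "(F, E) \<in> leq T \<Longrightarrow> F \<in> pts T" "(F, E) \<in> leq T \<Longrightarrow> E \<in> pts T"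
  using partial_order_onD(4)[OF poset] by auto

lemma leq_refl: "E \<in> pts T \<Longrightarrow> (E, E) \<in> leq T"
  using partial_order_onD(1)[OF poset] by (rule refl_onD)

lemma leq_trans: "\<lbrakk>(F, E) \<in> leq T; (E, G) \<in> leq T\<rbrakk> \<Longrightarrow> (F, G) \<in> leq T"
  using partial_order_onD(2)[OF poset] by (rule transD)

lemma act_inv: "\<lbrakk>E \<in> pts T; v \<in> carrier (grp T)\<rbrakk> \<Longrightarrow> act T (act T E (inv\<^bsub>grp T\<^esub> v)) v = E"
  using act_mult[of E "inv\<^bsub>grp T\<^esub> v" v] act_one by simp

lemma act_inv': "\<lbrakk>E \<in> pts T; v \<in> carrier (grp T)\<rbrakk> \<Longrightarrow> act T (act T E v) (inv\<^bsub>grp T\<^esub> v) = E"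
  using act_mult[of E v "inv\<^bsub>grp T\<^esub> v"] act_one by simp

lemma cgroup_carrier: "w \<in> cgroup T C E \<Longrightarrow> w \<in> carrier (grp T)"
  by (simp add: cgroup_def stab_def)

lemma cgroup_act: "w \<in> cgroup T C E \<Longrightarrow> act T E w = E"
  by (simp add: cgroup_def stab_def)

lemma cgroup_antimono: "\<lbrakk>(F, E) \<in> leq T; w \<in> cgroup T C E\<rbrakk> \<Longrightarrow> w \<in> cgroup T C F"
  using decreasing by (auto simp: decreasing_structure_def)

lemma stab_subgroup:
  assumes E: "E \<in> pts T"
  shows "subgroup (stab T E) (grp T)"
proof (rule W.subgroupI)
  fix a b assume "a \<in> stab T E" "b \<in> stab T E"
  then show "inv\<^bsub>grp T\<^esub> a \<in> stab T E" "a \<otimes>\<^bsub>grp T\<^esub> b \<in> stab T E"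
    using act_mult[OF E, of a b] act_inv'[OF E, of a] by (simp_all add: stab_def)
qed (use E act_one in \<open>auto simp: stab_def\<close>)

lemma cgroup_subgroup:
  assumes E: "E \<in> pts T"
  shows "subgroup (cgroup T C E) (grp T)"
  using normal E W.incl_subgroup[OF stab_subgroup[OF E]]
  by (simp add: normal_structure_def normal_imp_subgroup)

text \<open>Conjugation invariance in the form in which it is used: an element of the group of
  \<open>E^w\<close> standing to the right of \<open>w\<close> is traded for one of
  \<open>W_E^e\<close> standing to its left.\<close>

lemma conjugate_cgroup:
  assumes E: "E \<in> pts T" and w: "w \<in> carrier (grp T)" and u: "u \<in> cgroup T C (act T E w)"
  obtains a where "a \<in> cgroup T C E" and "w \<otimes>\<^bsub>grp T\<^esub> u = a \<otimes>\<^bsub>grp T\<^esub> w"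
proof -
  obtain a where a: "a \<in> cgroup T C E" "u = inv\<^bsub>grp T\<^esub> w \<otimes>\<^bsub>grp T\<^esub> a \<otimes>\<^bsub>grp T\<^esub> w"
    using conjugation E w u unfolding conjugation_invariant_def by blast
  then have "w \<otimes>\<^bsub>grp T\<^esub> u = a \<otimes>\<^bsub>grp T\<^esub> w"
    using w cgroup_carrier[OF a(1)] by (simp add: W.m_assoc[symmetric])
  with a(1) show thesis by (rule that)
qed

lemma one_cgroup: "E \<in> pts T \<Longrightarrow> \<one>\<^bsub>grp T\<^esub> \<in> cgroup T C E"
  using cgroup_subgroup by (rule subgroup.one_closed)

lemma mem_dclass:
  assumes E: "E \<in> pts T" and v: "v \<in> carrier (grp T)"
  shows "v \<in> dclass T C E v"
proof -
  have "v = \<one>\<^bsub>grp T\<^esub> \<otimes>\<^bsub>grp T\<^esub> v \<otimes>\<^bsub>grp T\<^esub> \<one>\<^bsub>grp T\<^esub>" using v by simp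
  then show ?thesis
    unfolding dclass_def using one_cgroup[OF E] one_cgroup[OF act_closed[OF E v]] by blast
qed

text \<open>After moving the right-hand factor across \<open>v\<close>, the double coset is the
  one-sided coset \<open>W_E^e v\<close>. As composition reads from left to right, the factor
  \<open>a\<close> acts before \<open>v\<close>.\<close>

lemma dclassE:
  assumes E: "E \<in> pts T" and v: "v \<in> carrier (grp T)" and x: "x \<in> dclass T C E v"
  obtains a where "a \<in> cgroup T C E" and "x = a \<otimes>\<^bsub>grp T\<^esub> v"
proof -
  obtain a b where ab: "a \<in> cgroup T C E" "b \<in> cgroup T C (act T E v)"
    "x = a \<otimes>\<^bsub>grp T\<^esub> v \<otimes>\<^bsub>grp T\<^esub> b"
    using x unfolding dclass_def by blast
  obtain c where c: "c \<in> cgroup T C E" "v \<otimes>\<^bsub>grp T\<^esub> b = c \<otimes>\<^bsub>grp T\<^esub> v"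
    using conjugate_cgroup[OF E v ab(2)] .
  have "x = (a \<otimes>\<^bsub>grp T\<^esub> c) \<otimes>\<^bsub>grp T\<^esub> v"
    using ab c v by (simp add: W.m_assoc cgroup_carrier)
  then show thesis
    using that subgroup.m_closed[OF cgroup_subgroup[OF E] ab(1) c(1)] by blast
qed

text \<open>For \<open>v\<close> in \<open>W_E^e\<close> one has \<open>E^v = E\<close>, and the
  double coset is the group itself. Hence a module on the residual sees every element of
  \<open>W_E^e\<close> as an identity.\<close>

lemma dclass_cgroup:
  assumes E: "E \<in> pts T" and w: "w \<in> cgroup T C E"
  shows "dclass T C E w = dclass T C E \<one>\<^bsub>grp T\<^esub>"
proof -
  interpret H: subgroup "cgroup T C E" "grp T" by (rule cgroup_subgroup[OF E])
  have "dclass T C E v = cgroup T C E" if v: "v \<in> cgroup T C E" for v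
  proof
    show "dclass T C E v \<subseteq> cgroup T C E"
      using v by (auto simp: dclass_def cgroup_act)
    show "cgroup T C E \<subseteq> dclass T C E v"
    proof
      fix x assume x: "x \<in> cgroup T C E"
      then have "x = (x \<otimes>\<^bsub>grp T\<^esub> inv\<^bsub>grp T\<^esub> v) \<otimes>\<^bsub>grp T\<^esub> v \<otimes>\<^bsub>grp T\<^esub> \<one>\<^bsub>grp T\<^esub>"
        using v by (simp add: W.m_assoc)
      moreover have "x \<otimes>\<^bsub>grp T\<^esub> inv\<^bsub>grp T\<^esub> v \<in> cgroup T C E" "\<one>\<^bsub>grp T\<^esub> \<in> cgroup T C (act T E v)"
        using x v by (simp_all add: cgroup_act)
      ultimately show "x \<in> dclass T C E v"
        unfolding dclass_def by blast
    qed
  qed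
  then show ?thesis using w H.one_closed by simp
qed

end

text \<open>The laws of \<open>equivariant_diagram\<close> do not say where the maps land; with that
  added, rings and modules are treated alike, and one argument yields both \<open>R_inv\<close> and
  \<open>\<Psi> M\<close> as diagrams on the residual.\<close>

locale closed_diagram = component_action T C + equivariant_diagram T D
  for T :: "('s, 'w) poset_action" and C
    and D :: "('s, 'w, ('x, 'z) partial_object_scheme, 'x) diagram" +
  assumes smap_closed: "\<lbrakk>(F, E) \<in> leq T; x \<in> carrier (ob D F)\<rbrakk> \<Longrightarrow> smap D F E x \<in> carrier (ob D E)"
    and wmap_closed: "\<lbrakk>E \<in> pts T; w \<in> carrier (grp T); x \<in> carrier (ob D E)\<rbrakk>
      \<Longrightarrow> wmap D w E x \<in> carrier (ob D (act T E w))"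
begin

lemma fixed_pointsD:
  assumes "x \<in> fixed_points T C D E"
  shows "x \<in> carrier (ob D E)" and "w \<in> cgroup T C E \<Longrightarrow> wmap D w E x = x"
  using assms by (auto simp: fixed_points_def)

lemma smap_fixed:
  assumes FE: "(F, E) \<in> leq T" and x: "x \<in> fixed_points T C D F"
  shows "smap D F E x \<in> fixed_points T C D E"
  unfolding fixed_points_def
proof (intro CollectI conjI ballI)
  show "smap D F E x \<in> carrier (ob D E)"
    using FE fixed_pointsD(1)[OF x] by (rule smap_closed)
  fix w assume w: "w \<in> cgroup T C E"
  then have w': "w \<in> cgroup T C F" by (rule cgroup_antimono[OF FE])
  then show "wmap D w E (smap D F E x) = smap D F E x"
    using wmap_smap[OF FE cgroup_carrier[OF w] fixed_pointsD(1)[OF x]] fixed_pointsD(2)[OF x w'] w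
    by (simp add: cgroup_act)
qed

text \<open>Applying \<open>u\<close> after \<open>v\<close> is applying \<open>v u = a v\<close>,
  and \<open>a\<close> in \<open>W_E^e\<close> fixes \<open>x\<close>.\<close>

lemma wmap_fixed:
  assumes E: "E \<in> pts T" and v: "v \<in> carrier (grp T)" and x: "x \<in> fixed_points T C D E"
  shows "wmap D v E x \<in> fixed_points T C D (act T E v)"
  unfolding fixed_points_def
proof (intro CollectI conjI ballI)
  show "wmap D v E x \<in> carrier (ob D (act T E v))"
    using E v fixed_pointsD(1)[OF x] by (rule wmap_closed)
  fix u assume u: "u \<in> cgroup T C (act T E v)"
  obtain a where a: "a \<in> cgroup T C E" "v \<otimes>\<^bsub>grp T\<^esub> u = a \<otimes>\<^bsub>grp T\<^esub> v"
    using conjugate_cgroup[OF E v u] .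
  show "wmap D u (act T E v) (wmap D v E x) = wmap D v E x"
    using wmap_mult[OF E v cgroup_carrier[OF u] fixed_pointsD(1)[OF x]]
      wmap_mult[OF E cgroup_carrier[OF a(1)] v fixed_pointsD(1)[OF x]] a
    by (simp add: cgroup_act fixed_pointsD(2)[OF x])
qed

text \<open>The representative picked by \<open>SOME\<close> has the form \<open>a v\<close> with
  \<open>a\<close> in \<open>W_\<tau>^e\<close>. The element \<open>smap D \<sigma> \<tau> x\<close>
  is already invariant under \<open>W_\<tau>^e\<close>, so \<open>a\<close> disappears. From here on
  the structure maps on invariants are computed with any chosen \<open>v\<close>.\<close>

lemma dmap_fixed:
  assumes st: "(\<sigma>, \<tau>) \<in> leq T" and v: "v \<in> carrier (grp T)" and x: "x \<in> fixed_points T C D \<sigma>"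
  shows "dmap (fixed_diagram T C D) \<sigma> \<tau> (dclass T C \<tau> v) x = wmap D v \<tau> (smap D \<sigma> \<tau> x)"
proof -
  have t: "\<tau> \<in> pts T" using st by (rule leq_pts)
  define v' where "v' = (SOME v'. v' \<in> dclass T C \<tau> v)"
  have "v' \<in> dclass T C \<tau> v"
    unfolding v'_def using mem_dclass[OF t v] by (rule someI)
  then obtain a where a: "a \<in> cgroup T C \<tau>" "v' = a \<otimes>\<^bsub>grp T\<^esub> v"
    by (rule dclassE[OF t v])
  have "wmap D v' \<tau> (smap D \<sigma> \<tau> x) = wmap D v \<tau> (smap D \<sigma> \<tau> x)"
    unfolding a(2)
    using wmap_mult[OF t cgroup_carrier[OF a(1)] v, of "smap D \<sigma> \<tau> x"] smap_fixed[OF st x] a(1)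
    by (simp add: cgroup_act fixed_pointsD)
  then show ?thesis by (simp add: fixed_diagram_def v'_def)
qed

lemma dmap_fixed_closed:
  assumes st: "(\<sigma>, \<tau>) \<in> leq T" and v: "v \<in> carrier (grp T)" and x: "x \<in> fixed_points T C D \<sigma>"
  shows "wmap D v \<tau> (smap D \<sigma> \<tau> x) \<in> fixed_points T C D (act T \<tau> v)"
  using wmap_fixed[OF leq_pts(2)[OF st] v smap_fixed[OF st x]] .

lemma residual_functor_fixed: "residual_functor T C (fixed_diagram T C D)"
proof
  fix E x assume E: "E \<in> pts T" and "x \<in> carrier (dob (fixed_diagram T C D) E)"
  then have x: "x \<in> fixed_points T C D E" by (simp add: fixed_diagram_def)
  then show "dmap (fixed_diagram T C D) E E (dclass T C E \<one>\<^bsub>grp T\<^esub>) x = x"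
    using dmap_fixed[OF leq_refl[OF E] W.one_closed x] smap_id[OF E] wmap_one[OF E]
    by (simp add: fixed_pointsD)
next
  fix \<sigma> \<tau> v \<rho> w \<rho>' u x
  assume st: "(\<sigma>, \<tau>) \<in> leq T" and v: "v \<in> carrier (grp T)" and r: "(act T \<tau> v, \<rho>) \<in> leq T"
    and w: "w \<in> carrier (grp T)"
    and comp: "transport_comp T (\<sigma>, \<tau>, v) (act T \<tau> v, \<rho>, w) = (\<sigma>, \<rho>', u)"
    and "x \<in> carrier (dob (fixed_diagram T C D) \<sigma>)"
  then have x: "x \<in> fixed_points T C D \<sigma>" by (simp add: fixed_diagram_def)
  have t: "\<tau> \<in> pts T" and p: "\<rho> \<in> pts T" using st r by (auto dest: leq_pts)
  have eq: "\<rho>' = act T \<rho> (inv\<^bsub>grp T\<^esub> v)" "u = v \<otimes>\<^bsub>grp T\<^esub> w" using comp by simp_all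
  \<comment> \<open>Translating the inclusion of \<open>\<tau>^v\<close> in \<open>\<rho>\<close>
    back by the inverse of \<open>v\<close> gives the second half of the composite
    \<open>\<sigma> \<rightarrow> \<tau> \<rightarrow> \<rho>'\<close>.\<close>
  have tr: "(\<tau>, \<rho>') \<in> leq T"
    using act_mono[OF r W.inv_closed[OF v]] by (simp add: eq act_inv'[OF t v])
  have sr: "(\<sigma>, \<rho>') \<in> leq T" using st tr by (rule leq_trans)
  have rv: "act T \<rho>' v = \<rho>" by (simp add: eq act_inv[OF p v])
  have xs: "smap D \<sigma> \<tau> x \<in> carrier (ob D \<tau>)"
    using smap_closed[OF st fixed_pointsD(1)[OF x]] .
  have "dmap (fixed_diagram T C D) \<sigma> \<rho>' (dclass T C \<rho>' u) x = wmap D (v \<otimes>\<^bsub>grp T\<^esub> w) \<rho>' (smap D \<sigma> \<rho>' x)"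
    using dmap_fixed[OF sr _ x] v w by (simp add: eq)
  also have "\<dots> = wmap D w \<rho> (wmap D v \<rho>' (smap D \<tau> \<rho>' (smap D \<sigma> \<tau> x)))"
    using wmap_mult[OF leq_pts(2)[OF sr] v w smap_closed[OF sr fixed_pointsD(1)[OF x]]]
      smap_comp[OF st tr fixed_pointsD(1)[OF x]] by (simp add: rv)
  \<comment> \<open>Here \<open>v\<close> is pulled past the structure map out of
    \<open>\<tau>\<close>, using that \<open>\<rho>'\<close> translates back to
    \<open>\<rho>\<close> under \<open>v\<close>.\<close>
  also have "wmap D v \<rho>' (smap D \<tau> \<rho>' (smap D \<sigma> \<tau> x)) = smap D (act T \<tau> v) \<rho> (wmap D v \<tau> (smap D \<sigma> \<tau> x))"
    using wmap_smap[OF tr v xs] by (simp add: rv)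
  also have "wmap D w \<rho> \<dots> = dmap (fixed_diagram T C D) (act T \<tau> v) \<rho> (dclass T C \<rho> w)
      (dmap (fixed_diagram T C D) \<sigma> \<tau> (dclass T C \<tau> v) x)"
    by (simp add: dmap_fixed[OF st v x] dmap_fixed[OF r w dmap_fixed_closed[OF st v x]])
  finally show "dmap (fixed_diagram T C D) \<sigma> \<rho>' (dclass T C \<rho>' u) x =
      dmap (fixed_diagram T C D) (act T \<tau> v) \<rho> (dclass T C \<rho> w)
        (dmap (fixed_diagram T C D) \<sigma> \<tau> (dclass T C \<tau> v) x)" .
qed

end

section \<open>The rings of invariants as a diagram\<close>

locale fixed_point_setting = component_action T C + R: equivariant_ring T R
  for T :: "('s, 'w) poset_action" and C and R :: "('s, 'w, 'r) ring_diagram"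
begin

abbreviation "A \<equiv> R_inv T C R"

sublocale R: closed_diagram T C R
  by unfold_locales (auto intro: ring_hom_closed R.smap_ring_hom R.wmap_ring_hom)

lemma dob_A: "dob A E = (ob R E)\<lparr>carrier := fixed_points T C R E\<rparr>"
  by (simp add: R_inv_def fixed_diagram_def)

lemma A_sel [simp]:
  "carrier (dob A E) = fixed_points T C R E"
  "x \<oplus>\<^bsub>dob A E\<^esub> y = x \<oplus>\<^bsub>ob R E\<^esub> y"
  "x \<otimes>\<^bsub>dob A E\<^esub> y = x \<otimes>\<^bsub>ob R E\<^esub> y"
  "\<one>\<^bsub>dob A E\<^esub> = \<one>\<^bsub>ob R E\<^esub>"
  "\<zero>\<^bsub>dob A E\<^esub> = \<zero>\<^bsub>ob R E\<^esub>"
  by (simp_all add: dob_A)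

lemma cring_A:
  assumes E: "E \<in> pts T"
  shows "cring (dob A E)"
proof -
  interpret RE: cring "ob R E" by (rule R.cring_ob[OF E])
  have hom: "wmap R w E \<in> ring_hom (ob R E) (ob R E)" if "w \<in> cgroup T C E" for w
    using R.wmap_ring_hom[OF E cgroup_carrier[OF that]] that by (simp add: cgroup_act)
  have "wmap R w E (\<ominus>\<^bsub>ob R E\<^esub> x) = \<ominus>\<^bsub>ob R E\<^esub> wmap R w E x"
    if "w \<in> cgroup T C E" "x \<in> carrier (ob R E)" for w x
  proof -
    interpret h: ring_hom_cring "ob R E" "ob R E" "wmap R w E"
      using hom[OF that(1)] by unfold_locales
    show ?thesis using that(2) by simp
  qed
  then have "subring (fixed_points T C R E) (ob R E)"
    by (intro RE.subringI) (auto simp: fixed_points_def ring_hom_one[OF hom] ring_hom_mult[OF hom]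
        ring_hom_add[OF hom])
  moreover from this have "fixed_points T C R E \<subseteq> carrier (ob R E)"
    by (auto simp: fixed_points_def)
  ultimately show ?thesis
    using RE.subcring_iff[of "fixed_points T C R E"] RE.subcringI'[of "fixed_points T C R E"]
        by (simp add: dob_A)
qed

lemma A_inclusion: "(\<lambda>a. a) \<in> ring_hom (dob A E) (ob R E)"
  by (intro ring_hom_memI) (auto simp: fixed_points_def)

lemma dmap_A:
  "\<lbrakk>(\<sigma>, \<tau>) \<in> leq T; v \<in> carrier (grp T); a \<in> fixed_points T C R \<sigma>\<rbrakk>
    \<Longrightarrow> dmap A \<sigma> \<tau> (dclass T C \<tau> v) a = wmap R v \<tau> (smap R \<sigma> \<tau> a)"
  unfolding R_inv_def by (rule R.dmap_fixed)

lemma residual_ring_A: "residual_ring T C A"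
proof (intro residual_ring.intro residual_ring_axioms.intro)
  show "residual_functor T C A"
    unfolding R_inv_def by (rule R.residual_functor_fixed)
  show "cring (dob A E)" if "E \<in> pts T" for E
    using that by (rule cring_A)
  fix \<sigma> \<tau> v assume st: "(\<sigma>, \<tau>) \<in> leq T" and v: "v \<in> carrier (grp T)"
  have t: "\<tau> \<in> pts T" using st by (rule leq_pts)
  interpret S: cring "dob A \<sigma>" using st by (intro cring_A leq_pts)
  have sub: "a \<in> carrier (ob R \<sigma>)" if "a \<in> fixed_points T C R \<sigma>" for a
    using that by (rule R.fixed_pointsD)
  note homs = R.smap_ring_hom[OF st] R.wmap_ring_hom[OF t v]
  show "dmap A \<sigma> \<tau> (dclass T C \<tau> v) \<in> ring_hom (dob A \<sigma>) (dob A (act T \<tau> v))"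
  proof (rule ring_hom_memI)
    fix a b assume "a \<in> carrier (dob A \<sigma>)" "b \<in> carrier (dob A \<sigma>)"
    \<comment> \<open>\<open>dmap_A\<close> evaluates the structure map on invariants only, so sums
      and products must first be known to be invariant.\<close>
    moreover from this have "a \<oplus>\<^bsub>ob R \<sigma>\<^esub> b \<in> fixed_points T C R \<sigma>" "a \<otimes>\<^bsub>ob R \<sigma>\<^esub> b \<in> fixed_points T C R \<sigma>"
      using S.a_closed[of a b] S.m_closed[of a b] by simp_all
    ultimately show
      "dmap A \<sigma> \<tau> (dclass T C \<tau> v) (a \<oplus>\<^bsub>dob A \<sigma>\<^esub> b) =
        dmap A \<sigma> \<tau> (dclass T C \<tau> v) a \<oplus>\<^bsub>dob A (act T \<tau> v)\<^esub> dmap A \<sigma> \<tau> (dclass T C \<tau> v) b"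
      "dmap A \<sigma> \<tau> (dclass T C \<tau> v) (a \<otimes>\<^bsub>dob A \<sigma>\<^esub> b) =
        dmap A \<sigma> \<tau> (dclass T C \<tau> v) a \<otimes>\<^bsub>dob A (act T \<tau> v)\<^esub> dmap A \<sigma> \<tau> (dclass T C \<tau> v) b"
      by (simp_all add: dmap_A[OF st v] sub R.smap_closed[OF st] ring_hom_add[OF homs(1)]
        ring_hom_add[OF homs(2)] ring_hom_mult[OF homs(1)] ring_hom_mult[OF homs(2)])
  next
    show "dmap A \<sigma> \<tau> (dclass T C \<tau> v) \<one>\<^bsub>dob A \<sigma>\<^esub> = \<one>\<^bsub>dob A (act T \<tau> v)\<^esub>"
      using dmap_A[OF st v, of "\<one>\<^bsub>ob R \<sigma>\<^esub>"] S.one_closed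
      by (simp add: ring_hom_one[OF homs(1)] ring_hom_one[OF homs(2)])
  qed (simp add: dmap_A[OF st v] R.dmap_fixed_closed[OF st v])
qed

section \<open>Invariants of an equivariant module\<close>

lemma equivariant_module_closed:
  assumes "equivariant_module T R M"
  shows "closed_diagram T C M"
proof -
  interpret M: equivariant_module T R M by (rule assms)
  show ?thesis
    by unfold_locales (auto intro: semilinear_closed M.smap_semilinear M.wmap_semilinear)
qed

lemma Psi_sel [simp]:
  "carrier (dob (Psi T C M) E) = fixed_points T C M E"
  "x \<oplus>\<^bsub>dob (Psi T C M) E\<^esub> y = x \<oplus>\<^bsub>ob M E\<^esub> y"
  "a \<odot>\<^bsub>dob (Psi T C M) E\<^esub> x = a \<odot>\<^bsub>ob M E\<^esub> x"
  "\<zero>\<^bsub>dob (Psi T C M) E\<^esub> = \<zero>\<^bsub>ob M E\<^esub>"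
  by (simp_all add: Psi_def fixed_diagram_def)

lemma module_restrict_A:
  assumes E: "E \<in> pts T" and M: "Module.module (ob R E) M"
  shows "Module.module (dob A E) M"
proof -
  interpret M: Module.module "ob R E" M by (rule M)
  show ?thesis
    using cring_A[OF E] M.abelian_group_axioms
    by (intro moduleI) (auto simp: R.fixed_pointsD M.smult_l_distr M.smult_r_distr M.smult_assoc1)
qed

text \<open>On \<open>M(E)\<close> the group \<open>W_E^e\<close> acts only semilinearly over
  \<open>R(E)\<close>, but it fixes the scalars of \<open>R_inv(E)\<close>. So the invariants form a
  submodule once scalars are restricted to \<open>R_inv(E)\<close>. The maps between them inherit
  semilinearity from \<open>smap\<close> and \<open>wmap\<close> by evaluating at one
  representative.\<close>

lemma residual_module_Psi:
  assumes M: "equivariant_module T R M"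
  shows "residual_module T C A (Psi T C M)"
proof -
  interpret M: equivariant_module T R M by (rule M)
  interpret M: closed_diagram T C M using M by (rule equivariant_module_closed)
  have mod: "Module.module (dob A E) (dob (Psi T C M) E)" if E: "E \<in> pts T" for E
  proof -
    interpret RM: Module.module "ob R E" "ob M E" by (rule M.module_ob[OF E])
    interpret AM: Module.module "dob A E" "ob M E" by (rule module_restrict_A[OF E M.module_ob[OF E]])
    have lin: "wmap M w E \<in> semilinear (wmap R w E) (ob R E) (ob M E) (ob M E)"
        if "w \<in> cgroup T C E" for w
      using M.wmap_semilinear[OF E cgroup_carrier[OF that]] that by (simp add: cgroup_act)
    have zero: "wmap M w E \<zero>\<^bsub>ob M E\<^esub> = \<zero>\<^bsub>ob M E\<^esub>" if "w \<in> cgroup T C E" for w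
      using semilinear_add[OF lin[OF that], of "\<zero>\<^bsub>ob M E\<^esub>" "\<zero>\<^bsub>ob M E\<^esub>"] semilinear_closed[OF lin[OF
          that], of "\<zero>\<^bsub>ob M E\<^esub>"]
      by simp
    have neg: "wmap M w E (\<ominus>\<^bsub>ob M E\<^esub> x) = \<ominus>\<^bsub>ob M E\<^esub> wmap M w E x"
      if w: "w \<in> cgroup T C E" and x: "x \<in> carrier (ob M E)" for w x
      using semilinear_add[OF lin[OF w], of "\<ominus>\<^bsub>ob M E\<^esub> x" x] x semilinear_closed[OF lin[OF w]]
      by (intro RM.minus_equality[symmetric]) (simp_all add: RM.l_neg zero[OF w])
    have "submodule (fixed_points T C M E) (dob A E) (ob M E)"
    proof (rule AM.submoduleI)
      show "a \<odot>\<^bsub>ob M E\<^esub> x \<in> fixed_points T C M E"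
        if a: "a \<in> carrier (dob A E)" and x: "x \<in> fixed_points T C M E" for a x
        using a x by (auto simp: fixed_points_def semilinear_smult[OF lin])
    qed (auto simp: fixed_points_def zero neg semilinear_add[OF lin])
    from submodule.submodule_is_module[OF this AM.module_axioms] show ?thesis
      by (simp add: Psi_def fixed_diagram_def)
  qed
  show ?thesis
  proof (intro residual_module.intro residual_module_axioms.intro)
    show "residual_functor T C (Psi T C M)"
      unfolding Psi_def by (rule M.residual_functor_fixed)
    show "Module.module (dob A E) (dob (Psi T C M) E)" if "E \<in> pts T" for E
      using that by (rule mod)
    fix \<sigma> \<tau> v assume st: "(\<sigma>, \<tau>) \<in> leq T" and v: "v \<in> carrier (grp T)"
    have t: "\<tau> \<in> pts T" using st by (rule leq_pts)
    interpret S: Module.module "dob A \<sigma>" "dob (Psi T C M) \<sigma>" using st by (intro mod leq_pts)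
    note lins = M.smap_semilinear[OF st] M.wmap_semilinear[OF t v]
    note d = M.dmap_fixed[OF st v, folded Psi_def]
    show "dmap (Psi T C M) \<sigma> \<tau> (dclass T C \<tau> v) \<in>
        semilinear (dmap A \<sigma> \<tau> (dclass T C \<tau> v)) (dob A \<sigma>) (dob (Psi T C M) \<sigma>) (dob (Psi T C M)
            (act T \<tau> v))"
    proof (rule semilinearI)
      fix x y assume "x \<in> carrier (dob (Psi T C M) \<sigma>)" "y \<in> carrier (dob (Psi T C M) \<sigma>)"
      then show "dmap (Psi T C M) \<sigma> \<tau> (dclass T C \<tau> v) (x \<oplus>\<^bsub>dob (Psi T C M) \<sigma>\<^esub> y) =
          dmap (Psi T C M) \<sigma> \<tau> (dclass T C \<tau> v) x \<oplus>\<^bsub>dob (Psi T C M) (act T \<tau> v)\<^esub>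
          dmap (Psi T C M) \<sigma> \<tau> (dclass T C \<tau> v) y"
        using S.a_closed[of x y]
        by (simp add: d M.fixed_pointsD M.smap_closed[OF st] semilinear_add[OF lins(1)]
            semilinear_add[OF lins(2)])
    next
      fix a x assume "a \<in> carrier (dob A \<sigma>)" "x \<in> carrier (dob (Psi T C M) \<sigma>)"
      then show "dmap (Psi T C M) \<sigma> \<tau> (dclass T C \<tau> v) (a \<odot>\<^bsub>dob (Psi T C M) \<sigma>\<^esub> x) =
          dmap A \<sigma> \<tau> (dclass T C \<tau> v) a \<odot>\<^bsub>dob (Psi T C M) (act T \<tau> v)\<^esub>
          dmap (Psi T C M) \<sigma> \<tau> (dclass T C \<tau> v) x"
        using S.smult_closed[of a x]
        by (simp add: d dmap_A[OF st v] M.fixed_pointsD R.fixed_pointsD M.smap_closed[OF st]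
            R.smap_closed[OF st]
            semilinear_smult[OF lins(1)] semilinear_smult[OF lins(2)])
    qed (simp add: d M.dmap_fixed_closed[OF st v])
  qed
qed

section \<open>The two categories of modules\<close>

lemma equivariant_hom_comp:
  assumes M: "equivariant_module T R M"
    and f: "f \<in> equivariant_hom T R M M'" and g: "g \<in> equivariant_hom T R M' M''"
  shows "family_comp T (\<lambda>E. carrier (ob M E)) g f \<in> equivariant_hom T R M M''"
proof -
  interpret M: equivariant_module T R M by (rule M)
  interpret M: closed_diagram T C M using M by (rule equivariant_module_closed)
  show ?thesis
  proof (rule equivariant_homI)
    show "family_comp T (\<lambda>E. carrier (ob M E)) g f E \<in> semilinear (\<lambda>a. a) (ob R E) (ob M E) (ob M'' E)"
      if "E \<in> pts T" for E
      using that by (intro semilinear_compose[OF equivariant_homD(2)[OF f] equivariant_homD(2)[OF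
          g]] M.module_ob)
        (simp_all add: family_comp_apply)
  qed (simp_all add: family_comp_extensional family_comp_apply leq_pts act_closed M.smap_closed
      M.wmap_closed equivariant_homD[OF f] equivariant_homD[OF g])
qed

lemma equivariant_hom_id:
  assumes M: "equivariant_module T R M"
  shows "family_id T (\<lambda>E. carrier (ob M E)) \<in> equivariant_hom T R M M"
proof -
  interpret M: equivariant_module T R M by (rule M)
  interpret M: closed_diagram T C M using M by (rule equivariant_module_closed)
  show ?thesis
  proof (rule equivariant_homI)
    fix E assume E: "E \<in> pts T"
    interpret ME: Module.module "ob R E" "ob M E" by (rule M.module_ob[OF E])
    show "family_id T (\<lambda>E. carrier (ob M E)) E \<in> semilinear (\<lambda>a. a) (ob R E) (ob M E) (ob M E)"
      by (rule semilinearI) (simp_all add: family_id_apply E)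
  qed (simp_all add: family_id_extensional family_id_apply leq_pts act_closed M.smap_closed
      M.wmap_closed)
qed

lemma category_equivariant_modules: "category (equivariant_modules T R)"
proof (unfold_locales, simp_all only: equivariant_modules_def cat.simps mem_Collect_eq)
  fix M M' M'' M''' :: "('s, 'w, 'r, 'm) module_diagram" and f g h
  assume "f \<in> equivariant_hom T R M M'"
  note f = equivariant_homD[OF this]
  show "family_comp T (\<lambda>E. carrier (ob M E)) f (family_id T (\<lambda>E. carrier (ob M E))) = f"
    by (rule family_eqI[OF family_comp_extensional f(1)]) (simp add: family_comp_apply family_id_apply)
  show "family_comp T (\<lambda>E. carrier (ob M E)) (family_id T (\<lambda>E. carrier (ob M' E))) f = f"
    by (rule family_eqI[OF family_comp_extensional f(1)]) (simp add: family_comp_apply family_id_apply f)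
  show "family_comp T (\<lambda>E. carrier (ob M E)) h (family_comp T (\<lambda>E. carrier (ob M E)) g f) =
      family_comp T (\<lambda>E. carrier (ob M E)) (family_comp T (\<lambda>E. carrier (ob M' E)) h g) f"
    by (rule family_eqI[OF family_comp_extensional family_comp_extensional])
        (simp add: family_comp_apply f)
qed (rule equivariant_hom_id equivariant_hom_comp; assumption)+

lemma residual_module_dmap_closed:
  assumes "residual_module T C A N" "(\<sigma>, \<tau>) \<in> leq T" "v \<in> carrier (grp T)" "x \<in> carrier (dob N \<sigma>)"
  shows "dmap N \<sigma> \<tau> (dclass T C \<tau> v) x \<in> carrier (dob N (act T \<tau> v))"
  using semilinear_closed[OF residual_module.dmap_semilinear[OF assms(1-3)] assms(4)] .

lemma residual_hom_comp:
  assumes N: "residual_module T C A N"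
    and f: "f \<in> residual_hom T C A N N'" and g: "g \<in> residual_hom T C A N' N''"
  shows "family_comp T (\<lambda>E. carrier (dob N E)) g f \<in> residual_hom T C A N N''"
proof (rule residual_homI)
  show "family_comp T (\<lambda>E. carrier (dob N E)) g f E \<in> semilinear (\<lambda>a. a) (dob A E) (dob N E) (dob N'' E)"
    if "E \<in> pts T" for E
    using that by (intro semilinear_compose[OF residual_homD(2)[OF f] residual_homD(2)[OF g]]
        residual_module.module_dob[OF N]) (simp_all add: family_comp_apply)
qed (simp_all add: family_comp_extensional family_comp_apply leq_pts act_closed
    residual_module_dmap_closed[OF N] residual_homD[OF f] residual_homD[OF g])

lemma residual_hom_id:
  assumes N: "residual_module T C A N"
  shows "family_id T (\<lambda>E. carrier (dob N E)) \<in> residual_hom T C A N N"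
proof (rule residual_homI)
  fix E assume E: "E \<in> pts T"
  interpret NE: Module.module "dob A E" "dob N E" by (rule residual_module.module_dob[OF N E])
  show "family_id T (\<lambda>E. carrier (dob N E)) E \<in> semilinear (\<lambda>a. a) (dob A E) (dob N E) (dob N E)"
    by (rule semilinearI) (simp_all add: family_id_apply E del: A_sel)
qed (simp_all add: family_id_extensional family_id_apply leq_pts act_closed
    residual_module_dmap_closed[OF N])

lemma category_residual_modules: "category (residual_modules T C A)"
proof (unfold_locales, simp_all only: residual_modules_def cat.simps mem_Collect_eq)
  fix N N' N'' N''' :: "('s, 'w, 'r, 'n) residual_module_diagram" and f g h
  assume "f \<in> residual_hom T C A N N'"
  note f = residual_homD[OF this]
  show "family_comp T (\<lambda>E. carrier (dob N E)) f (family_id T (\<lambda>E. carrier (dob N E))) = f"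
    by (rule family_eqI[OF family_comp_extensional f(1)]) (simp add: family_comp_apply family_id_apply)
  show "family_comp T (\<lambda>E. carrier (dob N E)) (family_id T (\<lambda>E. carrier (dob N' E))) f = f"
    by (rule family_eqI[OF family_comp_extensional f(1)]) (simp add: family_comp_apply family_id_apply f)
  show "family_comp T (\<lambda>E. carrier (dob N E)) h (family_comp T (\<lambda>E. carrier (dob N E)) g f) =
      family_comp T (\<lambda>E. carrier (dob N E)) (family_comp T (\<lambda>E. carrier (dob N' E)) h g) f"
    by (rule family_eqI[OF family_comp_extensional family_comp_extensional])
        (simp add: family_comp_apply f)
qed (rule residual_hom_id residual_hom_comp; assumption)+

section \<open>Invariants of morphisms\<close>

lemma Psi_map_apply: "\<lbrakk>E \<in> pts T; x \<in> fixed_points T C M E\<rbrakk> \<Longrightarrow> Psi_map T C M M' f E x = f E x"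
  by (simp add: Psi_map_def)

lemma Psi_map_extensional: "Psi_map T C M M' f
    \<in> (\<Pi>\<^sub>E E\<in>pts T. extensional (carrier (dob (Psi T C M) E)))"
  by (auto simp: Psi_map_def)

text \<open>For \<open>w\<close> in \<open>W_E^e\<close> source and target of \<open>w_m\<close> are
  both at \<open>E\<close>, so compatibility of \<open>f\<close> with \<open>w_m\<close> says that
  \<open>f E\<close> commutes with the action of \<open>W_E^e\<close>.\<close>

lemma equivariant_hom_fixed:
  assumes M: "equivariant_module T R M" and f: "f \<in> equivariant_hom T R M M'"
    and E: "E \<in> pts T" and x: "x \<in> fixed_points T C M E"
  shows "f E x \<in> fixed_points T C M' E"
proof -
  have "wmap M' w E (f E x) = f E x" if w: "w \<in> cgroup T C E" for w
    using equivariant_homD(5)[OF f E cgroup_carrier[OF w], of x] x w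
        by (simp add: fixed_points_def cgroup_act)
  then show ?thesis
    using equivariant_homD(3)[OF f E] x by (simp add: fixed_points_def)
qed

lemma Psi_map_hom:
  assumes M: "equivariant_module T R M" and M': "equivariant_module T R M'"
    and f: "f \<in> equivariant_hom T R M M'"
  shows "Psi_map T C M M' f \<in> residual_hom T C A (Psi T C M) (Psi T C M')"
proof -
  interpret M: equivariant_module T R M by (rule M)
  interpret M: closed_diagram T C M using M by (rule equivariant_module_closed)
  interpret M': closed_diagram T C M' using M' by (rule equivariant_module_closed)
  note P = residual_module_Psi[OF M]
  show ?thesis
  proof (rule residual_homI[OF Psi_map_extensional])
    fix E assume E: "E \<in> pts T"
    interpret PE: Module.module "dob A E" "dob (Psi T C M) E"
        by (rule residual_module.module_dob[OF P E])
    show "Psi_map T C M M' f E \<in> semilinear (\<lambda>a. a) (dob A E) (dob (Psi T C M) E) (dob (Psi T C M') E)"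
    proof (rule semilinearI)
      fix x y assume "x \<in> carrier (dob (Psi T C M) E)" "y \<in> carrier (dob (Psi T C M) E)"
      then show "Psi_map T C M M' f E (x \<oplus>\<^bsub>dob (Psi T C M) E\<^esub> y) =
          Psi_map T C M M' f E x \<oplus>\<^bsub>dob (Psi T C M') E\<^esub> Psi_map T C M M' f E y"
        using PE.a_closed[of x y]
        by (simp add: Psi_map_apply E M.fixed_pointsD semilinear_add[OF equivariant_homD(2)[OF f E]])
    next
      fix a x assume "a \<in> carrier (dob A E)" "x \<in> carrier (dob (Psi T C M) E)"
      then show "Psi_map T C M M' f E (a \<odot>\<^bsub>dob (Psi T C M) E\<^esub> x) =
          a \<odot>\<^bsub>dob (Psi T C M') E\<^esub> Psi_map T C M M' f E x"
        using PE.smult_closed[of a x]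
        by (simp add: Psi_map_apply E M.fixed_pointsD R.fixed_pointsD semilinear_smult[OF
            equivariant_homD(2)[OF f E]])
    qed (simp add: Psi_map_apply E equivariant_hom_fixed[OF M f E])
  next
    fix \<sigma> \<tau> v x assume st: "(\<sigma>, \<tau>) \<in> leq T" and v: "v \<in> carrier (grp T)"
      and "x \<in> carrier (dob (Psi T C M) \<sigma>)"
    then have x: "x \<in> fixed_points T C M \<sigma>" by simp
    have pts: "\<sigma> \<in> pts T" "\<tau> \<in> pts T" "act T \<tau> v \<in> pts T"
      using st v by (auto intro: leq_pts act_closed)
    show "Psi_map T C M M' f (act T \<tau> v) (dmap (Psi T C M) \<sigma> \<tau> (dclass T C \<tau> v) x) =
        dmap (Psi T C M') \<sigma> \<tau> (dclass T C \<tau> v) (Psi_map T C M M' f \<sigma> x)"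
      \<comment> \<open>Both structure maps are evaluated at the same representative
        \<open>v\<close>; what remains is that \<open>f\<close> commutes with \<open>smap\<close>
        and then with \<open>wmap\<close>.\<close>
      using M.dmap_fixed[OF st v x] M'.dmap_fixed[OF st v equivariant_hom_fixed[OF M f pts(1) x]]
        M.dmap_fixed_closed[OF st v x] M.fixed_pointsD(1)[OF x]
      by (simp add: Psi_def[symmetric] Psi_map_apply pts x equivariant_homD[OF f]
          st v M.smap_closed[OF st])
  qed
qed

lemma functor_Psi:
  "cat_functor (equivariant_modules T R :: (('s, 'w, 'r, 'm) module_diagram, 's \<Rightarrow> 'm \<Rightarrow> 'm) cat)
    (residual_modules T C A) (Psi T C) (Psi_map T C)"
proof (intro cat_functor.intro category_equivariant_modules category_residual_modules
    cat_functor_axioms.intro;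
    simp only: equivariant_modules_def residual_modules_def cat.simps mem_Collect_eq)
  fix M M' M'' :: "('s, 'w, 'r, 'm) module_diagram" and f g
  assume M: "equivariant_module T R M"
  show "residual_module T C A (Psi T C M)"
    using M by (rule residual_module_Psi)
  show "Psi_map T C M M (family_id T (\<lambda>E. carrier (ob M E))) = family_id T (\<lambda>E. carrier (dob
      (Psi T C M) E))"
    by (rule family_eqI[OF Psi_map_extensional family_id_extensional])
       (auto simp: Psi_map_apply family_id_apply fixed_points_def)
  assume f: "f \<in> equivariant_hom T R M M'"
  show "Psi_map T C M M'' (family_comp T (\<lambda>E. carrier (ob M E)) g f) =
      family_comp T (\<lambda>E. carrier (dob (Psi T C M) E)) (Psi_map T C M' M'' g) (Psi_map T C M M' f)"
    by (rule family_eqI[OF Psi_map_extensional family_comp_extensional])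
       (simp_all add: Psi_map_apply family_comp_apply equivariant_hom_fixed[OF M f], simp add:
           fixed_points_def family_comp_apply)
  assume "equivariant_module T R M'"
  with M show "Psi_map T C M M' f \<in> residual_hom T C A (Psi T C M) (Psi T C M')"
    using f by (rule Psi_map_hom)
qed

end

section \<open>Termwise extension of scalars\<close>

text \<open>\<open>tensor_map_hom\<close> yields additive maps of tensor groups. The formula on pure
  tensors turns them into semilinear maps over the large rings.\<close>

lemma semilinear_hom_extI:
  assumes s: "scalar_extension A B N" and t: "scalar_extension A' B' N'"
    and \<psi>: "\<psi> \<in> ring_hom B B'" and g: "\<And>n. n \<in> carrier N \<Longrightarrow> g n \<in> carrier N'"
    and h: "h \<in> hom (tensor_group A (ring_via (\<lambda>a. a) B) N) (tensor_group A' (ring_via (\<lambda>a. a) B') N')"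
    and pure: "\<And>b n. \<lbrakk>b \<in> carrier B; n \<in> carrier N\<rbrakk>
      \<Longrightarrow> h (pure_tensor A (ring_via (\<lambda>a. a) B) N b n) = pure_tensor A' (ring_via (\<lambda>a. a) B') N' (\<psi> b)
          (g n)"
  shows "h \<in> semilinear \<psi> B (extend_scalars A B N) (extend_scalars A' B' N')"
proof -
  interpret s: scalar_extension A B N by (rule s)
  interpret t: scalar_extension A' B' N' by (rule t)
  have one: "\<one>\<^bsub>B'\<^esub> \<in> carrier B'" by simp
  show ?thesis
  \<comment> \<open>\<open>\<psi> b \<otimes> g n\<close> is \<open>\<psi> b\<close> times
    \<open>1 \<otimes> g n\<close>, the shape that \<open>semilinear_extI\<close> asks for.\<close>
  proof (rule s.semilinear_extI[where g = "\<lambda>n. t.pure \<one>\<^bsub>B'\<^esub> (g n)", OF _ _ _ \<psi> t.ext.module_axioms])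
    show "h (x \<oplus>\<^bsub>s.ext\<^esub> y) = h x \<oplus>\<^bsub>t.ext\<^esub> h y" if "x \<in> carrier s.ext" "y \<in> carrier s.ext" for x y
      using hom_mult[OF h] that by (simp add: s.carrier_ext s.add_ext t.add_ext)
  qed (simp_all add: pure g t.smult_hom(2) ring_hom_closed[OF \<psi>])
qed

lemma semilinear_restrict:
  assumes "h \<in> semilinear \<phi> A P Q" "Module.module A P"
  shows "restrict h (carrier P) \<in> semilinear \<phi> A P Q"
  using semilinear_compose[of "\<lambda>x. x" "\<lambda>a. a" A P P h \<phi> A Q "restrict h (carrier P)" \<phi>] assms
  by (simp add: semilinear_def)

context fixed_point_setting
begin

context
  fixes N :: "('s, 'w, 'r, 'n) residual_module_diagram"
  assumes N: "residual_module T C A N"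
begin

interpretation N: residual_module T C A N by (rule N)

lemma scalar_extension_N:
  assumes E: "E \<in> pts T"
  shows "scalar_extension (dob A E) (ob R E) (dob N E)"
  by (intro scalar_extension.intro R.cring_ob N.module_dob E scalar_extension_axioms.intro A_inclusion)

text \<open>The composition law with the second target written as a translate under
  \<open>v\<close>: pulling it back along \<open>v\<close> then gives \<open>\<rho>\<close> itself,
  and the composite is indexed by \<open>v w\<close>.\<close>

lemma dmap_step:
  assumes "(\<sigma>, \<tau>) \<in> leq T" "v \<in> carrier (grp T)" "(act T \<tau> v, act T \<rho> v) \<in> leq T"
    "w \<in> carrier (grp T)" "\<rho> \<in> pts T" "x \<in> carrier (dob N \<sigma>)"
  shows "dmap N (act T \<tau> v) (act T \<rho> v) (dclass T C (act T \<rho> v) w) (dmap N \<sigma> \<tau> (dclass T C \<tau> v) x) =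
    dmap N \<sigma> \<rho> (dclass T C \<rho> (v \<otimes>\<^bsub>grp T\<^esub> w)) x"
  using assms by (intro N.dmap_comp[symmetric]) (simp_all add: act_inv')

text \<open>The factorisation of \<open>(i, [v])\<close> into \<open>(i, [1])\<close> followed by
  \<open>(1, [v])\<close>. The diagram \<open>\<theta>_* N\<close> uses only these two kinds of
  maps, so this is how general residual maps are recovered.\<close>

lemma dmap_factor:
  assumes st: "(\<sigma>, \<tau>) \<in> leq T" and v: "v \<in> carrier (grp T)" and x: "x \<in> carrier (dob N \<sigma>)"
  shows "dmap N \<tau> \<tau> (dclass T C \<tau> v) (dmap N \<sigma> \<tau> (dclass T C \<tau> \<one>\<^bsub>grp T\<^esub>) x) = dmap N \<sigma> \<tau>
      (dclass T C \<tau> v) x"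
  using dmap_step[of \<sigma> \<tau> "\<one>\<^bsub>grp T\<^esub>" \<tau> v x] leq_pts[OF st] st v x by (simp add: act_one leq_refl)

lemma dmap_closed:
  "\<lbrakk>(\<sigma>, \<tau>) \<in> leq T; v \<in> carrier (grp T); x \<in> carrier (dob N \<sigma>)\<rbrakk>
    \<Longrightarrow> dmap N \<sigma> \<tau> (dclass T C \<tau> v) x \<in> carrier (dob N (act T \<tau> v))"
  by (rule residual_module_dmap_closed[OF N])

lemma dmap_one_closed:
  "\<lbrakk>(F, E) \<in> leq T; x \<in> carrier (dob N F)\<rbrakk> \<Longrightarrow> dmap N F E (dclass T C E \<one>\<^bsub>grp T\<^esub>) x \<in> carrier (dob N E)"
  using dmap_closed[of F E "\<one>\<^bsub>grp T\<^esub>" x] by (simp add: act_one leq_pts)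

lemma dmap_refl_closed:
  "\<lbrakk>E \<in> pts T; w \<in> carrier (grp T); x \<in> carrier (dob N E)\<rbrakk>
    \<Longrightarrow> dmap N E E (dclass T C E w) x \<in> carrier (dob N (act T E w))"
  using dmap_closed[of E E w x] by (simp add: leq_refl)

end

abbreviation (input) tens where
  "tens N E \<equiv> pure_tensor (dob A E) (ring_via (\<lambda>a. a) (ob R E)) (dob N E)"

lemma ob_theta: "ob (theta T C R N) E = extend_scalars (dob A E) (ob R E) (dob N E)"
  by (simp add: theta_def Let_def)

text \<open>The composite defining the map is followed through \<open>R(E) \<otimes> N(F)\<close>
  over \<open>R_inv(F)\<close>. The first step keeps the base ring and changes only the
  coefficients; the second is the identity on \<open>R(E)\<close>, semilinear along
  \<open>R_inv(F) \<rightarrow> R_inv(E)\<close>, tensored with the map of \<open>N\<close>.\<close>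

lemma theta_smap:
  assumes N: "residual_module T C A N" and FE: "(F, E) \<in> leq T"
  shows "smap (theta T C R N) F E \<in> semilinear (smap R F E) (ob R F) (ob (theta T C R N) F) (ob
      (theta T C R N) E)"
    and "\<lbrakk>r \<in> carrier (ob R F); n \<in> carrier (dob N F)\<rbrakk> \<Longrightarrow>
      smap (theta T C R N) F E (tens N F r n) = tens N E (smap R F E r) (dmap N F E
          (dclass T C E \<one>\<^bsub>grp T\<^esub>) n)"
proof -
  have F: "F \<in> pts T" and E: "E \<in> pts T" using FE by (auto dest: leq_pts)
  interpret N: residual_module T C A N by (rule N)
  interpret s: scalar_extension "dob A F" "ob R F" "dob N F" by (rule scalar_extension_N[OF N F])
  interpret t: scalar_extension "dob A E" "ob R E" "dob N E" by (rule scalar_extension_N[OF N E])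
  let ?V = "ring_via (smap R F E) (ob R E)"
  let ?f = "tensor_map (dob A F) ?V (dob N F) (smap R F E) (\<lambda>n. n)"
  let ?g = "tensor_map (dob A E) (ring_via (\<lambda>a. a) (ob R E)) (dob N E)
    (\<lambda>r. r) (dmap N F E (dclass T C E \<one>\<^bsub>grp T\<^esub>))"
  note \<phi> = R.smap_ring_hom[OF FE]
  \<comment> \<open>The class of \<open>1\<close> indexes the poset morphism, so on invariants this
    is the structure map of \<open>R\<close>; both factors of \<open>?g\<close> are thus semilinear
    along the same map.\<close>
  have dA: "dmap A F E (dclass T C E \<one>\<^bsub>grp T\<^esub>) a = smap R F E a" if "a \<in> fixed_points T C R F" for a
    using dmap_A[OF FE W.one_closed that] R.wmap_one[OF E] R.smap_closed[OF FE R.fixed_pointsD(1)[OF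
        that]] by simp
  have "smap R F E \<in> ring_hom (dob A F) (ob R E)"
    using \<phi> by (auto simp: ring_hom_def fixed_points_def)
  then have V: "tensor_product (dob A F) ?V (dob N F)"
    by (intro tensor_product.intro ring_via_module s.N.R.is_cring t.B.is_cring s.N.module_axioms)
  have "smap R F E \<in> semilinear (\<lambda>a. a) (dob A F) (ring_via (\<lambda>a. a) (ob R F)) ?V"
    by (intro semilinearI) (simp_all add: R.smap_closed[OF FE] ring_hom_add[OF \<phi>]
        ring_hom_mult[OF \<phi>] R.fixed_pointsD)
  moreover have "(\<lambda>n. n) \<in> semilinear (\<lambda>a. a) (dob A F) (dob N F) (dob N F)"
    by (simp add: semilinear_def)
  moreover have "(\<lambda>a. a) \<in> carrier (dob A F) \<rightarrow> carrier (dob A F)"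
    by simp
  ultimately have f: "?f \<in> hom (tensor_group (dob A F) (ring_via (\<lambda>a. a) (ob R F)) (dob N F))
      (tensor_group (dob A F) ?V (dob N F))"
    "\<And>r n. \<lbrakk>r \<in> carrier (ob R F); n \<in> carrier (dob N F)\<rbrakk>
      \<Longrightarrow> ?f (tens N F r n) = pure_tensor (dob A F) ?V (dob N F) (smap R F E r) n"
    using tensor_map_hom[OF s.tensor_product_axioms V] by simp_all
  have "(\<lambda>r. r) \<in> semilinear (dmap A F E (dclass T C E \<one>\<^bsub>grp T\<^esub>)) (dob A F) ?V (ring_via (\<lambda>a. a)
      (ob R E))"
    by (intro semilinearI) (simp_all add: dA)
  moreover have "dmap N F E (dclass T C E \<one>\<^bsub>grp T\<^esub>) \<in>
      semilinear (dmap A F E (dclass T C E \<one>\<^bsub>grp T\<^esub>)) (dob A F) (dob N F) (dob N E)"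
    using N.dmap_semilinear[OF FE W.one_closed] by (simp add: act_one E)
  moreover have "dmap A F E (dclass T C E \<one>\<^bsub>grp T\<^esub>) \<in> carrier (dob A F) \<rightarrow> carrier (dob A E)"
    by (auto simp: dA R.smap_fixed[OF FE])
  ultimately have g: "?g \<in> hom (tensor_group (dob A F) ?V (dob N F)) (tensor_group (dob A E)
      (ring_via (\<lambda>a. a) (ob R E)) (dob N E))"
    "\<And>r n. \<lbrakk>r \<in> carrier (ob R E); n \<in> carrier (dob N F)\<rbrakk>
      \<Longrightarrow> ?g (pure_tensor (dob A F) ?V (dob N F) r n) = tens N E r (dmap N F E (dclass T C E \<one>\<^bsub>grp T\<^esub>) n)"
    using tensor_map_hom[OF V t.tensor_product_axioms] by simp_all
  have smap: "smap (theta T C R N) F E = ?g \<circ> ?f"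
    by (simp add: theta_def Let_def)
  show pure: "smap (theta T C R N) F E (tens N F r n) = tens N E (smap R F E r) (dmap N F E
      (dclass T C E \<one>\<^bsub>grp T\<^esub>) n)"
    if "r \<in> carrier (ob R F)" "n \<in> carrier (dob N F)" for r n
    using that by (simp add: smap f(2) g(2) R.smap_closed[OF FE])
  show "smap (theta T C R N) F E \<in> semilinear (smap R F E) (ob R F) (ob (theta T C R N) F) (ob
      (theta T C R N) E)"
    unfolding ob_theta
  proof (rule semilinear_hom_extI[OF s.scalar_extension_axioms t.scalar_extension_axioms \<phi> _ _ pure])
    show "smap (theta T C R N) F E \<in> hom (tensor_group (dob A F) (ring_via (\<lambda>a. a) (ob R F)) (dob N F))
        (tensor_group (dob A E) (ring_via (\<lambda>a. a) (ob R E)) (dob N E))"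
      unfolding smap by (rule hom_compose[OF f(1) g(1)])
  qed (rule dmap_one_closed[OF N FE])
qed

text \<open>One step suffices: the maps of \<open>R\<close> and of \<open>N\<close> at
  \<open>w\<close> are semilinear along the same map
  \<open>R_inv(E) \<rightarrow> R_inv(E^w)\<close>.\<close>

lemma theta_wmap:
  assumes N: "residual_module T C A N" and E: "E \<in> pts T" and w: "w \<in> carrier (grp T)"
  shows "wmap (theta T C R N) w E \<in>
      semilinear (wmap R w E) (ob R E) (ob (theta T C R N) E) (ob (theta T C R N) (act T E w))"
    and "\<lbrakk>r \<in> carrier (ob R E); n \<in> carrier (dob N E)\<rbrakk> \<Longrightarrow>
      wmap (theta T C R N) w E (tens N E r n) = tens N (act T E w) (wmap R w E r) (dmap N E E
          (dclass T C E w) n)"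
proof -
  have E': "act T E w \<in> pts T" using E w by (rule act_closed)
  interpret N: residual_module T C A N by (rule N)
  interpret s: scalar_extension "dob A E" "ob R E" "dob N E" by (rule scalar_extension_N[OF N E])
  interpret t: scalar_extension "dob A (act T E w)" "ob R (act T E w)" "dob N (act T E w)"
    by (rule scalar_extension_N[OF N E'])
  let ?f = "tensor_map (dob A (act T E w)) (ring_via (\<lambda>a. a) (ob R (act T E w))) (dob N (act T E w))
    (wmap R w E) (dmap N E E (dclass T C E w))"
  note \<phi> = R.wmap_ring_hom[OF E w]
  have dA: "dmap A E E (dclass T C E w) a = wmap R w E a" if "a \<in> fixed_points T C R E" for a
    using dmap_A[OF leq_refl[OF E] w that] R.smap_id[OF E R.fixed_pointsD(1)[OF that]] by simp
  have "wmap R w E \<in> semilinear (dmap A E E (dclass T C E w)) (dob A E)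
      (ring_via (\<lambda>a. a) (ob R E)) (ring_via (\<lambda>a. a) (ob R (act T E w)))"
    by (intro semilinearI) (simp_all add: R.wmap_closed[OF E w] ring_hom_add[OF \<phi>]
        ring_hom_mult[OF \<phi>] R.fixed_pointsD dA)
  moreover have "dmap N E E (dclass T C E w) \<in>
      semilinear (dmap A E E (dclass T C E w)) (dob A E) (dob N E) (dob N (act T E w))"
    using N.dmap_semilinear[OF leq_refl[OF E] w] .
  moreover have "dmap A E E (dclass T C E w) \<in> carrier (dob A E) \<rightarrow> carrier (dob A (act T E w))"
    by (auto simp: dA R.wmap_fixed[OF E w])
  ultimately have f: "?f \<in> hom (tensor_group (dob A E) (ring_via (\<lambda>a. a) (ob R E)) (dob N E))
      (tensor_group (dob A (act T E w)) (ring_via (\<lambda>a. a) (ob R (act T E w))) (dob N (act T E w)))"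
    "\<And>r n. \<lbrakk>r \<in> carrier (ob R E); n \<in> carrier (dob N E)\<rbrakk>
      \<Longrightarrow> ?f (tens N E r n) = tens N (act T E w) (wmap R w E r) (dmap N E E (dclass T C E w) n)"
    using tensor_map_hom[OF s.tensor_product_axioms t.tensor_product_axioms] by simp_all
  have wmap: "wmap (theta T C R N) w E = ?f"
    by (simp add: theta_def Let_def)
  show pure: "wmap (theta T C R N) w E (tens N E r n) = tens N (act T E w) (wmap R w E r)
      (dmap N E E (dclass T C E w) n)"
    if "r \<in> carrier (ob R E)" "n \<in> carrier (dob N E)" for r n
    using that by (simp add: wmap f(2))
  show "wmap (theta T C R N) w E \<in>
      semilinear (wmap R w E) (ob R E) (ob (theta T C R N) E) (ob (theta T C R N) (act T E w))"
    unfolding ob_theta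
    by (rule semilinear_hom_extI[OF s.scalar_extension_axioms t.scalar_extension_axioms \<phi> _ _ pure])
       (simp_all add: wmap f(1) dmap_refl_closed[OF N E w])
qed

lemma theta_induct [consumes 3, case_names pure add]:
  assumes N: "residual_module T C A N" and E: "E \<in> pts T" and x: "x \<in> carrier (ob (theta T C R N) E)"
    and "\<And>r n. \<lbrakk>r \<in> carrier (ob R E); n \<in> carrier (dob N E)\<rbrakk> \<Longrightarrow> S (tens N E r n)"
    and "\<And>x y. \<lbrakk>x \<in> carrier (ob (theta T C R N) E); y \<in> carrier (ob (theta T C R N) E); S x; S y\<rbrakk>
      \<Longrightarrow> S (x \<oplus>\<^bsub>ob (theta T C R N) E\<^esub> y)"
  shows "S x"
  using scalar_extension.ext_induct[OF scalar_extension_N[OF N E], of x S] assms(3-)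
      by (simp add: ob_theta)

lemma tens_closed:
  "\<lbrakk>residual_module T C A N; E \<in> pts T; r \<in> carrier (ob R E); n \<in> carrier (dob N E)\<rbrakk>
    \<Longrightarrow> tens N E r n \<in> carrier (ob (theta T C R N) E)"
  using scalar_extension.pure_ext[OF scalar_extension_N] by (simp add: ob_theta)

text \<open>Each diagram law is additive in the element. On a pure tensor it is the law of
  \<open>R\<close> in the first factor and, in the second, functoriality of \<open>N\<close> on the
  residual.\<close>

lemma equivariant_module_theta:
  assumes N: "residual_module T C A N"
  shows "equivariant_module T R (theta T C R N)"
proof (intro equivariant_module.intro equivariant_module_axioms.intro equivariant_diagram.intro)
  interpret N: residual_module T C A N by (rule N)
  let ?\<theta> = "theta T C R N"
  note sl = theta_smap(1)[OF N] and sp = theta_smap(2)[OF N]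
    and wl = theta_wmap(1)[OF N] and wp = theta_wmap(2)[OF N]
  show "Module.module (ob R E) (ob ?\<theta> E)" if E: "E \<in> pts T" for E
  proof -
    interpret s: scalar_extension "dob A E" "ob R E" "dob N E" by (rule scalar_extension_N[OF N E])
    show ?thesis unfolding ob_theta by (rule s.ext.module_axioms)
  qed
  show "smap ?\<theta> F E \<in> semilinear (smap R F E) (ob R F) (ob ?\<theta> F) (ob ?\<theta> E)" if "(F, E) \<in> leq T" for F E
    using that by (rule sl)
  show "wmap ?\<theta> w E \<in> semilinear (wmap R w E) (ob R E) (ob ?\<theta> E) (ob ?\<theta> (act T E w))"
    if "E \<in> pts T" "w \<in> carrier (grp T)" for E w
    using that by (rule wl)
  show "smap ?\<theta> E E x = x" if E: "E \<in> pts T" and x: "x \<in> carrier (ob ?\<theta> E)" for E x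
    using N E x
  proof (induction rule: theta_induct)
    case (pure r n)
    then show ?case by (simp add: sp leq_refl E R.smap_id N.dmap_id)
  next
    case (add x y)
    then show ?case by (simp add: semilinear_add[OF sl[OF leq_refl[OF E]]])
  qed
  show "wmap ?\<theta> \<one>\<^bsub>grp T\<^esub> E x = x" if E: "E \<in> pts T" and x: "x \<in> carrier (ob ?\<theta> E)" for E x
    using N E x
  proof (induction rule: theta_induct)
    case (pure r n)
    then show ?case by (simp add: wp E R.wmap_one N.dmap_id act_one)
  next
    case (add x y)
    then show ?case using semilinear_add[OF wl[OF E W.one_closed], of x y] by (simp add: act_one E)
  qed
  show "smap ?\<theta> F G x = smap ?\<theta> E G (smap ?\<theta> F E x)"
    if FE: "(F, E) \<in> leq T" and EG: "(E, G) \<in> leq T" and x: "x \<in> carrier (ob ?\<theta> F)" for F E G x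
  proof -
    have FG: "(F, G) \<in> leq T" using FE EG by (rule leq_trans)
    have pts: "F \<in> pts T" "E \<in> pts T" "G \<in> pts T" using FE EG by (auto dest: leq_pts)
    from N pts(1) x show ?thesis
    proof (induction rule: theta_induct)
      case (pure r n)
      then show ?case
        using dmap_step[OF N, of F E "\<one>\<^bsub>grp T\<^esub>" G "\<one>\<^bsub>grp T\<^esub>" n] pts FE EG
        by (simp add: sp FE EG FG R.smap_closed R.smap_comp[OF FE EG] dmap_one_closed[OF N FE] act_one)
    next
      case (add x y)
      then show ?case
        by (simp add: semilinear_add[OF sl[OF FE]] semilinear_add[OF sl[OF EG]]
            semilinear_add[OF sl[OF FG]]
            semilinear_closed[OF sl[OF FE]])
    qed
  qed
  show "wmap ?\<theta> (v \<otimes>\<^bsub>grp T\<^esub> w) E x = wmap ?\<theta> w (act T E v) (wmap ?\<theta> v E x)"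
    if E: "E \<in> pts T" and v: "v \<in> carrier (grp T)" and w: "w \<in> carrier (grp T)"
      and x: "x \<in> carrier (ob ?\<theta> E)" for E v w x
  proof -
    have E': "act T E v \<in> pts T" using E v by (rule act_closed)
    have vw: "v \<otimes>\<^bsub>grp T\<^esub> w \<in> carrier (grp T)" using v w by simp
    from N E x show ?thesis
    proof (induction rule: theta_induct)
      case (pure r n)
      then show ?case
        using dmap_step[OF N, of E E v E w n] E E' v w
        by (simp add: wp E E' v w vw R.wmap_closed R.wmap_mult dmap_refl_closed[OF N E v]
            act_mult leq_refl)
    next
      case (add x y)
      then show ?case
        using semilinear_add[OF wl[OF E vw], of x y]
        by (simp add: semilinear_add[OF wl[OF E v]] semilinear_add[OF wl[OF E' w]]
            semilinear_closed[OF wl[OF E v]] act_mult E v w)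
    qed
  qed
  show "wmap ?\<theta> w E (smap ?\<theta> F E x) = smap ?\<theta> (act T F w) (act T E w) (wmap ?\<theta> w F x)"
    if FE: "(F, E) \<in> leq T" and w: "w \<in> carrier (grp T)" and x: "x \<in> carrier (ob ?\<theta> F)" for F E w x
  proof -
    have pts: "F \<in> pts T" "E \<in> pts T" using FE by (auto dest: leq_pts)
    have FE': "(act T F w, act T E w) \<in> leq T" using FE w by (rule act_mono)
    from N pts(1) x show ?thesis
    proof (induction rule: theta_induct)
      case (pure r n)
      \<comment> \<open>Both sides are the value of \<open>N\<close> on \<open>(i, [w])\<close>: on
        the left \<open>i\<close> comes before \<open>w\<close>, on the right \<open>w\<close> comes
        before the translate of \<open>i\<close>.\<close>
      have "dmap N E E (dclass T C E w) (dmap N F E (dclass T C E \<one>\<^bsub>grp T\<^esub>) n) =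
          dmap N (act T F w) (act T E w) (dclass T C (act T E w) \<one>\<^bsub>grp T\<^esub>) (dmap N F F
              (dclass T C F w) n)"
        using dmap_factor[OF N FE w, of n] dmap_step[OF N, of F F w E "\<one>\<^bsub>grp T\<^esub>" n] pts FE' w pure
        by (simp add: leq_refl)
      then show ?case
        using pure by (simp add: sp wp FE FE' pts w R.smap_closed R.wmap_closed R.wmap_smap
            dmap_one_closed[OF N FE] dmap_refl_closed[OF N pts(1) w])
    next
      case (add x y)
      then show ?case
        by (simp add: semilinear_add[OF sl[OF FE]] semilinear_add[OF wl[OF pts(2) w]]
            semilinear_add[OF sl[OF FE']] semilinear_add[OF wl[OF pts(1) w]]
            semilinear_closed[OF sl[OF FE]] semilinear_closed[OF wl[OF pts(1) w]])
    qed
  qed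
qed

section \<open>Extension of scalars on morphisms\<close>

lemma theta_map:
  assumes N: "residual_module T C A N" and N': "residual_module T C A N'"
    and f: "f \<in> residual_hom T C A N N'" and E: "E \<in> pts T"
  shows "theta_map T C R N N' f E \<in> semilinear (\<lambda>a. a) (ob R E) (ob (theta T C R N) E) (ob
      (theta T C R N') E)"
    and "\<lbrakk>r \<in> carrier (ob R E); n \<in> carrier (dob N E)\<rbrakk>
      \<Longrightarrow> theta_map T C R N N' f E (tens N E r n) = tens N' E r (f E n)"
proof -
  interpret s: scalar_extension "dob A E" "ob R E" "dob N E" by (rule scalar_extension_N[OF N E])
  interpret t: scalar_extension "dob A E" "ob R E" "dob N' E" by (rule scalar_extension_N[OF N' E])
  let ?f = "tensor_map (dob A E) (ring_via (\<lambda>a. a) (ob R E)) (dob N' E) (\<lambda>r. r) (f E)"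
  have "(\<lambda>r. r) \<in> semilinear (\<lambda>a. a) (dob A E) (ring_via (\<lambda>a. a) (ob R E)) (ring_via (\<lambda>a. a) (ob R E))"
    by (simp add: semilinear_def)
  moreover have "(\<lambda>a. a) \<in> carrier (dob A E) \<rightarrow> carrier (dob A E)"
    by simp
  ultimately have f': "?f \<in> hom (tensor_group (dob A E) (ring_via (\<lambda>a. a) (ob R E)) (dob N E))
      (tensor_group (dob A E) (ring_via (\<lambda>a. a) (ob R E)) (dob N' E))"
    "\<And>r n. \<lbrakk>r \<in> carrier (ob R E); n \<in> carrier (dob N E)\<rbrakk> \<Longrightarrow> ?f (tens N E r n) = tens N' E r (f E n)"
    using tensor_map_hom[OF s.tensor_product_axioms t.tensor_product_axioms _ residual_homD(2)[OF f
        E]] by simp_all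
  have "(\<lambda>a. a) \<in> ring_hom (ob R E) (ob R E)" by (intro ring_hom_memI) simp_all
  then have "?f \<in> semilinear (\<lambda>a. a) (ob R E) s.ext t.ext"
    using semilinear_hom_extI[OF s.scalar_extension_axioms t.scalar_extension_axioms _ _ f']
        residual_homD(3)[OF f E]
    by simp
  moreover have "theta_map T C R N N' f E = restrict ?f (carrier s.ext)"
    using E by (simp add: theta_map_def ob_theta restrict_def)
  ultimately show "theta_map T C R N N' f E
      \<in> semilinear (\<lambda>a. a) (ob R E) (ob (theta T C R N) E) (ob (theta T C R N') E)"
    and "\<lbrakk>r \<in> carrier (ob R E); n \<in> carrier (dob N E)\<rbrakk>
      \<Longrightarrow> theta_map T C R N N' f E (tens N E r n) = tens N' E r (f E n)"
    using semilinear_restrict[OF _ s.ext.module_axioms] by (simp_all add: ob_theta f'(2))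
qed

lemma theta_map_extensional:
  "theta_map T C R N N' f \<in> (\<Pi>\<^sub>E E\<in>pts T. extensional (carrier (ob (theta T C R N) E)))"
  by (auto simp: theta_map_def)

lemma theta_map_hom:
  assumes N: "residual_module T C A N" and N': "residual_module T C A N'"
    and f: "f \<in> residual_hom T C A N N'"
  shows "theta_map T C R N N' f \<in> equivariant_hom T R (theta T C R N) (theta T C R N')"
proof (rule equivariant_homI[OF theta_map_extensional])
  note tl = theta_map(1)[OF N N' f] and tp = theta_map(2)[OF N N' f]
  show "theta_map T C R N N' f E \<in> semilinear (\<lambda>a. a) (ob R E) (ob (theta T C R N) E) (ob
      (theta T C R N') E)"
    if "E \<in> pts T" for E
    using that by (rule tl)
  fix E w x assume E: "E \<in> pts T" and w: "w \<in> carrier (grp T)"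
      and x: "x \<in> carrier (ob (theta T C R N) E)"
  have E': "act T E w \<in> pts T" using E w by (rule act_closed)
  note wl = theta_wmap(1)[OF N E w] and wl' = theta_wmap(1)[OF N' E w]
  from N E x show "theta_map T C R N N' f (act T E w) (wmap (theta T C R N) w E x) =
      wmap (theta T C R N') w E (theta_map T C R N N' f E x)"
  proof (induction rule: theta_induct)
    case (pure r n)
    then show ?case
      using residual_homD(4)[OF f leq_refl[OF E] w, of n]
      by (simp add: tp E E' theta_wmap(2)[OF N E w] theta_wmap(2)[OF N' E w] R.wmap_closed w
          dmap_refl_closed[OF N E w] residual_homD(3)[OF f])
  next
    case (add x y)
    then show ?case
      by (simp add: semilinear_add[OF tl[OF E]] semilinear_add[OF tl[OF E']] semilinear_add[OF wl]
          semilinear_add[OF wl'] semilinear_closed[OF tl[OF E]] semilinear_closed[OF wl])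
  qed
next
  note tl = theta_map(1)[OF N N' f] and tp = theta_map(2)[OF N N' f]
  fix F E x assume FE: "(F, E) \<in> leq T" and x: "x \<in> carrier (ob (theta T C R N) F)"
  have F: "F \<in> pts T" and E: "E \<in> pts T" using FE by (auto dest: leq_pts)
  note sl = theta_smap(1)[OF N FE] and sl' = theta_smap(1)[OF N' FE]
  from N F x show "theta_map T C R N N' f E (smap (theta T C R N) F E x) =
      smap (theta T C R N') F E (theta_map T C R N N' f F x)"
  proof (induction rule: theta_induct)
    case (pure r n)
    then show ?case
      using residual_homD(4)[OF f FE W.one_closed, of n]
      by (simp add: tp F E theta_smap(2)[OF N FE] theta_smap(2)[OF N' FE] R.smap_closed FE
          dmap_one_closed[OF N FE] residual_homD(3)[OF f] act_one)
  next
    case (add x y)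
    then show ?case
      by (simp add: semilinear_add[OF tl[OF E]] semilinear_add[OF tl[OF F]] semilinear_add[OF sl]
          semilinear_add[OF sl'] semilinear_closed[OF tl[OF F]] semilinear_closed[OF sl])
  qed
qed

lemma functor_theta:
  "cat_functor (residual_modules T C A :: (('s, 'w, 'r, 'n) residual_module_diagram, 's \<Rightarrow> 'n \<Rightarrow> 'n) cat)
    (equivariant_modules T R) (theta T C R) (theta_map T C R)"
proof (intro cat_functor.intro category_equivariant_modules category_residual_modules
    cat_functor_axioms.intro;
    simp only: equivariant_modules_def residual_modules_def cat.simps mem_Collect_eq)
  fix N N' N'' :: "('s, 'w, 'r, 'n) residual_module_diagram" and f g
  assume N: "residual_module T C A N"
  show "equivariant_module T R (theta T C R N)"
    using N by (rule equivariant_module_theta)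
  note id = residual_hom_id[OF N]
  show "theta_map T C R N N (family_id T (\<lambda>E. carrier (dob N E))) = family_id T (\<lambda>E. carrier (ob
      (theta T C R N) E))"
  proof (rule family_eqI[OF theta_map_extensional family_id_extensional])
    fix E x assume E: "E \<in> pts T" and x: "x \<in> carrier (ob (theta T C R N) E)"
    from N E x have "theta_map T C R N N (family_id T (\<lambda>E. carrier (dob N E))) E x = x"
      by (induction rule: theta_induct)
         (simp_all add: theta_map(2)[OF N N id] E family_id_apply semilinear_add[OF theta_map(1)[OF
             N N id E]])
    then show "theta_map T C R N N (family_id T (\<lambda>E. carrier (dob N E))) E x =
        family_id T (\<lambda>E. carrier (ob (theta T C R N) E)) E x"
      using E x by (simp add: family_id_apply)
  qed
  assume N': "residual_module T C A N'" and f: "f \<in> residual_hom T C A N N'"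
  show "theta_map T C R N N' f \<in> equivariant_hom T R (theta T C R N) (theta T C R N')"
    using N N' f by (rule theta_map_hom)
  assume N'': "residual_module T C A N''" and g: "g \<in> residual_hom T C A N' N''"
  note gf = residual_hom_comp[OF N f g]
  show "theta_map T C R N N'' (family_comp T (\<lambda>E. carrier (dob N E)) g f) =
      family_comp T (\<lambda>E. carrier (ob (theta T C R N) E)) (theta_map T C R N' N'' g)
          (theta_map T C R N N' f)"
  proof (rule family_eqI[OF theta_map_extensional family_comp_extensional])
    fix E x assume E: "E \<in> pts T" and x: "x \<in> carrier (ob (theta T C R N) E)"
    from N E x have "theta_map T C R N N'' (family_comp T (\<lambda>E. carrier (dob N E)) g f) E x =
        theta_map T C R N' N'' g E (theta_map T C R N N' f E x)"
      by (induction rule: theta_induct)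
         (simp_all add: theta_map(2)[OF N N'' gf E] theta_map(2)[OF N N' f E] theta_map(2)[OF N' N'' g E]
           family_comp_apply E residual_homD(3)[OF f E] semilinear_add[OF theta_map(1)[OF N N'' gf E]]
           semilinear_add[OF theta_map(1)[OF N N' f E]] semilinear_add[OF theta_map(1)[OF N' N'' g E]]
           semilinear_closed[OF theta_map(1)[OF N N' f E]])
    then show "theta_map T C R N N'' (family_comp T (\<lambda>E. carrier (dob N E)) g f) E x =
        family_comp T (\<lambda>E. carrier (ob (theta T C R N) E)) (theta_map T C R N' N'' g)
            (theta_map T C R N N' f) E x"
      using E x by (simp add: family_comp_apply)
  qed
qed

end

section \<open>The adjunction\<close>

context fixed_point_setting
begin

section \<open>The unit\<close>

lemma unit_map_apply:
  "\<lbrakk>E \<in> pts T; n \<in> carrier (dob N E)\<rbrakk> \<Longrightarrow> unit_map T C R N E n = tens N E \<one>\<^bsub>ob R E\<^esub> n"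
  by (simp add: unit_map_def)

lemma one_closed_R: "E \<in> pts T \<Longrightarrow> \<one>\<^bsub>ob R E\<^esub> \<in> carrier (ob R E)"
  using R.cring_ob[of E] by (simp add: cring.cring_simprules)

lemma unit_map_extensional: "unit_map T C R N \<in> (\<Pi>\<^sub>E E\<in>pts T. extensional (carrier (dob N E)))"
  by (auto simp: unit_map_def)

text \<open>The class of \<open>w\<close> is that of the identity, so \<open>w\<close> acts on the
  ring factor alone. This gives invariance of \<open>1 \<otimes> n\<close>, and it is the shape of
  action required by the averaging argument.\<close>

lemma wmap_unit_fixed:
  assumes N: "residual_module T C A N" and E: "E \<in> pts T" and n: "n \<in> carrier (dob N E)"
    and w: "w \<in> cgroup T C E" and r: "r \<in> carrier (ob R E)"
  shows "wmap (theta T C R N) w E (tens N E r n) = tens N E (wmap R w E r) n"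
proof -
  interpret N: residual_module T C A N by (rule N)
  show ?thesis
    using theta_wmap(2)[OF N E cgroup_carrier[OF w] r n] E w n
    by (simp add: dclass_cgroup N.dmap_id cgroup_act)
qed

lemma unit_map_fixed:
  assumes N: "residual_module T C A N" and E: "E \<in> pts T" and n: "n \<in> carrier (dob N E)"
  shows "tens N E \<one>\<^bsub>ob R E\<^esub> n \<in> fixed_points T C (theta T C R N) E"
  using wmap_unit_fixed[OF N E n _ one_closed_R[OF E]] ring_hom_one[OF R.wmap_ring_hom[OF E
      cgroup_carrier]]
  by (simp add: fixed_points_def tens_closed[OF N E one_closed_R[OF E] n] cgroup_act)

lemma unit_map_hom:
  assumes N: "residual_module T C A N"
  shows "unit_map T C R N \<in> residual_hom T C A N (Psi T C (theta T C R N))"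
proof (rule residual_homI[OF unit_map_extensional])
  interpret N: residual_module T C A N by (rule N)
  fix E assume E: "E \<in> pts T"
  interpret s: scalar_extension "dob A E" "ob R E" "dob N E" by (rule scalar_extension_N[OF N E])
  note u = s.unit_semilinear
  show "unit_map T C R N E \<in> semilinear (\<lambda>a. a) (dob A E) (dob N E) (dob (Psi T C (theta T C R N)) E)"
  proof (rule semilinearI)
    fix x y assume "x \<in> carrier (dob N E)" "y \<in> carrier (dob N E)"
    then show "unit_map T C R N E (x \<oplus>\<^bsub>dob N E\<^esub> y) =
        unit_map T C R N E x \<oplus>\<^bsub>dob (Psi T C (theta T C R N)) E\<^esub> unit_map T C R N E y"
      using semilinear_add[OF u] by (simp add: unit_map_apply E ob_theta)
  next
    fix a x assume "a \<in> carrier (dob A E)" "x \<in> carrier (dob N E)"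
    then show "unit_map T C R N E (a \<odot>\<^bsub>dob N E\<^esub> x) =
        a \<odot>\<^bsub>dob (Psi T C (theta T C R N)) E\<^esub> unit_map T C R N E x"
      using semilinear_smult[OF u, of a x] s.N.smult_closed[of a x]
          by (simp add: unit_map_apply E ob_theta)
  qed (simp add: unit_map_apply E unit_map_fixed[OF N])
next
  fix \<sigma> \<tau> v x assume st: "(\<sigma>, \<tau>) \<in> leq T" and v: "v \<in> carrier (grp T)" and x: "x \<in> carrier (dob N \<sigma>)"
  have pts: "\<sigma> \<in> pts T" "\<tau> \<in> pts T" "act T \<tau> v \<in> pts T"
    using st v by (auto intro: leq_pts act_closed)
  interpret \<theta>: closed_diagram T C "theta T C R N"
    using equivariant_module_theta[OF N] by (rule equivariant_module_closed)
  show "unit_map T C R N (act T \<tau> v) (dmap N \<sigma> \<tau> (dclass T C \<tau> v) x) =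
      dmap (Psi T C (theta T C R N)) \<sigma> \<tau> (dclass T C \<tau> v) (unit_map T C R N \<sigma> x)"
    \<comment> \<open>Evaluated at \<open>v\<close>, the right-hand side is \<open>1\<close>
      tensored with the image of \<open>x\<close> under \<open>(i, [1])\<close> and then
      \<open>(1, [v])\<close>; \<open>dmap_factor\<close> rejoins the two.\<close>
    using \<theta>.dmap_fixed[OF st v unit_map_fixed[OF N pts(1) x], folded Psi_def]
    by (simp add: unit_map_apply pts x dmap_closed[OF N st v] theta_smap(2)[OF N st]
        theta_wmap(2)[OF N pts(2) v]
        one_closed_R ring_hom_one[OF R.smap_ring_hom[OF st]] ring_hom_one[OF
            R.wmap_ring_hom[OF pts(2) v]]
        dmap_one_closed[OF N st] dmap_factor[OF N st v])
qed

text \<open>The restriction made by \<open>Psi_map\<close> does no harm because the unit lands in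
  the invariants. With this formula, injectivity and both naturality laws become evaluations at
  \<open>1 \<otimes> n\<close>.\<close>

lemma adjunct_apply:
  assumes N: "residual_module T C A N" and E: "E \<in> pts T" and n: "n \<in> carrier (dob N E)"
  shows "adjunct T C R N M f E n = f E (tens N E \<one>\<^bsub>ob R E\<^esub> n)"
  using assms by (simp add: adjunct_def family_comp_apply unit_map_apply Psi_map_apply unit_map_fixed)

lemma adjunct_extensional: "adjunct T C R N M f \<in> (\<Pi>\<^sub>E E\<in>pts T. extensional (carrier (dob N E)))"
  unfolding adjunct_def by (rule family_comp_extensional)

lemma adjunct_hom:
  assumes N: "residual_module T C A N" and M: "equivariant_module T R M"
    and f: "f \<in> equivariant_hom T R (theta T C R N) M"
  shows "adjunct T C R N M f \<in> residual_hom T C A N (Psi T C M)"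
  unfolding adjunct_def
  by (rule residual_hom_comp[OF N unit_map_hom[OF N] Psi_map_hom[OF equivariant_module_theta[OF N] M f]])

lemma adjunct_inj:
  assumes N: "residual_module T C A N"
  shows "inj_on (adjunct T C R N M) (equivariant_hom T R (theta T C R N) M)"
proof (rule inj_onI)
  fix f f' assume f: "f \<in> equivariant_hom T R (theta T C R N) M"
      and f': "f' \<in> equivariant_hom T R (theta T C R N) M"
    and eq: "adjunct T C R N M f = adjunct T C R N M f'"
  show "f = f'"
  proof (rule family_eqI[OF equivariant_homD(1)[OF f] equivariant_homD(1)[OF f']])
    fix E x assume E: "E \<in> pts T" and x: "x \<in> carrier (ob (theta T C R N) E)"
    show "f E x = f' E x"
      using scalar_extension.semilinear_ext_eqI[OF scalar_extension_N[OF N E]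
          equivariant_homD(2)[OF f E, unfolded ob_theta] equivariant_homD(2)[OF f' E, unfolded
              ob_theta] _ x[unfolded ob_theta]]
        adjunct_apply[OF N E, of _ M f] adjunct_apply[OF N E, of _ M f'] eq
      by simp
  qed
qed

text \<open>The preimage is \<open>r \<otimes> n \<mapsto> r g(n)\<close> at each object. That these
  maps form a morphism of diagrams is, on pure tensors, the compatibility of \<open>g\<close> with
  the residual maps, taken at the class of \<open>1\<close> for structure maps and at the identity
  of \<open>E\<close> for the maps of \<open>W\<close>.\<close>

lemma adjunct_surj:
  assumes N: "residual_module T C A N" and M: "equivariant_module T R M"
    and g: "g \<in> residual_hom T C A N (Psi T C M)"
  obtains f where "f \<in> equivariant_hom T R (theta T C R N) M" and "adjunct T C R N M f = g"
proof -
  interpret M: equivariant_module T R M by (rule M)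
  interpret M: closed_diagram T C M using M by (rule equivariant_module_closed)
  interpret N: residual_module T C A N by (rule N)
  have g_fixed: "g E n \<in> fixed_points T C M E" if "E \<in> pts T" "n \<in> carrier (dob N E)" for E n
    using residual_homD(3)[OF g that] by simp
  have g_closed: "g E n \<in> carrier (ob M E)" if "E \<in> pts T" "n \<in> carrier (dob N E)" for E n
    using M.fixed_pointsD(1)[OF g_fixed[OF that]] .
  have "\<exists>h. h \<in> semilinear (\<lambda>a. a) (ob R E) (ob (theta T C R N) E) (ob M E) \<and>
      (\<forall>r\<in>carrier (ob R E). \<forall>n\<in>carrier (dob N E). h (tens N E r n) = r \<odot>\<^bsub>ob M E\<^esub> g E n)"
    if E: "E \<in> pts T" for E
  proof -
    interpret s: scalar_extension "dob A E" "ob R E" "dob N E" by (rule scalar_extension_N[OF N E])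
    have "g E \<in> semilinear (\<lambda>a. a) (dob A E) (dob N E) (ob M E)"
      using residual_homD(2)[OF g E] M.fixed_pointsD(1)[of _ E] by (auto simp: semilinear_def)
    from s.ext_universal[OF M.module_ob[OF E] this] show ?thesis
      unfolding ob_theta by metis
  qed
  then obtain h where h: "\<And>E. E \<in> pts T \<Longrightarrow> h E
      \<in> semilinear (\<lambda>a. a) (ob R E) (ob (theta T C R N) E) (ob M E)"
    and h_pure: "\<And>E r n. \<lbrakk>E \<in> pts T; r \<in> carrier (ob R E); n \<in> carrier (dob N E)\<rbrakk>
      \<Longrightarrow> h E (tens N E r n) = r \<odot>\<^bsub>ob M E\<^esub> g E n"
    by metis
  \<comment> \<open>The universal property fixes \<open>h E\<close> only on the carrier; morphisms
    have to be extensional.\<close>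
  define f where "f = (\<lambda>E\<in>pts T. restrict (h E) (carrier (ob (theta T C R N) E)))"
  have f_apply: "f E x = h E x" if "E \<in> pts T" "x \<in> carrier (ob (theta T C R N) E)" for E x
    using that by (simp add: f_def)
  interpret \<theta>: closed_diagram T C "theta T C R N"
    using equivariant_module_theta[OF N] by (rule equivariant_module_closed)
  have "f \<in> equivariant_hom T R (theta T C R N) M"
  proof (rule equivariant_homI)
    show "f \<in> (\<Pi>\<^sub>E E\<in>pts T. extensional (carrier (ob (theta T C R N) E)))"
      by (auto simp: f_def)
    show "f E \<in> semilinear (\<lambda>a. a) (ob R E) (ob (theta T C R N) E) (ob M E)" if E: "E \<in> pts T" for E
      using semilinear_restrict[OF h[OF E]] equivariant_module.module_ob[OF
          equivariant_module_theta[OF N] E] E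
      by (simp add: f_def)
    fix F E x assume FE: "(F, E) \<in> leq T" and x: "x \<in> carrier (ob (theta T C R N) F)"
    have F: "F \<in> pts T" and E: "E \<in> pts T" using FE by (auto dest: leq_pts)
    note sl = theta_smap(1)[OF N FE] and ml = M.smap_semilinear[OF FE]
    from N F x have "h E (smap (theta T C R N) F E x) = smap M F E (h F x)"
    proof (induction rule: theta_induct)
      case (pure r n)
      \<comment> \<open>In \<open>\<Psi> M\<close> the class of \<open>1\<close> is evaluated at the
        representative \<open>1\<close>, which leaves just the structure map of
        \<open>M\<close>.\<close>
      have "g E (dmap N F E (dclass T C E \<one>\<^bsub>grp T\<^esub>) n) = smap M F E (g F n)"
        using residual_homD(4)[OF g FE W.one_closed pure(2)]
          M.dmap_fixed[OF FE W.one_closed g_fixed[OF F pure(2)], folded Psi_def]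
        by (simp add: act_one E M.wmap_one[OF E] M.smap_closed[OF FE] g_closed[OF F pure(2)])
      then show ?case
        using pure by (simp add: h_pure F E theta_smap(2)[OF N FE] R.smap_closed[OF FE]
            dmap_one_closed[OF N FE] semilinear_smult[OF ml] g_closed)
    next
      case (add x y)
      then show ?case
        by (simp add: semilinear_add[OF sl] semilinear_add[OF ml] semilinear_add[OF h[OF E]]
            semilinear_add[OF h[OF F]] semilinear_closed[OF sl] semilinear_closed[OF h[OF F]])
    qed
    then show "f E (smap (theta T C R N) F E x) = smap M F E (f F x)"
      using x by (simp add: f_apply E F \<theta>.smap_closed[OF FE])
  next
    fix E w x assume E: "E \<in> pts T" and w: "w \<in> carrier (grp T)"
        and x: "x \<in> carrier (ob (theta T C R N) E)"
    have E': "act T E w \<in> pts T" using E w by (rule act_closed)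
    note wl = theta_wmap(1)[OF N E w] and ml = M.wmap_semilinear[OF E w]
    from N E x have "h (act T E w) (wmap (theta T C R N) w E x) = wmap M w E (h E x)"
    proof (induction rule: theta_induct)
      case (pure r n)
      have "g (act T E w) (dmap N E E (dclass T C E w) n) = wmap M w E (g E n)"
        using residual_homD(4)[OF g leq_refl[OF E] w pure(2)]
          M.dmap_fixed[OF leq_refl[OF E] w g_fixed[OF E pure(2)], folded Psi_def]
        by (simp add: M.smap_id[OF E] g_closed[OF E pure(2)])
      then show ?case
        using pure by (simp add: h_pure E E' theta_wmap(2)[OF N E w] R.wmap_closed[OF E w]
            dmap_refl_closed[OF N E w] semilinear_smult[OF ml] g_closed)
    next
      case (add x y)
      then show ?case
        by (simp add: semilinear_add[OF wl] semilinear_add[OF ml] semilinear_add[OF h[OF E]]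
            semilinear_add[OF h[OF E']] semilinear_closed[OF wl] semilinear_closed[OF h[OF E]])
    qed
    then show "f (act T E w) (wmap (theta T C R N) w E x) = wmap M w E (f E x)"
      using x by (simp add: f_apply E E' \<theta>.wmap_closed[OF E w])
  qed
  moreover have "adjunct T C R N M f = g"
  proof (rule family_eqI[OF adjunct_extensional residual_homD(1)[OF g]])
    fix E n assume E: "E \<in> pts T" and n: "n \<in> carrier (dob N E)"
    interpret ME: Module.module "ob R E" "ob M E" by (rule M.module_ob[OF E])
    show "adjunct T C R N M f E n = g E n"
      by (simp add: adjunct_apply[OF N E n] f_apply E tens_closed[OF N E _ n] h_pure n g_closed)
  qed
  ultimately show thesis by (rule that)
qed

lemma adjunct_bij:
  assumes N: "residual_module T C A N" and M: "equivariant_module T R M"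
  shows "bij_betw (adjunct T C R N M) (equivariant_hom T R (theta T C R N) M) (residual_hom T C A N
      (Psi T C M))"
  unfolding bij_betw_def
proof (intro conjI adjunct_inj[OF N] equalityI image_subsetI adjunct_hom[OF N M])
  show "residual_hom T C A N (Psi T C M) \<subseteq> adjunct T C R N M ` equivariant_hom T R (theta T C R N) M"
    using adjunct_surj[OF N M] by blast
qed

text \<open>Both sides send \<open>n\<close> to \<open>f (1 \<otimes> h n)\<close>.\<close>

lemma adjunct_natural_left:
  assumes N: "residual_module T C A N" and N': "residual_module T C A N'"
    and h: "h \<in> residual_hom T C A N N'"
  shows "adjunct T C R N M (family_comp T (\<lambda>E. carrier (ob (theta T C R N) E)) f
      (theta_map T C R N N' h)) =
    family_comp T (\<lambda>E. carrier (dob N E)) (adjunct T C R N' M f) h"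
  by (rule family_eqI[OF adjunct_extensional family_comp_extensional])
     (simp add: adjunct_apply[OF N] adjunct_apply[OF N'] family_comp_apply tens_closed[OF N] one_closed_R
       theta_map(2)[OF N N' h] residual_homD(3)[OF h])

text \<open>Both sides send \<open>n\<close> to \<open>k (f (1 \<otimes> n))\<close>; the latter
  argument of \<open>k\<close> is invariant, so restricting \<open>k\<close> changes
  nothing.\<close>

lemma adjunct_natural_right:
  assumes N: "residual_module T C A N" and f: "f \<in> equivariant_hom T R (theta T C R N) M"
  shows "adjunct T C R N M' (family_comp T (\<lambda>E. carrier (ob (theta T C R N) E)) k f) =
    family_comp T (\<lambda>E. carrier (dob N E)) (Psi_map T C M M' k) (adjunct T C R N M f)"
  by (rule family_eqI[OF adjunct_extensional family_comp_extensional])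
     (simp add: adjunct_apply[OF N] family_comp_apply tens_closed[OF N] one_closed_R
       Psi_map_apply equivariant_hom_fixed[OF equivariant_module_theta[OF N] f] unit_map_fixed[OF N])

text \<open>This identifies the explicit map \<open>n \<mapsto> 1 \<otimes> n\<close> with the unit
  determined by the bijection of morphism sets.\<close>

lemma adjunct_id:
  assumes N: "residual_module T C A N"
  shows "adjunct T C R N (theta T C R N) (family_id T (\<lambda>E. carrier (ob (theta T C R N) E)))
      = unit_map T C R N"
  by (rule family_eqI[OF adjunct_extensional unit_map_extensional])
     (simp add: adjunct_apply[OF N] family_id_apply tens_closed[OF N] one_closed_R unit_map_apply)

end

section \<open>Invertible group order\<close>

context fixed_point_setting
begin

text \<open>A termwise inverse inherits linearity and compatibility with the residual maps: write
  each argument as \<open>f E x'\<close>, move the operation inside \<open>f\<close>, and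
  cancel.\<close>

lemma residual_iso_bij:
  assumes N: "residual_module T C A N" and f: "f \<in> residual_hom T C A N N'"
    and bij: "\<And>E. E \<in> pts T \<Longrightarrow> bij_betw (f E) (carrier (dob N E)) (carrier (dob N' E))"
  shows "f \<in> residual_iso T C A N N'"
proof -
  interpret N: residual_module T C A N by (rule N)
  define g where "g = (\<lambda>E\<in>pts T. restrict (the_inv_into (carrier (dob N E)) (f E)) (carrier (dob N' E)))"
  have gf: "g E (f E x) = x" if "E \<in> pts T" "x \<in> carrier (dob N E)" for E x
    using that bij[OF that(1)] residual_homD(3)[OF f that]
    by (simp add: g_def bij_betw_def the_inv_into_f_f)
  have surj: "\<exists>x\<in>carrier (dob N E). y = f E x" if "E \<in> pts T" "y \<in> carrier (dob N' E)" for E y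
    using bij[OF that(1)] that(2) by (auto simp: bij_betw_def)
  have "g \<in> residual_hom T C A N' N"
  proof (rule residual_homI)
    show "g \<in> (\<Pi>\<^sub>E E\<in>pts T. extensional (carrier (dob N' E)))"
      by (auto simp: g_def)
    fix E assume E: "E \<in> pts T"
    interpret NE: Module.module "dob A E" "dob N E" by (rule N.module_dob[OF E])
    note fl = residual_homD(2)[OF f E]
    show "g E \<in> semilinear (\<lambda>a. a) (dob A E) (dob N' E) (dob N E)"
    proof (rule semilinearI)
      fix x assume x: "x \<in> carrier (dob N' E)"
      then obtain x' where x': "x' \<in> carrier (dob N E)" "x = f E x'" using surj[OF E] by blast
      then show "g E x \<in> carrier (dob N E)" by (simp add: gf E)
      show "g E (a \<odot>\<^bsub>dob N' E\<^esub> x) = a \<odot>\<^bsub>dob N E\<^esub> g E x" if a: "a \<in> carrier (dob A E)" for a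
        using gf[OF E NE.smult_closed[OF a x'(1)]] semilinear_smult[OF fl a x'(1)] x' by (simp add: gf E)
      fix y assume "y \<in> carrier (dob N' E)"
      then obtain y' where y': "y' \<in> carrier (dob N E)" "y = f E y'" using surj[OF E] by blast
      show "g E (x \<oplus>\<^bsub>dob N' E\<^esub> y) = g E x \<oplus>\<^bsub>dob N E\<^esub> g E y"
        using gf[OF E NE.a_closed[OF x'(1) y'(1)]] semilinear_add[OF fl x'(1) y'(1)] x' y'
            by (simp add: gf E)
    qed
  next
    fix \<sigma> \<tau> v x assume st: "(\<sigma>, \<tau>) \<in> leq T" and v: "v \<in> carrier (grp T)" and x: "x \<in> carrier (dob N' \<sigma>)"
    have pts: "\<sigma> \<in> pts T" "act T \<tau> v \<in> pts T"
      using st v by (auto intro: leq_pts act_closed)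
    obtain x' where x': "x' \<in> carrier (dob N \<sigma>)" "x = f \<sigma> x'" using surj[OF pts(1) x] by blast
    show "g (act T \<tau> v) (dmap N' \<sigma> \<tau> (dclass T C \<tau> v) x) = dmap N \<sigma> \<tau> (dclass T C \<tau> v) (g \<sigma> x)"
      using residual_homD(4)[OF f st v x'(1)] gf[OF pts(2) dmap_closed[OF N st v x'(1)]] x'
          by (simp add: gf pts)
  qed
  moreover have "family_comp T (\<lambda>E. carrier (dob N E)) g f = family_id T (\<lambda>E. carrier (dob N E))"
    by (rule family_eqI[OF family_comp_extensional family_id_extensional])
       (simp add: family_comp_apply family_id_apply gf)
  moreover have "family_comp T (\<lambda>E. carrier (dob N' E)) f g = family_id T (\<lambda>E. carrier (dob N' E))"
  proof (rule family_eqI[OF family_comp_extensional family_id_extensional])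
    fix E x assume E: "E \<in> pts T" and x: "x \<in> carrier (dob N' E)"
    then show "family_comp T (\<lambda>E. carrier (dob N' E)) f g E x = family_id T (\<lambda>E. carrier (dob N' E)) E x"
      using surj[OF E x] by (auto simp: family_comp_apply family_id_apply gf)
  qed
  ultimately show ?thesis
    using f unfolding residual_iso_def by blast
qed

text \<open>The averaging argument is run with \<open>H\<close> the group \<open>W_E^e\<close>,
  acting on \<open>R(E)\<close> by \<open>wmap R\<close> and on the extension by \<open>wmap\<close>
  of \<open>\<theta>_* N\<close>. Its invariants in the two are \<open>R_inv(E)\<close> and
  \<open>\<Psi> (\<theta>_* N)\<close> at \<open>E\<close>.\<close>

lemma unit_map_bij:
  assumes fin: "finite (carrier (grp T))" and N: "residual_module T C A N" and E: "E \<in> pts T"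
    and unit: "[order (grp T)] \<cdot>\<^bsub>ob R E\<^esub> \<one>\<^bsub>ob R E\<^esub> \<in> Units (ob R E)"
  shows "bij_betw (unit_map T C R N E) (carrier (dob N E)) (carrier (dob (Psi T C (theta T C R N)) E))"
proof -
  interpret s: scalar_extension "dob A E" "ob R E" "dob N E" by (rule scalar_extension_N[OF N E])
  interpret H: subgroup "cgroup T C E" "grp T" by (rule cgroup_subgroup[OF E])
  \<comment> \<open>Lagrange exhibits \<open>|W_E^e|\<close> as a divisor of \<open>|W|\<close>,
    which makes it invertible in \<open>R(E)\<close> with inverse \<open>c\<close>.\<close>
  have "order (grp T) = card (rcosets\<^bsub>grp T\<^esub> (cgroup T C E)) * card (cgroup T C E)"
    using W.lagrange[OF H.subgroup_axioms] by simp
  with unit obtain c where c: "c \<in> carrier (ob R E)" "c \<otimes>\<^bsub>ob R E\<^esub> [card (cgroup T C E)]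
      \<cdot>\<^bsub>ob R E\<^esub> \<one>\<^bsub>ob R E\<^esub> = \<one>\<^bsub>ob R E\<^esub>"
    using s.B.nat_divisor_unit by metis
  have "bij_betw (s.pure \<one>\<^bsub>ob R E\<^esub>) (carrier (dob N E)) {x
      \<in> carrier s.ext. \<forall>h\<in>cgroup T C E. wmap (theta T C R N) h E x = x}"
  proof (rule s.unit_bij_invariants[OF _ _ _ _ _ c, where s = "\<lambda>w. wmap R w E" and m = "(\<otimes>\<^bsub>grp T\<^esub>)"])
    show "finite (cgroup T C E)"
      using fin H.subset by (rule finite_subset[rotated])
    show "wmap R h E \<in> ring_hom (ob R E) (ob R E)" if "h \<in> cgroup T C E" for h
      using R.wmap_ring_hom[OF E H.mem_carrier[OF that]] that by (simp add: cgroup_act)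
    show "carrier (dob A E) = {b \<in> carrier (ob R E). \<forall>h\<in>cgroup T C E. wmap R h E b = b}"
      by (simp add: fixed_points_def)
    show "wmap R k E (wmap R h E b) = wmap R (h \<otimes>\<^bsub>grp T\<^esub> k) E b"
      if "h \<in> cgroup T C E" "k \<in> cgroup T C E" "b \<in> carrier (ob R E)" for h k b
      using that R.wmap_mult[OF E, of h k b] by (simp add: cgroup_act)
    show "bij_betw (\<lambda>h. h \<otimes>\<^bsub>grp T\<^esub> k) (cgroup T C E) (cgroup T C E)" if "k \<in> cgroup T C E" for k
      using that by (intro bij_betwI[where g = "\<lambda>h. h \<otimes>\<^bsub>grp T\<^esub> inv\<^bsub>grp T\<^esub> k"]) (auto simp: W.m_assoc)
    show "wmap (theta T C R N) h E (x \<oplus>\<^bsub>s.ext\<^esub> y) = wmap (theta T C R N) h E x \<oplus>\<^bsub>s.ext\<^esub> wmap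
        (theta T C R N) h E y"
      if "h \<in> cgroup T C E" "x \<in> carrier s.ext" "y \<in> carrier s.ext" for h x y
      using semilinear_add[OF theta_wmap(1)[OF N E H.mem_carrier[OF that(1)]], of x y] that
      by (simp add: ob_theta cgroup_act)
    show "wmap (theta T C R N) h E (s.pure b n) = s.pure (wmap R h E b) n"
      if "h \<in> cgroup T C E" "b \<in> carrier (ob R E)" "n \<in> carrier (dob N E)" for h b n
      using wmap_unit_fixed[OF N E that(3,1,2)] .
  qed
  then show ?thesis
    unfolding Psi_sel fixed_points_def ob_theta[symmetric]
    by (rule bij_betw_cong[THEN iffD1, rotated]) (simp add: unit_map_apply E)
qed

end

theorem proposition5p9:
  fixes T :: "('s, 'w) poset_action"
    and C :: "('s \<times> 's \<times> 'w) set"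
    and R :: "('s, 'w, 'r) ring_diagram"
  assumes action: "poset_action T"
    and finite_group: "finite (carrier (grp T))"
    and component: "component_structure T C"
    and decreasing: "decreasing_structure T C"
    and normal: "normal_structure T C"
    and conjugation: "conjugation_invariant T C"
    and ring: "equivariant_ring T R"
  shows
    \<comment> \<open>the fixed rings form a diagram on the discrete residual\<close>
    "residual_ring T C (R_inv T C R) \<and>
    \<comment> \<open>the two functors\<close>
    cat_functor
      (equivariant_modules T R ::
        (('s, 'w, 'r, 'm) module_diagram, 's \<Rightarrow> 'm \<Rightarrow> 'm) cat)
      (residual_modules T C (R_inv T C R))
      (Psi T C) (Psi_map T C) \<and>
    cat_functor
      (residual_modules T C (R_inv T C R) ::
        (('s, 'w, 'r, 'n) residual_module_diagram, 's \<Rightarrow> 'n \<Rightarrow> 'n) cat)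
      (equivariant_modules T R)
      (theta T C R) (theta_map T C R) \<and>
    \<comment> \<open>the adjunction: a bijection natural in both variables, sending identities to the unit\<close>
    (\<forall>(N :: ('s, 'w, 'r, 'n) residual_module_diagram) (M :: ('s, 'w, 'r, 'm) module_diagram).
      residual_module T C (R_inv T C R) N \<longrightarrow> equivariant_module T R M \<longrightarrow>
      bij_betw (adjunct T C R N M)
        (equivariant_hom T R (theta T C R N) M)
        (residual_hom T C (R_inv T C R) N (Psi T C M))) \<and>
    (\<forall>(N :: ('s, 'w, 'r, 'n) residual_module_diagram)
      (N' :: ('s, 'w, 'r, 'n') residual_module_diagram)
      (M :: ('s, 'w, 'r, 'm) module_diagram) h f.
      residual_module T C (R_inv T C R) N \<longrightarrow> residual_module T C (R_inv T C R) N' \<longrightarrow>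
      equivariant_module T R M \<longrightarrow> h \<in> residual_hom T C (R_inv T C R) N N' \<longrightarrow>
      f \<in> equivariant_hom T R (theta T C R N') M \<longrightarrow>
      adjunct T C R N M
        (family_comp T (\<lambda>E. carrier (ob (theta T C R N) E)) f (theta_map T C R N N' h)) =
      family_comp T (\<lambda>E. carrier (dob N E)) (adjunct T C R N' M f) h) \<and>
    (\<forall>(N :: ('s, 'w, 'r, 'n) residual_module_diagram)
      (M :: ('s, 'w, 'r, 'm) module_diagram) (M' :: ('s, 'w, 'r, 'm') module_diagram) f k.
      residual_module T C (R_inv T C R) N \<longrightarrow> equivariant_module T R M \<longrightarrow>
      equivariant_module T R M' \<longrightarrow> f \<in> equivariant_hom T R (theta T C R N) M \<longrightarrow>
      k \<in> equivariant_hom T R M M' \<longrightarrow>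
      adjunct T C R N M' (family_comp T (\<lambda>E. carrier (ob (theta T C R N) E)) k f) =
      family_comp T (\<lambda>E. carrier (dob N E)) (Psi_map T C M M' k) (adjunct T C R N M f)) \<and>
    (\<forall>N :: ('s, 'w, 'r, 'n) residual_module_diagram.
      residual_module T C (R_inv T C R) N \<longrightarrow>
      adjunct T C R N (theta T C R N)
        (family_id T (\<lambda>E. carrier (ob (theta T C R N) E))) = unit_map T C R N) \<and>
    \<comment> \<open>the unit is an isomorphism when the group order is invertible\<close>
    ((\<forall>E\<in>pts T. [order (grp T)] \<cdot>\<^bsub>ob R E\<^esub> \<one>\<^bsub>ob R E\<^esub> \<in> Units (ob R E)) \<longrightarrow>
      (\<forall>N :: ('s, 'w, 'r, 'n) residual_module_diagram.
        residual_module T C (R_inv T C R) N \<longrightarrow>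
        unit_map T C R N \<in> residual_iso T C (R_inv T C R) N (Psi T C (theta T C R N))))"
proof -
  interpret fixed_point_setting T C R
    using action decreasing normal conjugation ring
    by (simp add: fixed_point_setting_def component_action_def component_action_axioms_def)
  have "unit_map T C R N \<in> residual_iso T C (R_inv T C R) N (Psi T C (theta T C R N))"
    if "\<forall>E\<in>pts T. [order (grp T)] \<cdot>\<^bsub>ob R E\<^esub> \<one>\<^bsub>ob R E\<^esub> \<in> Units (ob R E)"
      and N: "residual_module T C (R_inv T C R) N"
    for N :: "('s, 'w, 'r, 'n) residual_module_diagram"
  proof (rule residual_iso_bij[OF N unit_map_hom[OF N]])
    fix E assume E: "E \<in> pts T"
    show "bij_betw (unit_map T C R N E) (carrier (dob N E)) (carrier (dob (Psi T C (theta T C R N)) E))"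
      using that(1) E unit_map_bij[OF finite_group N E] by simp
  qed
  then show ?thesis
    using residual_ring_A functor_Psi functor_theta adjunct_bij adjunct_natural_left
      adjunct_natural_right adjunct_id
    by (intro conjI allI impI) assumption+
qed

end
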